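(* Fix $r_0,\delta,L,\Lambda$ and $d$. Let $G$ be a $d$-regular graph on $n$ vertices that is $(r_0,\delta)$-subcritical at scale $\ell=2\lceil\log n\rceil$. Let $\mathcal C$ be any consistent family of even cycles of $G$, each of length at most $L$, let $W=\operatorname{span}_{\mathbb F_2}\{\chi_C:C\in\mathcal C\}$ (possibly $W=\{0\}$), and suppose $\Lambda_W:=\max_{z\in W}|z|\le\Lambda$. Then some signing $\sigma$ in the solution family $\mathcal F$ of $\mathcal C$ (that is, some signing for which every cycle in $\mathcal C$ is unbalanced) satisfies $$\rho(A_\sigma)\le 2\sqrt{d-1}\,(1+\delta)^{4(r_0+2)}\Bigl(1+O_{r_0,\delta,\Lambda,d}\bigl(\tfrac{\log\log n}{\log n}\bigr)\Bigr),$$ where the implied constant depends only on $r_0,\delta,\Lambda,d$.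
   Context: $G=(V,E)$ is a finite simple connected graph. A signing is $\sigma\in\{\pm1\}^E$, encoded by $s\in\mathbb F_2^E$ with $\sigma_e=(-1)^{s_e}$; $A_\sigma$ is the signed adjacency matrix, with $uv$ entry $\sigma_{uv}$ if $uv\in E$ and $0$ otherwise; $\rho(A_\sigma)=\max_i|\lambda_i(A_\sigma)|$. For a cycle $C$, $\chi_C\in\mathbb F_2^E$ is the indicator vector of its edge set; $C$ is unbalanced under $\sigma$ if $s\cdot\chi_C=1$ in $\mathbb F_2$. A family $\mathcal C$ of even cycles (cycles of even length) is consistent if the system $s\cdot\chi_C=1$ $(C\in\mathcal C)$ over $\mathbb F_2$ has a solution. For $z\in\mathbb F_2^E$, $|z|$ is the number of nonzero coordinates. Closed non-backtracking walks of length $t$ in a graph are cyclic sequences with a marked start, i.e. sequences of directed edges $(e_1,\dots,e_t)$ with head of $e_i$ equal to tail of $e_{i+1}$ and $e_{i+1}\ne\bar e_i$ for all $i$ modulo $t$ ($\bar e$ is the reversal of $e$). For a non-negative integer $r_0$ and real $\delta\ge0$, $G$ is $(r_0,\delta)$-subcritical at scale $\ell$ if every connected subgraph $H$ of $G$ with minimum degree at least $2$ and at most $\ell$ edges satisfies: (i) the cycle rank $|E(H)|-|V(H)|+1$ of $H$ is at most $r_0$; and (ii) the number $c_H(t)$ of closed non-backtracking walks of length $t$ in $H$ satisfies $c_H(t)\le 2|E(H)|\,(t+1)^{3r_0}(1+\delta)^t$ for all $t\le 8\ell$. Logarithms are natural. *)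

theory Defs
  imports
    Complex_Main
    "HOL-Library.Z2"
    "HOL-Library.Function_Algebras"
    "Jordan_Normal_Form.Spectral_Radius"
begin

subsection \<open>Finite simple graphs\<close>

text \<open>A graph is a vertex set together with a set of two-element sets of vertices.\<close>

definition simple_graph :: "'a set \<Rightarrow> 'a set set \<Rightarrow> bool" where
  "simple_graph V E \<longleftrightarrow> finite V \<and> E \<subseteq> {e. e \<subseteq> V \<and> card e = 2}"

text \<open>Connected graphs are nonempty by convention.\<close>

definition graph_connected :: "'a set \<Rightarrow> 'a set set \<Rightarrow> bool" where
  "graph_connected V E \<longleftrightarrow>
     V \<noteq> {} \<and> (\<forall>u\<in>V. \<forall>v\<in>V. (u, v) \<in> {(x, y). {x, y} \<in> E}\<^sup>*)"

definition vdegree :: "'a set set \<Rightarrow> 'a \<Rightarrow> nat" where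
  "vdegree E v = card {e \<in> E. v \<in> e}"

definition regular_graph :: "nat \<Rightarrow> 'a set \<Rightarrow> 'a set set \<Rightarrow> bool" where
  "regular_graph d V E \<longleftrightarrow> (\<forall>v\<in>V. vdegree E v = d)"

definition subgraph_of :: "'a set \<Rightarrow> 'a set set \<Rightarrow> 'a set \<Rightarrow> 'a set set \<Rightarrow> bool" where
  "subgraph_of V' E' V E \<longleftrightarrow> V' \<subseteq> V \<and> E' \<subseteq> E \<and> simple_graph V' E'"

definition cycle_rank :: "'a set \<Rightarrow> 'a set set \<Rightarrow> int" where
  "cycle_rank V E = int (card E) - int (card V) + 1"

text \<open>
  A cycle, being a subgraph without isolated vertices, is represented by its edge set \<open>C\<close>;
  its length is \<open>card C\<close>.
\<close>

definition is_cycle :: "'a set set \<Rightarrow> 'a set set \<Rightarrow> bool" where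
  "is_cycle E C \<longleftrightarrow> C \<subseteq> E \<and>
     (\<exists>vs. distinct vs \<and> length vs \<ge> 3 \<and>
        C = {{vs ! i, vs ! (Suc i mod length vs)} | i. i < length vs})"

definition even_cycle :: "'a set set \<Rightarrow> 'a set set \<Rightarrow> bool" where
  "even_cycle E C \<longleftrightarrow> is_cycle E C \<and> even (card C)"

subsection \<open>Closed non-backtracking walks and subcriticality\<close>

text \<open>A directed edge is a pair (tail, head); its reversal swaps the components.\<close>

definition directed_edges :: "'a set set \<Rightarrow> ('a \<times> 'a) set" where
  "directed_edges E = {(u, v). {u, v} \<in> E}"

definition closed_nb_walks :: "'a set set \<Rightarrow> nat \<Rightarrow> ('a \<times> 'a) list set" where
  "closed_nb_walks E t =
     {es. length es = t \<and> set es \<subseteq> directed_edges E \<and>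
        (\<forall>i<t. snd (es ! i) = fst (es ! (Suc i mod t)) \<and>
               es ! (Suc i mod t) \<noteq> prod.swap (es ! i))}"

definition subcritical :: "nat \<Rightarrow> real \<Rightarrow> nat \<Rightarrow> 'a set \<Rightarrow> 'a set set \<Rightarrow> bool" where
  "subcritical r0 \<delta> l V E \<longleftrightarrow>
     (\<forall>V' E'. subgraph_of V' E' V E \<longrightarrow> graph_connected V' E' \<longrightarrow>
        (\<forall>v\<in>V'. vdegree E' v \<ge> 2) \<longrightarrow> card E' \<le> l \<longrightarrow>
        cycle_rank V' E' \<le> int r0 \<and>
        (\<forall>t \<le> 8 * l. real (card (closed_nb_walks E' t))
            \<le> 2 * real (card E') * (real t + 1) ^ (3 * r0) * (1 + \<delta>) ^ t))"

subsection \<open>Vectors over the two-element field\<close>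

text \<open>
  A vector indexed by the edge set \<open>E\<close> is a function into \<^typ>\<open>bit\<close>; only its values on \<open>E\<close>
  matter. The indicator vectors below, and hence their linear combinations, vanish off \<open>E\<close>.
\<close>

global_interpretation F2: vector_space "\<lambda>(c::bit) (x :: 'b \<Rightarrow> bit) i. c * x i"
  by unfold_locales
    (simp_all only: fun_eq_iff plus_fun_apply distrib_left distrib_right mult.assoc mult_1_left simp_thms)

definition chi :: "'a set set \<Rightarrow> 'a set \<Rightarrow> bit" where
  "chi C e = (if e \<in> C then 1 else 0)"

definition dot :: "'a set set \<Rightarrow> ('a set \<Rightarrow> bit) \<Rightarrow> ('a set \<Rightarrow> bit) \<Rightarrow> bit" where
  "dot E s z = (\<Sum>e\<in>E. s e * z e)"

definition weight :: "'a set set \<Rightarrow> ('a set \<Rightarrow> bit) \<Rightarrow> nat" where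
  "weight E z = card {e \<in> E. z e \<noteq> 0}"

definition cycle_span :: "'a set set set \<Rightarrow> ('a set \<Rightarrow> bit) set" where
  "cycle_span \<C> = F2.span (chi ` \<C>)"

definition max_weight :: "'a set set \<Rightarrow> ('a set \<Rightarrow> bit) set \<Rightarrow> nat" where
  "max_weight E W = Max (weight E ` W)"

definition consistent :: "'a set set \<Rightarrow> 'a set set set \<Rightarrow> bool" where
  "consistent E \<C> \<longleftrightarrow> (\<exists>s. \<forall>C\<in>\<C>. dot E s (chi C) = 1)"

subsection \<open>Signings\<close>

definition signing :: "'a set set \<Rightarrow> ('a set \<Rightarrow> real) \<Rightarrow> bool" where
  "signing E \<sigma> \<longleftrightarrow> (\<forall>e\<in>E. \<sigma> e = 1 \<or> \<sigma> e = -1)"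

text \<open>The vector \<open>s\<close> with \<open>\<sigma> e = (-1) ^ s e\<close> on \<open>E\<close>.\<close>

definition sign_code :: "('a set \<Rightarrow> real) \<Rightarrow> 'a set \<Rightarrow> bit" where
  "sign_code \<sigma> e = (if \<sigma> e = -1 then 1 else 0)"

definition unbalanced :: "'a set set \<Rightarrow> ('a set \<Rightarrow> real) \<Rightarrow> 'a set set \<Rightarrow> bool" where
  "unbalanced E \<sigma> C \<longleftrightarrow> dot E (sign_code \<sigma>) (chi C) = 1"

definition solution_family :: "'a set set \<Rightarrow> 'a set set set \<Rightarrow> ('a set \<Rightarrow> real) set" where
  "solution_family E \<C> = {\<sigma>. signing E \<sigma> \<and> (\<forall>C\<in>\<C>. unbalanced E \<sigma> C)}"

definition signed_adjacency :: "nat \<Rightarrow> nat set set \<Rightarrow> (nat set \<Rightarrow> real) \<Rightarrow> real mat" where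
  "signed_adjacency n E \<sigma> =
     Matrix.mat n n (\<lambda>(u, v). if {u, v} \<in> E then \<sigma> {u, v} else 0)"

definition rho :: "real mat \<Rightarrow> real" where
  "rho A = spectral_radius (map_mat complex_of_real A)"

end

theory Submission
  imports Defs "HOL-Analysis.L2_Norm"
begin

text \<open>
  Let \<open>P\<close> be the matrix of signed non-backtracking walks of length \<open>t\<close>. It is a Chebyshev-like polynomial
  in the signed adjacency matrix, so an eigenvalue \<open>sqrt (d - 1) * (z + 1 / z)\<close> with \<open>z \<ge> 1\<close> forces the sum of the
  squared entries of \<open>P\<close> to be at least \<open>((sqrt (d - 1) * z) ^ t / 2)\<^sup>2\<close>. Averaged over all solutions of the parity
  system, this sum is at most the number of pairs of walks with common ends whose joint parity vector lies in
  the span of the cycles, and the support of such a pair has at most \<open>t + \<Lambda>\<close> edges.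

  To count the pairs take \<open>t = N * q\<close> with \<open>q\<close> of order \<open>ln n\<close> and \<open>N\<close> of order \<open>sqrt (ln n / ln (ln n))\<close>. Cut into
  pieces of length \<open>q\<close>, any two pieces that meet span a graph of cycle rank at most \<open>r0\<close>. Hence new edges are traversed
  in \<open>O(N\<^sup>2)\<close> runs, which leaves \<open>(d - 1) ^ t\<close> possible supports up to a factor \<open>n ^ O(1)\<close>. Given the support, a piece
  is one of at most \<open>(1 + \<delta>) ^ (2 * q)\<close> walks, up to a power of \<open>ln n\<close>, between its two ends. Therefore
  \<open>z\<close> is at most \<open>(1 + \<delta>)\<^sup>2 * exp h\<close> with \<open>h = O(1 / N)\<close>, and the error in \<open>z + 1 / z\<close> is quadratic in \<open>h\<close>.
\<close>

section \<open>Excess of connected edge sets\<close>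

text \<open>Averaging loses a factor of order \<open>n ^ c\<close>, which disappears in the
  \<open>2 * t\<close>-th root only if \<open>t\<close> is much larger than \<open>ln n\<close>.
  Subcriticality, however, says nothing about subgraphs with more than \<open>l\<close>, roughly
  \<open>2 * ln n\<close>, edges, so the support of a pair of long walks is out of its reach. It is
  applied only to two pieces at a time (at most \<open>2 * q\<close> edges) and to one piece with
  its detours, for which \<open>(r0 + 2) * q <= l\<close> leaves room; this dictates
  \<open>q\<close>. Comparing every piece with all earlier ones is what makes the number of runs
  quadratic in \<open>N\<close>. Each run costs a power of \<open>ln n\<close>, so \<open>N\<close>
  is as large as \<open>N^2 * ln (ln n) = O(ln n)\<close> permits: the total loss stays
  \<open>n ^ O(1)\<close>, and \<open>h^2\<close> becomes the error of the theorem. It enters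
  squared because the linear terms of \<open>exp h\<close> and \<open>exp (- h)\<close> cancel in
  \<open>z + 1 / z\<close>. The factor \<open>(1 + \<delta>)^2\<close> arises because a detour
  closes up to a loop of twice its length, and \<open>2 * N\<close> pieces stand against a root of
  order \<open>2 * t\<close>; the power in the theorem is a weakening of it.\<close>

definition steps :: "(nat \<Rightarrow> 'a) \<Rightarrow> nat \<Rightarrow> nat \<Rightarrow> 'a set set" where
  "steps f a b = (\<lambda>i. {f i, f (Suc i)}) ` {a..<b}"

text \<open>With the vertex set read off from the edges, \<open>excess Q + 1\<close> is the
  \<open>cycle_rank\<close> that subcriticality bounds by \<open>r0\<close>. The constant is left
  out since mostly increments matter.\<close>

definition excess :: "'a set set \<Rightarrow> int" where
  "excess Q = int (card Q) - int (card (\<Union>Q))"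

text \<open>Connectivity of a bare edge set. Unlike \<open>graph_connected\<close> it admits the
  empty set, from which the unions of walks are built up.\<close>

definition linked :: "'a set set \<Rightarrow> bool" where
  "linked Q \<longleftrightarrow> (\<forall>u\<in>\<Union>Q. \<forall>v\<in>\<Union>Q. (u, v) \<in> {(x, y). {x, y} \<in> Q}\<^sup>*)"

lemma steps_empty [simp]: "steps f a a = {}"
  by (simp add: steps_def)

lemma steps_Suc: "a \<le> b \<Longrightarrow> steps f a (Suc b) = insert {f b, f (Suc b)} (steps f a b)"
  by (simp add: steps_def atLeastLessThanSuc)

lemma finite_steps [simp]: "finite (steps f a b)"
  by (simp add: steps_def)

lemma finite_Union_steps [simp]: "finite (\<Union>(steps f a b))"
  by (auto simp: steps_def)

lemma steps_mono: "a' \<le> a \<Longrightarrow> b \<le> b' \<Longrightarrow> steps f a b \<subseteq> steps f a' b'"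
  unfolding steps_def by (intro image_mono) auto

lemma steps_split: "a \<le> b \<Longrightarrow> b \<le> c \<Longrightarrow> steps f a c = steps f a b \<union> steps f b c"
  unfolding steps_def image_Un[symmetric] by (simp add: ivl_disj_un)

lemma card_steps: "card (steps f a b) \<le> b - a"
  unfolding steps_def by (rule order_trans[OF card_image_le]) auto

lemma in_stepsI: "a \<le> i \<Longrightarrow> i < b \<Longrightarrow> {f i, f (Suc i)} \<in> steps f a b"
  by (simp add: steps_def)

lemma start_in_steps: "a < b \<Longrightarrow> f a \<in> \<Union>(steps f a b)"
  by (force simp: steps_def)

text \<open>An edge at an old vertex brings at most one new vertex, and so pays for it.\<close>

lemma excess_insert:
  assumes "finite Q" "finite (\<Union>Q)" "x \<in> \<Union>Q"
  shows "excess Q \<le> excess (insert {x, y} Q)"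
proof (cases "{x, y} \<in> Q")
  case True
  then show ?thesis by (simp add: insert_absorb)
next
  case False
  have "\<Union>(insert {x, y} Q) = insert y (\<Union>Q)" using assms(3) by auto
  then show ?thesis using assms False
    by (simp add: excess_def card_insert_if)
qed

lemma excess_insert_old:
  assumes "finite Q" "x \<in> \<Union>Q" "y \<in> \<Union>Q" "{x, y} \<notin> Q"
  shows "excess (insert {x, y} Q) = excess Q + 1"
proof -
  have "\<Union>(insert {x, y} Q) = \<Union>Q" using assms by auto
  then show ?thesis using assms by (simp add: excess_def)
qed

lemma mem_Union_steps:
  assumes "f a \<in> \<Union>Q" "a \<le> b"
  shows "f b \<in> \<Union>(Q \<union> steps f a b)"
proof (cases "a = b")
  case True then show ?thesis using assms by simp
next
  case False
  then have "{f (b - 1), f (Suc (b - 1))} \<in> steps f a b" using assms by (intro in_stepsI) auto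
  moreover have "Suc (b - 1) = b" using False assms by simp
  ultimately show ?thesis by auto
qed

lemma excess_steps_mono:
  assumes "finite Q" "finite (\<Union>Q)" "f a \<in> \<Union>Q" "a \<le> b"
  shows "excess Q \<le> excess (Q \<union> steps f a b)"
  using assms(4)
proof (induction b rule: dec_induct)
  case base then show ?case by simp
next
  case (step b)
  have "excess (Q \<union> steps f a b) \<le> excess (insert {f b, f (Suc b)} (Q \<union> steps f a b))"
    using assms mem_Union_steps[where f=f and Q=Q, OF assms(3) step(1)] by (intro excess_insert) auto
  then show ?case using step by (simp add: steps_Suc)
qed

text \<open>Look at the last step that uses a new edge: since the walk does not backtrack, the vertex it
  leads to has been seen before, so this step adds an edge but no vertex.\<close>

lemma excess_nb_walk:
  assumes fin: "finite Q" "finite (\<Union>Q)" and a: "f a \<in> \<Union>Q" and ab: "a \<le> b"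
    and "end": "f b \<in> \<Union>Q \<or> {f (b - 1), f b} \<in> Q \<union> steps f a (b - 1)"
    and nb: "\<And>i. a \<le> i \<Longrightarrow> Suc i < b \<Longrightarrow> f i \<noteq> f (Suc (Suc i))"
    and new: "\<not> steps f a b \<subseteq> Q"
  shows "excess Q + 1 \<le> excess (Q \<union> steps f a b)"
proof -
  \<comment> \<open>These are the steps that draw an edge outside \<open>Q\<close> for the first
    time.\<close>
  define P where "P k \<longleftrightarrow> a \<le> k \<and> k < b \<and> {f k, f (Suc k)} \<notin> Q \<union> steps f a k" for k
  have stepsP: "steps f a m \<subseteq> Q" if "\<And>k. k < m \<Longrightarrow> \<not> P k" "a \<le> m" "m \<le> b" for m
    using that(2,1,3)
  proof (induction m rule: dec_induct)
    case (step m)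
    have "steps f a m \<subseteq> Q" using step by simp
    moreover have "{f m, f (Suc m)} \<in> Q \<union> steps f a m" using step by (auto simp: P_def)
    ultimately show ?case using step by (auto simp: steps_Suc)
  qed simp
  have exP: "\<exists>k. P k" using stepsP[of b] ab new by auto
  have bnd: "\<forall>k. P k \<longrightarrow> k \<le> b" by (auto simp: P_def)
  obtain k where k: "P k" and kmax: "\<And>j. P j \<Longrightarrow> j \<le> k"
    using GreatestI_ex_nat[OF exP] Greatest_le_nat[of P] bnd by blast
  let ?Qk = "Q \<union> steps f a k"
  have kab: "a \<le> k" "k < b" and knew: "{f k, f (Suc k)} \<notin> ?Qk" using k by (auto simp: P_def)
  have old: "f (Suc k) \<in> \<Union>?Qk"
  proof (cases "Suc k = b")
    case True
    with "end" have "f (Suc k) \<in> \<Union>Q \<or> {f k, f (Suc k)} \<in> ?Qk" by auto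
    with knew show ?thesis by auto
  next
    case False
    then have lt: "Suc k < b" using kab by simp
    \<comment> \<open>Step \<open>Suc k\<close> repeats an edge. It is not the edge of step
      \<open>k\<close>, since that would be backtracking, so it belongs to \<open>?Qk\<close> and
      carries the vertex \<open>f (Suc k)\<close>.\<close>
    have "\<not> P (Suc k)" using kmax by fastforce
    then have "{f (Suc k), f (Suc (Suc k))} \<in> Q \<union> steps f a (Suc k)" using lt kab by (auto simp: P_def)
    moreover have "{f (Suc k), f (Suc (Suc k))} \<noteq> {f k, f (Suc k)}" using nb[OF kab(1) lt] by (auto simp: doubleton_eq_iff)
    ultimately have "{f (Suc k), f (Suc (Suc k))} \<in> ?Qk" using kab by (auto simp: steps_Suc)
    then show ?thesis by blast
  qed
  have rest: "Q \<union> steps f a m = Q \<union> steps f a (Suc k)" if "Suc k \<le> m" "m \<le> b" for m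
    using that
  proof (induction m rule: dec_induct)
    case (step m)
    have "\<not> P m" using kmax[of m] step by auto
    then have "{f m, f (Suc m)} \<in> Q \<union> steps f a m" using step kab by (auto simp: P_def)
    then show ?case using step kab by (auto simp: steps_Suc)
  qed simp
  have "excess Q + 1 \<le> excess ?Qk + 1" using excess_steps_mono[of Q f a k, OF fin a kab(1)] by simp
  also have "\<dots> = excess (insert {f k, f (Suc k)} ?Qk)"
    using fin old knew mem_Union_steps[where a=a and b=k, of f Q, OF a kab(1)] by (intro excess_insert_old[symmetric]) auto
  also have "insert {f k, f (Suc k)} ?Qk = Q \<union> steps f a (Suc k)" using kab by (simp add: steps_Suc)
  also have "\<dots> = Q \<union> steps f a b" using rest[of b] kab by simp
  finally show ?thesis .
qed

lemma sym_adj_rel: "sym {(x, y). {x, y} \<in> Q}"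
  by (auto simp: sym_def insert_commute)

lemma linked_insert:
  assumes "linked Q" "Q = {} \<or> x \<in> \<Union>Q"
  shows "linked (insert {x, y} Q)"
proof -
  let ?R = "{(u, v). {u, v} \<in> insert {x, y} Q}"
  have s: "sym (?R\<^sup>*)" using sym_adj_rel by (rule sym_rtrancl)
  have x: "(x, u) \<in> ?R\<^sup>*" if "u \<in> \<Union>(insert {x, y} Q)" for u
  proof -
    have "u = x \<or> u = y \<or> u \<in> \<Union>Q \<and> x \<in> \<Union>Q" using that assms(2) by auto
    then consider "u = x" | "u = y" | "u \<in> \<Union>Q" "x \<in> \<Union>Q" by auto
    then show ?thesis
    proof cases
      case 3
      have "(x, u) \<in> {(u, v). {u, v} \<in> Q}\<^sup>*"
        by (rule assms(1)[unfolded linked_def, THEN bspec, OF 3(2), THEN bspec, OF 3(1)])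
      then show ?thesis by (rule rtrancl_mono[THEN subsetD, rotated]) auto
    qed auto
  qed
  show ?thesis unfolding linked_def
    using x s by (meson rtrancl_trans symD)
qed

lemma linked_steps:
  assumes "linked Q" "Q = {} \<or> f a \<in> \<Union>Q" "a \<le> b"
  shows "linked (Q \<union> steps f a b)"
  using assms(3)
proof (induction b rule: dec_induct)
  case base then show ?case using assms by simp
next
  case (step b)
  have "Q \<union> steps f a b = {} \<or> f b \<in> \<Union>(Q \<union> steps f a b)"
  proof (cases "Q = {}")
    case True
    then show ?thesis
    proof (cases "a = b")
      case False
      then have "f (Suc a) \<in> \<Union>(steps f a (Suc a))" "Suc a \<le> b" using step by (auto simp: steps_def)
      then have "f b \<in> \<Union>(steps f a (Suc a) \<union> steps f (Suc a) b)" by (intro mem_Union_steps)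
      then show ?thesis using step \<open>Suc a \<le> b\<close> steps_split[of a "Suc a" b f] by auto
    qed simp
  next
    case False
    then show ?thesis using mem_Union_steps[of f a Q b] assms step by auto
  qed
  then have "linked (insert {f b, f (Suc b)} (Q \<union> steps f a b))"
    using step by (intro linked_insert) auto
  then show ?case using step by (simp add: steps_Suc)
qed

lemma linked_walk: "linked (steps f a b)"
proof (cases "a \<le> b")
  case True
  have "linked ({} \<union> steps f a b)" using True by (intro linked_steps) (auto simp: linked_def)
  then show ?thesis by simp
next
  case False
  then show ?thesis by (simp add: steps_def linked_def)
qed

text \<open>The first step has one edge and at most two vertices, and every later edge is attached
  to an old vertex.\<close>

lemma excess_walk:
  assumes "a < b" shows "excess (steps f a b) \<ge> - 1"
proof -
  have "-1 \<le> excess (steps f a (Suc a))"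
    by (simp add: steps_Suc excess_def card_insert_if)
  also have "\<dots> \<le> excess (steps f a (Suc a) \<union> steps f (Suc a) b)"
    using assms by (intro excess_steps_mono) (auto simp: steps_Suc)
  also have "steps f a (Suc a) \<union> steps f (Suc a) b = steps f a b"
    using assms by (intro steps_split[symmetric]) auto
  finally show ?thesis .
qed

lemma vdegree_ge2_iff:
  assumes "finite Q"
  shows "vdegree Q v \<ge> 2 \<longleftrightarrow> (\<exists>e\<in>Q. \<exists>e'\<in>Q. e \<noteq> e' \<and> v \<in> e \<and> v \<in> e')"
proof -
  have "2 \<le> vdegree Q v \<longleftrightarrow> \<not> card {e\<in>Q. v \<in> e} \<le> Suc 0"
    unfolding vdegree_def by auto
  also have "\<dots> \<longleftrightarrow> (\<exists>e\<in>Q. \<exists>e'\<in>Q. e \<noteq> e' \<and> v \<in> e \<and> v \<in> e')"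
    using assms by (subst card_le_Suc0_iff_eq) auto
  finally show ?thesis .
qed

text \<open>A path can only enter and leave the leaf \<open>v\<close> through \<open>w\<close>, so
  the visit to \<open>v\<close> can be cut out.\<close>

lemma linked_remove_leaf:
  assumes "linked Q" and card2: "\<And>e. e \<in> Q \<Longrightarrow> card e = 2" and leaf: "\<And>e. e \<in> Q \<Longrightarrow> v \<in> e \<Longrightarrow> e = {v, w}"
  shows "linked (Q - {{v, w}})"
proof -
  let ?R = "{(x, y). {x, y} \<in> Q}" and ?R' = "{(x, y). {x, y} \<in> Q - {{v, w}}}"
  \<comment> \<open>To make the induction along the path work, a path that currently sits at
    \<open>v\<close> is represented by one that waits at \<open>w\<close>.\<close>
  have key: "(c \<noteq> v \<longrightarrow> (a, c) \<in> ?R'\<^sup>*) \<and> (c = v \<longrightarrow> (a, w) \<in> ?R'\<^sup>*)" if "(a, c) \<in> ?R\<^sup>*" "a \<noteq> v" for a c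
    using that(1)
  proof (induction rule: rtrancl_induct)
    case base
    then show ?case using that by simp
  next
    case (step c c2)
    have e: "{c, c2} \<in> Q" using step by simp
    have ne: "c \<noteq> c2" using card2[OF e] by auto
    consider "c = v" | "c2 = v" "c \<noteq> v" | "c \<noteq> v" "c2 \<noteq> v" by auto
    then show ?case
    proof cases
      case 1
      then have "c2 = w" using leaf[OF e] ne by (auto simp: doubleton_eq_iff)
      then show ?thesis using step 1 ne by auto
    next
      case 2
      then have "c = w" using leaf[OF e] ne by (auto simp: doubleton_eq_iff)
      then show ?thesis using step 2 by auto
    next
      case 3
      then have "(c, c2) \<in> ?R'" using e by (auto simp: doubleton_eq_iff)
      then show ?thesis using step 3 by (auto intro: rtrancl_into_rtrancl)
    qed
  qed
  have notv: "x \<noteq> v" if "x \<in> \<Union>(Q - {{v, w}})" for x using that leaf by auto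
  show ?thesis unfolding linked_def
    using assms(1) key notv unfolding linked_def by (metis (no_types, lifting) Diff_iff UnionE UnionI)
qed

text \<open>Subcriticality only speaks about minimum degree 2. Deleting a leaf edge removes one edge
  and at least one vertex, so it does not lower the excess; the induction ends at a set of minimum
  degree 2 or at a single edge, whose excess is -1.\<close>

lemma subcritical_excess:
  fixes E :: "'a set set"
  assumes sub: "subcritical r0 \<delta> l V E" and VE: "simple_graph V E"
    and "linked Q" "Q \<subseteq> E" "Q \<noteq> {}" "card Q \<le> l"
  shows "excess Q + 1 \<le> int r0"
  using assms(3-6)
proof (induction "card Q" arbitrary: Q rule: less_induct)
  case less
  have finE: "finite V" "E \<subseteq> Pow V" and card2: "\<And>e. e \<in> E \<Longrightarrow> card e = 2"
    using VE by (auto simp: simple_graph_def)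
  have finQ: "finite Q" using finE less by (meson finite_Pow_iff finite_subset)
  have finU: "finite (\<Union>Q)" 
    using finE less(3) by (metis Sup_subset_mono Union_Pow_eq finite_subset order_trans)
  have ne: "Q \<noteq> {}" using less by simp
  show ?case
    proof (cases "\<forall>v\<in>\<Union>Q. vdegree Q v \<ge> 2")
      case True
      have "subgraph_of (\<Union>Q) Q V E"
        using less finE finU card2 by (auto simp: subgraph_of_def simple_graph_def)
      moreover have "graph_connected (\<Union>Q) Q"
        using less ne card2 by (fastforce simp: graph_connected_def linked_def)
      ultimately have "cycle_rank (\<Union>Q) Q \<le> int r0"
        using sub True less unfolding subcritical_def by blast
      then show ?thesis by (simp add: cycle_rank_def excess_def)
    next
      case False
      then obtain v e where v: "e \<in> Q" "v \<in> e" "\<not> vdegree Q v \<ge> 2" by auto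
      then obtain w where w: "e = {v, w}" "v \<noteq> w"
        using card2 less by (metis card_2_iff insertE insert_commute singletonD subsetD)
      have leaf: "\<And>e'. e' \<in> Q \<Longrightarrow> v \<in> e' \<Longrightarrow> e' = {v, w}"
        using v w vdegree_ge2_iff[OF finQ] by metis
      let ?Q = "Q - {{v, w}}"
      have lk: "linked ?Q" using less leaf card2 by (intro linked_remove_leaf) auto
      have c: "card ?Q = card Q - 1" "card Q > 0" using v w finQ by (auto simp: card_gt_0_iff)
      have sub': "\<Union>?Q \<subseteq> \<Union>Q - {v}" using leaf by auto
      show ?thesis
      proof (cases "?Q = {}")
        case True
        then have "Q = {{v, w}}" using v w by auto
        then have "excess Q = -1" using w by (simp add: excess_def)
        then show ?thesis by simp
      next
        case False
        have "card (\<Union>?Q) \<le> card (\<Union>Q - {v})" using sub' finU by (intro card_mono) auto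
        moreover have "v \<in> \<Union>Q" using v by auto
        then have "card (\<Union>Q - {v}) = card (\<Union>Q) - 1" "card (\<Union>Q) > 0"
          using finU by (simp_all add: card_gt_0_iff card_Diff_singleton) blast
        ultimately have "excess Q \<le> excess ?Q" using c by (auto simp: excess_def)
        moreover have "card ?Q < card Q" "?Q \<subseteq> E" "card ?Q \<le> l" using c less(3,5) by auto
        then have "excess ?Q + 1 \<le> int r0" using less(1)[of ?Q] lk False by blast
        ultimately show ?thesis by simp
      qed
    qed
qed

section \<open>Non-backtracking walks between two vertices\<close>

text \<open>Open walks, in contrast to \<open>closed_nb_walks\<close>. Vertex lists are used so that
  a walk of length 0 still has a start and an end.\<close>

definition nbws :: "'a set set \<Rightarrow> nat \<Rightarrow> 'a \<Rightarrow> 'a list set" where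
  "nbws E t x = {xs. length xs = Suc t \<and> xs ! 0 = x \<and> (\<forall>i<t. {xs ! i, xs ! Suc i} \<in> E) \<and>
     (\<forall>i. Suc i < t \<longrightarrow> xs ! i \<noteq> xs ! Suc (Suc i))}"

lemma nbwsD:
  assumes "xs \<in> nbws E t x"
  shows "length xs = Suc t" "xs ! 0 = x" "\<And>i. i < t \<Longrightarrow> {xs ! i, xs ! Suc i} \<in> E"
    "\<And>i. Suc i < t \<Longrightarrow> xs ! i \<noteq> xs ! Suc (Suc i)"
  using assms by (auto simp: nbws_def)

lemma nbws_steps: "xs \<in> nbws E t x \<Longrightarrow> b \<le> t \<Longrightarrow> steps ((!) xs) a b \<subseteq> E"
  by (auto simp: steps_def nbws_def)

lemma set_nbws: 
  assumes "xs \<in> nbws E t x" shows "set xs \<subseteq> insert x (\<Union>E)"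
proof
  fix z assume "z \<in> set xs"
  then obtain i where i: "z = xs ! i" "i \<le> t" using nbwsD(1)[OF assms] by (auto simp: in_set_conv_nth)
  show "z \<in> insert x (\<Union>E)"
  proof (cases i)
    case 0 then show ?thesis using i nbwsD(2)[OF assms] by simp
  next
    case (Suc j) then show ?thesis using i nbwsD(3)[OF assms, of j] by auto
  qed
qed

lemma finite_nbws:
  assumes "finite (\<Union>E)" shows "finite (nbws E t x)"
proof (rule finite_subset)
  show "nbws E t x \<subseteq> {xs. set xs \<subseteq> insert x (\<Union>E) \<and> length xs = Suc t}"
  proof
    fix xs assume "xs \<in> nbws E t x"
    from set_nbws[OF this] nbwsD(1)[OF this]
    show "xs \<in> {xs. set xs \<subseteq> insert x (\<Union>E) \<and> length xs = Suc t}" by simp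
  qed
  show "finite {xs. set xs \<subseteq> insert x (\<Union>E) \<and> length xs = Suc t}"
    using assms by (intro finite_lists_length_eq) simp
qed

lemma simple_graphD:
  assumes "simple_graph V E"
  shows "finite V" "finite E" "finite (\<Union>E)" "\<Union>E \<subseteq> V" "\<And>e. e \<in> E \<Longrightarrow> card e = 2"
proof -
  show V: "finite V" and "\<Union>E \<subseteq> V" "\<And>e. e \<in> E \<Longrightarrow> card e = 2" using assms by (auto simp: simple_graph_def)
  then show "finite (\<Union>E)" by (meson finite_subset)
  then show "finite E" by (rule finite_UnionD)
qed

text \<open>The conditions on the first and the last step ensure that \<open>u\<close> followed by
  the reverse of \<open>u'\<close> backtracks at neither junction.\<close>

definition detours :: "'a set set \<Rightarrow> 'a list \<Rightarrow> nat \<Rightarrow> 'a list set" where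
  "detours E u s = {u' \<in> nbws E s (u ! 0). u' ! s = u ! s \<and> u' ! 1 \<noteq> u ! 1 \<and> u' ! (s - 1) \<noteq> u ! (s - 1)}"

lemma detours_steps: "w \<in> detours E u s \<Longrightarrow> steps ((!) w) 0 s \<subseteq> E"
  unfolding detours_def by (blast dest: nbws_steps[OF _ order_refl])

lemma steps_subsetD: "steps f 0 s \<subseteq> H \<Longrightarrow> i < s \<Longrightarrow> {f i, f (Suc i)} \<in> H"
  by (erule subsetD) (rule in_stepsI[OF le0])

lemma two_edgesI:
  assumes "{a, b} \<in> H" "{a', c} \<in> H" "a' = a" "b \<noteq> c"
  shows "\<exists>e\<in>H. \<exists>e'\<in>H. e \<noteq> e' \<and> a \<in> e \<and> a \<in> e'"
proof (intro bexI conjI)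
  show "{a, b} \<noteq> {a, c}" using assms(4) by (auto simp: doubleton_eq_iff)
qed (use assms in auto)

text \<open>Each detour that is not yet covered raises the excess, so the subcriticality bound on the cycle rank
  stops the union from growing after \<open>r0 + 1\<close> walks.\<close>

lemma card_union_detours:
  assumes sub: "subcritical r0 \<delta> l V E" and VE: "simple_graph V E"
    and s: "s \<ge> 1" "(r0 + 2) * s \<le> l" and u: "u \<in> nbws E s x"
    and F: "finite F" "F \<subseteq> detours E u s"
  shows "\<exists>j\<le>r0. card (steps ((!) u) 0 s \<union> (\<Union>w\<in>F. steps ((!) w) 0 s)) \<le> (j + 1) * s \<and>
    int j - 1 \<le> excess (steps ((!) u) 0 s \<union> (\<Union>w\<in>F. steps ((!) w) 0 s)) \<and>
    linked (steps ((!) u) 0 s \<union> (\<Union>w\<in>F. steps ((!) w) 0 s))"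
  using F
proof (induction F rule: finite_induct)
  case empty
  show ?case using card_steps[of "(!) u" 0 s] excess_walk[of 0 s "(!) u"] linked_walk s
    by (intro exI[of _ 0]) auto
next
  case (insert v F)
  define Q where "Q = steps ((!) u) 0 s \<union> (\<Union>w\<in>F. steps ((!) w) 0 s)"
  obtain j where j: "j \<le> r0" "card Q \<le> (j + 1) * s" "int j - 1 \<le> excess Q" "linked Q"
    using insert unfolding Q_def by auto
  have v: "v \<in> nbws E s (u ! 0)" "v ! s = u ! s" using insert by (auto simp: detours_def)
  have eq: "steps ((!) u) 0 s \<union> (\<Union>w\<in>insert v F. steps ((!) w) 0 s) = Q \<union> steps ((!) v) 0 s"
    by (auto simp: Q_def)
  have finQ: "finite Q" using insert by (auto simp: Q_def)
  have QE: "Q \<subseteq> E" unfolding Q_def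
    using insert(4) nbws_steps[OF u order_refl, of 0] by (blast dest: detours_steps)
  have finU: "finite (\<Union>Q)" using QE simple_graphD(3)[OF VE] by (meson Union_mono finite_subset)
  have "u ! 0 \<in> \<Union>(steps ((!) u) 0 s)" using start_in_steps[of 0 s "(!) u"] s by simp
  then have start: "v ! 0 \<in> \<Union>Q" using nbwsD(2)[OF v(1)] by (auto simp: Q_def)
  have "{u ! (s - 1), u ! Suc (s - 1)} \<in> steps ((!) u) 0 s" using s by (intro in_stepsI) auto
  then have "end": "v ! s \<in> \<Union>Q" using v s by (auto simp: Q_def)
  show ?case unfolding eq
  proof (cases "steps ((!) v) 0 s \<subseteq> Q")
    case True
    then show "\<exists>j\<le>r0. card (Q \<union> steps ((!) v) 0 s) \<le> (j + 1) * s \<and>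
      int j - 1 \<le> excess (Q \<union> steps ((!) v) 0 s) \<and> linked (Q \<union> steps ((!) v) 0 s)"
      unfolding Un_absorb2[OF True] using j by auto
  next
    case False
    have ex: "excess Q + 1 \<le> excess (Q \<union> steps ((!) v) 0 s)"
      using nbwsD(4)[OF v(1)] start "end" False finQ finU by (intro excess_nb_walk) auto
    have lk: "linked (Q \<union> steps ((!) v) 0 s)" using j start by (intro linked_steps) auto
    have "card (Q \<union> steps ((!) v) 0 s) \<le> card Q + s"
      using card_Un_le[of Q "steps ((!) v) 0 s"] card_steps[of "(!) v" 0 s] by simp
    then have c: "card (Q \<union> steps ((!) v) 0 s) \<le> (j + 2) * s" using j by simp
    \<comment> \<open>Even for \<open>j = r0\<close> the enlarged union must still fit into
      \<open>l\<close> edges, since only then does the rank bound exclude it. This is why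
      \<open>r0 + 2\<close> lengths are reserved.\<close>
    also have "\<dots> \<le> (r0 + 2) * s" using j by (intro mult_right_mono) auto
    finally have "card (Q \<union> steps ((!) v) 0 s) \<le> l" using s by simp
    then have "excess (Q \<union> steps ((!) v) 0 s) + 1 \<le> int r0"
      using lk QE nbws_steps[OF v(1), of s 0] False
      by (intro subcritical_excess[OF sub VE lk]) auto
    then show "\<exists>j\<le>r0. card (Q \<union> steps ((!) v) 0 s) \<le> (j + 1) * s \<and>
      int j - 1 \<le> excess (Q \<union> steps ((!) v) 0 s) \<and> linked (Q \<union> steps ((!) v) 0 s)"
      using j ex c lk by (intro exI[of _ "Suc j"]) auto
  qed
qed

text \<open>The closed walk \<open>u\<close> followed by the reverse of \<open>w\<close>, in the
  directed-edge format of \<open>closed_nb_walks\<close>.\<close>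

definition detour_loop :: "'a list \<Rightarrow> nat \<Rightarrow> 'a list \<Rightarrow> ('a \<times> 'a) list" where
  "detour_loop u s w = map (\<lambda>i. if i < s then (u ! i, u ! Suc i) else (w ! (2 * s - i), w ! (2 * s - i - 1))) [0..<2 * s]"

text \<open>Inside each half the property is inherited from \<open>u\<close> and \<open>w\<close>.
  At the turn after \<open>s\<close> steps and at the closing point it is given by the two
  inequalities in \<open>detours\<close>.\<close>

lemma detour_loop_closed_nb_walk:
  assumes u: "u \<in> nbws E s x" and w: "w \<in> detours E u s" and s: "s \<ge> 1"
    and H: "steps ((!) u) 0 s \<subseteq> H" "steps ((!) w) 0 s \<subseteq> H"
  shows "detour_loop u s w \<in> closed_nb_walks H (2 * s)"
proof -
  have wd: "w \<in> nbws E s (u ! 0)" "w ! s = u ! s" "w ! 1 \<noteq> u ! 1" "w ! (s - 1) \<noteq> u ! (s - 1)"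
    using w by (auto simp: detours_def)
  let ?e = "detour_loop u s w"
  have nth: "?e ! i = (if i < s then (u ! i, u ! Suc i) else (w ! (2 * s - i), w ! (2 * s - i - 1)))"
    if "i < 2 * s" for i using that by (simp add: detour_loop_def)
  have len: "length ?e = 2 * s" by (simp add: detour_loop_def)
  have mem: "?e ! i \<in> directed_edges H" if i: "i < 2 * s" for i
  proof (cases "i < s")
    case True
    then have "{u ! i, u ! Suc i} \<in> H" using H(1) by (meson in_stepsI le0 subsetD)
    then show ?thesis using True i by (simp add: nth directed_edges_def)
  next
    case False
    let ?m = "2 * s - i - 1"
    have "{w ! ?m, w ! Suc ?m} \<in> H" using H(2) False i by (intro subsetD[OF H(2)] in_stepsI) auto
    moreover have "Suc ?m = 2 * s - i" using i by simp
    ultimately show ?thesis using False i by (simp add: nth directed_edges_def insert_commute)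
  qed
  have adj: "snd (?e ! i) = fst (?e ! (Suc i mod (2 * s))) \<and> ?e ! (Suc i mod (2 * s)) \<noteq> prod.swap (?e ! i)"
    if i: "i < 2 * s" for i
  proof -
    consider "Suc i < s" | "Suc i = s" | "s \<le> i" "Suc i < 2 * s" | "Suc i = 2 * s" using i by linarith
    then show ?thesis
    proof cases
      case 1
      then show ?thesis using nbwsD(4)[OF u, of i] by (auto simp: nth)
    next
      case 2
      then have "i = s - 1" by simp
      then show ?thesis using 2 s wd by (auto simp: nth)
    next
      case 3
      define m where "m = 2 * s - i - 2"
      have m: "2 * s - i = Suc (Suc m)" "2 * s - i - 1 = Suc m" "2 * s - Suc i = Suc m" "2 * s - Suc i - 1 = m" "Suc m < s"
        using 3 by (auto simp: m_def)
      have "\<not> i < s" "\<not> Suc i < s" using 3 by auto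
      then show ?thesis using nbwsD(4)[OF wd(1) m(5)] 3 by (auto simp: nth m simp del: diff_diff_left)
    next
      case 4
      have "\<not> i < s" "2 * s - i = 1" using 4 s by auto
      then show ?thesis using 4 s wd nbwsD(2)[OF wd(1)] by (auto simp: nth)
    qed
  qed
  have "set ?e \<subseteq> directed_edges H" using mem len by (metis in_set_conv_nth subsetI)
  then show ?thesis unfolding closed_nb_walks_def using len adj by simp
qed

lemma inj_detour_loop: "inj_on (detour_loop u s) (detours E u s)"
proof (rule inj_onI)
  fix w w' assume w: "w \<in> detours E u s" "w' \<in> detours E u s" and eq: "detour_loop u s w = detour_loop u s w'"
  have "w ! m = w' ! m" if "m \<le> s" for m
  proof (cases "m = 0")
    case True then show ?thesis using w by (auto simp: detours_def nbws_def)
  next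
    case False
    then have "detour_loop u s w ! (2 * s - m) = detour_loop u s w' ! (2 * s - m)" "\<not> 2 * s - m < s" "2 * s - m < 2 * s" 
      "2 * s - (2 * s - m) = m"
      using eq that by auto
    then show ?thesis by (simp add: detour_loop_def)
  qed
  then show "w = w'" using w by (intro nth_equalityI) (auto simp: detours_def nbws_def)
qed

lemma finite_closed_nb_walks:
  assumes "finite (\<Union>H)" shows "finite (closed_nb_walks H t)"
proof -
  have "directed_edges H \<subseteq> \<Union>H \<times> \<Union>H" by (auto simp: directed_edges_def)
  then have "finite (directed_edges H)" using assms by (meson finite_SigmaI finite_subset)
  then show ?thesis
    by (intro finite_subset[OF _ finite_lists_length_eq[of "directed_edges H" t]])
      (auto simp: closed_nb_walks_def)
qed

text \<open>The union \<open>H\<close> of \<open>u\<close> and all its detours is connected, has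
  minimum degree 2 and at most \<open>l\<close> edges. Hence subcriticality bounds its closed walks
  of length \<open>2 * s\<close>, and \<open>detour_loop\<close> embeds the detours into
  these.\<close>

lemma card_detours:
  assumes sub: "subcritical r0 \<delta> l V E" and VE: "simple_graph V E" and \<delta>: "\<delta> \<ge> 0"
    and s: "s \<ge> 1" "(r0 + 2) * s \<le> l" and u: "u \<in> nbws E s x"
  shows "real (card (detours E u s)) \<le> 2 * real l * (2 * real s + 1) ^ (3 * r0) * (1 + \<delta>) ^ (2 * s)"
proof (cases "detours E u s = {}")
  case True
  then show ?thesis using \<delta> by simp
next
  case False
  let ?U = "detours E u s"
  define H where "H = steps ((!) u) 0 s \<union> (\<Union>w\<in>?U. steps ((!) w) 0 s)"
  have finU: "finite ?U"
    using finite_nbws[OF simple_graphD(3)[OF VE], of s "u ! 0"] by (simp add: detours_def)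
  obtain j where j: "j \<le> r0" "card H \<le> (j + 1) * s" "linked H"
    using card_union_detours[OF sub VE s u finU] unfolding H_def by auto
  have "(j + 1) * s \<le> (r0 + 2) * s" using j by (intro mult_right_mono) auto
  then have cardH: "card H \<le> l" using j s by simp
  have HE: "H \<subseteq> E" unfolding H_def
    using nbws_steps[OF u order_refl, of 0] by (blast dest: detours_steps)
  have finH: "finite H" "finite (\<Union>H)"
    using HE simple_graphD[OF VE] by (meson Union_mono finite_subset)+
  have uH: "steps ((!) u) 0 s \<subseteq> H" and wH: "\<And>w. w \<in> ?U \<Longrightarrow> steps ((!) w) 0 s \<subseteq> H"
    by (auto simp: H_def)
  \<comment> \<open>Without any detour the ends of \<open>u\<close> could be leaves. A single detour
    \<open>w0\<close> already gives both ends degree 2; an inner vertex gets it from the walk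
    passing through.\<close>
  obtain w0 where w0: "w0 \<in> ?U" using False by auto
  have w0d: "w0 ! 0 = u ! 0" "w0 ! s = u ! s" "w0 ! 1 \<noteq> u ! 1" "w0 ! (s - 1) \<noteq> u ! (s - 1)"
    using w0 by (auto simp: detours_def nbws_def)
  have ends: "\<exists>e\<in>H. \<exists>e'\<in>H. e \<noteq> e' \<and> u ! 0 \<in> e \<and> u ! 0 \<in> e'"
  proof -
    have "{u ! 0, u ! Suc 0} \<in> H" "{w0 ! 0, w0 ! Suc 0} \<in> H"
      using s steps_subsetD[OF uH, of 0] steps_subsetD[OF wH[OF w0], of 0] by auto
    then show ?thesis using w0d by (intro two_edgesI) auto
  qed
  have ends': "\<exists>e\<in>H. \<exists>e'\<in>H. e \<noteq> e' \<and> u ! s \<in> e \<and> u ! s \<in> e'"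
  proof -
    have "{u ! (s - 1), u ! Suc (s - 1)} \<in> H" "{w0 ! (s - 1), w0 ! Suc (s - 1)} \<in> H"
      using s steps_subsetD[OF uH, of "s - 1"] steps_subsetD[OF wH[OF w0], of "s - 1"] by auto
    then have "{u ! s, u ! (s - 1)} \<in> H" "{w0 ! s, w0 ! (s - 1)} \<in> H"
      using s by (simp_all add: insert_commute)
    then show ?thesis by (rule two_edgesI) (use w0d in auto)
  qed
  have mid: "\<exists>e\<in>H. \<exists>e'\<in>H. e \<noteq> e' \<and> w ! i \<in> e \<and> w ! i \<in> e'"
    if w: "w \<in> nbws E s (u ! 0)" "w ! s = u ! s" "steps ((!) w) 0 s \<subseteq> H" and i: "i \<le> s" for w i
  proof -
    consider "i = 0" | "i = s" | "0 < i" "i < s" using i by linarith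
    then show ?thesis
    proof cases
      case 1 then show ?thesis using ends nbwsD(2)[OF w(1)] by simp
    next
      case 2 then show ?thesis using ends' w by simp
    next
      case 3
      then obtain m where m: "i = Suc m" by (cases i) auto
      have "{w ! m, w ! Suc m} \<in> H" "{w ! Suc m, w ! Suc (Suc m)} \<in> H"
        using 3 m steps_subsetD[OF w(3), of m] steps_subsetD[OF w(3), of "Suc m"] by auto
      then have "{w ! Suc m, w ! m} \<in> H" "{w ! Suc m, w ! Suc (Suc m)} \<in> H"
        by (simp_all add: insert_commute)
      then show ?thesis unfolding m using nbwsD(4)[OF w(1), of m] 3 m by (intro two_edgesI) auto
    qed
  qed
  have deg: "vdegree H v \<ge> 2" if "v \<in> \<Union>H" for v
  proof -
    from that obtain e where e: "e \<in> H" "v \<in> e" by auto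
    then obtain w i where w: "w = u \<or> w \<in> ?U" "v = w ! i" "i \<le> s"
      unfolding H_def steps_def by force
    have "w \<in> nbws E s (u ! 0)" "w ! s = u ! s" "steps ((!) w) 0 s \<subseteq> H"
      using w uH wH u nbwsD(2)[OF u] by (auto simp: detours_def)
    then show ?thesis using mid w vdegree_ge2_iff[OF finH(1)] by blast
  qed
  have neH: "H \<noteq> {}" using ends by auto
  have "subgraph_of (\<Union>H) H V E"
    using HE finH simple_graphD[OF VE] by (auto simp: subgraph_of_def simple_graph_def)
  moreover have "graph_connected (\<Union>H) H"
    using j neH HE simple_graphD(5)[OF VE] by (fastforce simp: graph_connected_def linked_def)
  moreover have "2 * s \<le> 8 * l"
  proof -
    have "2 * s \<le> (r0 + 2) * s" by simp
    then show ?thesis using s by linarith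
  qed
  ultimately have c: "real (card (closed_nb_walks H (2 * s)))
      \<le> 2 * real (card H) * (real (2 * s) + 1) ^ (3 * r0) * (1 + \<delta>) ^ (2 * s)"
    using sub deg cardH unfolding subcritical_def by blast
  have "card ?U \<le> card (closed_nb_walks H (2 * s))"
    by (rule card_inj_on_le[OF inj_detour_loop])
      (use detour_loop_closed_nb_walk[OF u _ s(1) uH] wH finite_closed_nb_walks[OF finH(2)] in auto)
  then have "real (card ?U) \<le> 2 * real (card H) * (real (2 * s) + 1) ^ (3 * r0) * (1 + \<delta>) ^ (2 * s)"
    using c by linarith
  also have "\<dots> \<le> 2 * real l * (real (2 * s) + 1) ^ (3 * r0) * (1 + \<delta>) ^ (2 * s)"
    using cardH \<delta> by (intro mult_right_mono) auto
  finally show ?thesis by simp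
qed

text \<open>The 1 is for the reference walk, \<open>(t + 1)^2\<close> for the ends of the section
  where another walk deviates, and the last factor is the bound of \<open>card_detours\<close> with
  \<open>s = t\<close>.\<close>

definition walk_bound :: "nat \<Rightarrow> real \<Rightarrow> nat \<Rightarrow> nat \<Rightarrow> real" where
  "walk_bound r0 \<delta> l t = 1 + (real t + 1)\<^sup>2 * (2 * real l * (2 * real t + 1) ^ (3 * r0) * (1 + \<delta>) ^ (2 * t))"

text \<open>Fix one walk \<open>w0\<close>. Any other walk differs from it by a detour around the section between the first and the last
  disagreement, so it is determined by the ends of that section and by the detour.\<close>

lemma card_nbws_between:
  assumes sub: "subcritical r0 \<delta> l V E" and VE: "simple_graph V E" and \<delta>: "\<delta> \<ge> 0"
    and t: "(r0 + 2) * t \<le> l"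
  shows "real (card {w \<in> nbws E t x. w ! t = y}) \<le> walk_bound r0 \<delta> l t"
proof (cases "{w \<in> nbws E t x. w ! t = y} = {}")
  case True
  have "0 \<le> walk_bound r0 \<delta> l t"
    unfolding walk_bound_def using \<delta> by (intro add_nonneg_nonneg mult_nonneg_nonneg) auto
  then show ?thesis unfolding True by simp
next
  case False
  define W where "W = {w \<in> nbws E t x. w ! t = y}"
  obtain w0 where w0: "w0 \<in> nbws E t x" "w0 ! t = y" using False by auto
  define sec where "sec w a c = map ((!) w) [a..<Suc c]" for w :: "'a list" and a c
  have sec_nth: "sec w a c ! i = w ! (a + i)" if "i \<le> c - a" "a \<le> c" for w a c i
    using that by (simp add: sec_def del: upt_Suc)
  have sec_nbws: "sec w a c \<in> nbws E (c - a) (w ! a)" if "w \<in> nbws E t x" "a \<le> c" "c \<le> t" for w a c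
    using that nbwsD[OF that(1)] unfolding nbws_def 
    by (auto simp: sec_nth Suc_diff_le[symmetric]) (auto simp: sec_def)
  define U where "U p = (case p of (a, c) \<Rightarrow> if a < c then detours E (sec w0 a c) (c - a) else {})" for p
  define B where "B = 2 * real l * (2 * real t + 1) ^ (3 * r0) * (1 + \<delta>) ^ (2 * t)"
  have fin: "finite (U p)" for p
    using finite_nbws[OF simple_graphD(3)[OF VE]] by (cases p) (auto simp: U_def detours_def)
  have cU: "real (card (U p)) \<le> B" if "p \<in> {..t} \<times> {..t}" for p
  proof (cases p)
    case (Pair a c)
    show ?thesis
    proof (cases "a < c")
      case True
      have ct: "c \<le> t" using that Pair by simp
      have "(r0 + 2) * (c - a) \<le> (r0 + 2) * t" using ct by (intro mult_left_mono) auto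
      then have "real (card (U p)) \<le> 2 * real l * (2 * real (c - a) + 1) ^ (3 * r0) * (1 + \<delta>) ^ (2 * (c - a))"
        using True t card_detours[OF sub VE \<delta> _ _ sec_nbws[OF w0(1), of a c]] ct
        by (simp add: U_def Pair)
      also have "\<dots> \<le> B" unfolding B_def using ct \<delta>
        by (intro mult_mono power_mono power_increasing) auto
      finally show ?thesis .
    next
      case False then show ?thesis using \<delta> Pair by (simp add: U_def B_def)
    qed
  qed
  define g where "g p u' = (case p of (a, c) \<Rightarrow> take a w0 @ u' @ drop (Suc c) w0)" for p and u' :: "'a list"
  have cover: "W \<subseteq> {w0} \<union> (\<Union>p\<in>{..t} \<times> {..t}. g p ` U p)"
  proof
    fix w assume w: "w \<in> W"
    then have wn: "w \<in> nbws E t x" "w ! t = w0 ! t" using w0 by (auto simp: W_def)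
    note lens = nbwsD(1)[OF wn(1)] nbwsD(1)[OF w0(1)]
    show "w \<in> {w0} \<union> (\<Union>p\<in>{..t} \<times> {..t}. g p ` U p)"
    proof (cases "w = w0")
      case False
      define D where "D i \<longleftrightarrow> i \<le> t \<and> w ! i \<noteq> w0 ! i" for i
      obtain k where "D k" using False lens by (auto simp: D_def list_eq_iff_nth_eq less_Suc_eq_le)
      define i0 where "i0 = Least D"
      define i1 where "i1 = Greatest D"
      have i0: "D i0" "\<And>j. D j \<Longrightarrow> i0 \<le> j" unfolding i0_def using \<open>D k\<close> by (auto intro: LeastI Least_le)
      have bnd: "\<And>j. D j \<Longrightarrow> j \<le> t" by (simp add: D_def)
      have i1: "D i1" "\<And>j. D j \<Longrightarrow> j \<le> i1" unfolding i1_def using \<open>D k\<close> bnd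
        by (auto intro: GreatestI_nat Greatest_le_nat)
      \<comment> \<open>The walks agree at times 0 and \<open>t\<close>, so the disagreements can be
        framed by the agreements at \<open>a = i0 - 1\<close> and \<open>c = i1 + 1\<close>. That
        the neighbours of these times disagree is the detour condition.\<close>
      have "i0 \<noteq> 0" using i0(1) nbwsD(2)[OF wn(1)] nbwsD(2)[OF w0(1)] by (intro notI) (simp add: D_def)
      then obtain a where a: "i0 = Suc a" by (cases i0) auto
      have i1t: "i1 < t" using i1(1) wn by (auto simp: D_def le_less)
      define c where "c = Suc i1"
      have ac: "a < c" "c \<le> t" "Suc a < c" using i1t i0(2)[OF i1(1)] a by (auto simp: c_def)
      have lo: "w ! i = w0 ! i" if "i \<le> a" for i
        using i0(2)[of i] that ac a by (auto simp: D_def)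
      have hi: "w ! i = w0 ! i" if "c \<le> i" "i \<le> t" for i
        using i1(2)[of i] that by (auto simp: D_def c_def)
      have ne: "w ! Suc a \<noteq> w0 ! Suc a" "w ! (c - 1) \<noteq> w0 ! (c - 1)" using i0(1) i1(1) a by (auto simp: D_def c_def)
      have "sec w a c \<in> U (a, c)"
        using sec_nbws[OF wn(1), of a c] ac ne lo[of a] hi[of c]
        by (simp add: U_def detours_def sec_nth)
      moreover have "w = g (a, c) (sec w a c)"
      proof (rule nth_equalityI)
        show "length w = length (g (a, c) (sec w a c))" using lens ac by (simp add: g_def sec_def)
        fix i assume "i < length w"
        then have i: "i \<le> t" using lens by simp
        consider "i < a" | "a \<le> i" "i \<le> c" | "c < i" by linarith
        then show "w ! i = g (a, c) (sec w a c) ! i"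
        proof cases
          case 1 then show ?thesis using lens ac lo by (simp add: g_def nth_append)
        next
          case 2 then show ?thesis using lens ac sec_nth[of "i - a" c a w]
            by (simp add: g_def nth_append) (auto simp: sec_def)
        next
          case 3
          then have "\<not> i - a < Suc c - a" using ac by auto
          then show ?thesis using 3 lens ac hi i by (simp add: g_def nth_append) (auto simp: sec_def)
        qed
      qed
      ultimately have "w \<in> g (a, c) ` U (a, c)" by (intro image_eqI)
      moreover have "(a, c) \<in> {..t} \<times> {..t}" using ac by simp
      ultimately show ?thesis by blast
    qed simp
  qed
  have "card W \<le> card ({w0} \<union> (\<Union>p\<in>{..t} \<times> {..t}. g p ` U p))"
    using fin by (intro card_mono[OF _ cover]) auto
  also have "\<dots> \<le> 1 + card (\<Union>p\<in>{..t} \<times> {..t}. g p ` U p)"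
    using card_Un_le[of "{w0}"] by simp
  also have "card (\<Union>p\<in>{..t} \<times> {..t}. g p ` U p) \<le> (\<Sum>p\<in>{..t} \<times> {..t}. card (g p ` U p))"
    by (rule card_UN_le) simp
  also have "\<dots> \<le> (\<Sum>p\<in>{..t} \<times> {..t}. card (U p))"
    using fin by (intro sum_mono card_image_le) auto
  finally have "real (card W) \<le> 1 + (\<Sum>p\<in>{..t} \<times> {..t}. real (card (U p)))"
    by (simp flip: of_nat_sum of_nat_add of_nat_Suc)
  also have "\<dots> \<le> 1 + (\<Sum>p\<in>{..t} \<times> {..t}. B)" using cU by (intro add_left_mono sum_mono) auto
  also have "\<dots> = walk_bound r0 \<delta> l t"
    by (simp add: walk_bound_def B_def power2_eq_square algebra_simps)
  finally show ?thesis by (simp add: W_def)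
qed

section \<open>Encoding edge sets by runs of new edges\<close>

text \<open>The edge sets that can be drawn from \<open>u\<close> in \<open>F\<close> runs with \<open>M\<close> edges in total, together with the directed edge drawn
  last. A run starts at a vertex that has already been touched and does not backtrack.\<close>

fun edge_runs :: "'a set set \<Rightarrow> 'a \<Rightarrow> nat \<Rightarrow> nat \<Rightarrow> ('a set set \<times> 'a \<times> 'a) set" where
  "edge_runs E u 0 F = (if F = 0 then {({}, u, u)} else {})"
| "edge_runs E u (Suc M) 0 = {}"
| "edge_runs E u (Suc M) (Suc F) =
    (\<Union>(S, x, y)\<in>edge_runs E u M (Suc F). (\<lambda>z. (insert {y, z} S, y, z)) ` {z. {y, z} \<in> E \<and> z \<noteq> x}) \<union>
    (\<Union>(S, p)\<in>edge_runs E u M F. \<Union>x\<in>insert u (\<Union>S). (\<lambda>y. (insert {x, y} S, x, y)) ` {y. {x, y} \<in> E})"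

text \<open>An insertion may repeat an edge, so \<open>M\<close> is only an upper bound for
  \<open>card S\<close>. With no run drawn, the directed edge is the placeholder
  \<open>(u, u)\<close>, which explains the guard \<open>0 < F\<close>.\<close>

lemma edge_runs_invariant:
  "(S, x, y) \<in> edge_runs E u M F \<Longrightarrow> finite S \<and> card S \<le> M \<and> S \<subseteq> E \<and> (0 < F \<longrightarrow> {x, y} \<in> E)"
proof (induction E u M F arbitrary: S x y rule: edge_runs.induct)
  case (3 E u M F)
  from 3(3) have "(\<exists>S' x'. (S', x', x) \<in> edge_runs E u M (Suc F) \<and> S = insert {x, y} S' \<and> {x, y} \<in> E) \<or>
    (\<exists>S' x' y'. (S', x', y') \<in> edge_runs E u M F \<and> S = insert {x, y} S' \<and> {x, y} \<in> E)"
    by auto blast+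
  then show ?case
  proof (elim disjE exE conjE)
    fix S' x' assume "(S', x', x) \<in> edge_runs E u M (Suc F)" "S = insert {x, y} S'" "{x, y} \<in> E"
    then show ?thesis using 3(1)[of S' x' x] by (simp add: card_insert_if)
  next
    fix S' x' y' assume "(S', x', y') \<in> edge_runs E u M F" "S = insert {x, y} S'" "{x, y} \<in> E"
    then show ?thesis using 3(2)[of S' x' y'] by (simp add: card_insert_if)
  qed
qed (auto split: if_splits)

section \<open>Number of encodings in a regular graph\<close>

lemma card_neighbours:
  assumes "simple_graph V E" shows "card {y. {x, y} \<in> E} = vdegree E x"
proof -
  have "bij_betw (\<lambda>y. {x, y}) {y. {x, y} \<in> E} {e \<in> E. x \<in> e}"
    unfolding bij_betw_def
  proof
    show "inj_on (\<lambda>y. {x, y}) {y. {x, y} \<in> E}" by (auto simp: inj_on_def doubleton_eq_iff)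
    show "(\<lambda>y. {x, y}) ` {y. {x, y} \<in> E} = {e \<in> E. x \<in> e}"
    proof (intro equalityI subsetI)
      fix e assume e: "e \<in> {e \<in> E. x \<in> e}"
      then obtain a b where "e = {a, b}" using simple_graphD(5)[OF assms] by (metis card_2_iff mem_Collect_eq)
      then have "e = {x, a} \<or> e = {x, b}" using e by auto
      then show "e \<in> (\<lambda>y. {x, y}) ` {y. {x, y} \<in> E}" using e by auto
    qed auto
  qed
  then show ?thesis unfolding vdegree_def by (rule bij_betw_same_card)
qed

lemma finite_neighbours: "simple_graph V E \<Longrightarrow> finite {y. {x, y} \<in> E}"
  by (rule finite_subset[OF _ simple_graphD(3)]) auto

lemma card_neighbours_le:
  assumes "simple_graph V E" "regular_graph d V E" shows "card {y. {x, y} \<in> E} \<le> d"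
proof (cases "x \<in> V")
  case True then show ?thesis using assms card_neighbours[OF assms(1), of x] by (simp add: regular_graph_def)
next
  case False
  then have "{y. {x, y} \<in> E} = {}" using simple_graphD(4)[OF assms(1)] by auto
  then show ?thesis by simp
qed

lemma card_other_neighbours_le:
  assumes "simple_graph V E" "regular_graph d V E" "{x, y} \<in> E"
  shows "card {z. {y, z} \<in> E \<and> z \<noteq> x} \<le> d - 1"
proof -
  have "{z. {y, z} \<in> E \<and> z \<noteq> x} = {z. {y, z} \<in> E} - {x}" by auto
  then show ?thesis using assms(3) card_neighbours_le[OF assms(1,2), of y] finite_neighbours[OF assms(1), of y]
    by (simp add: insert_commute)
qed


text \<open>Continuing a run offers \<open>d - 1\<close> choices; starting one offers at most
  \<open>(2 * M + 1) * d\<close>, namely a touched vertex and a neighbour. The base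
  \<open>d * M^2\<close> is made for this recurrence, because
  \<open>d * M^2 + (2 * M + 1) * d = d * (M + 1)^2\<close>.\<close>

lemma card_edge_runs:
  assumes VE: "simple_graph V E" and reg: "regular_graph d V E" and d: "d \<ge> 2"
  shows "finite (edge_runs E u M F) \<and> card (edge_runs E u M F) \<le> (d - 1) ^ M * (d * M\<^sup>2) ^ F"
proof (induction M arbitrary: F)
  case 0
  then show ?case by simp
next
  case (Suc M)
  show ?case
  proof (cases F)
    case 0
    then show ?thesis by simp
  next
    case (Suc F')
    let ?A = "\<Union>(S, x, y)\<in>edge_runs E u M (Suc F'). (\<lambda>z. (insert {y, z} S, y, z)) ` {z. {y, z} \<in> E \<and> z \<noteq> x}"
    let ?B = "\<Union>(S, p)\<in>edge_runs E u M F'. \<Union>x\<in>insert u (\<Union>S). (\<lambda>y. (insert {x, y} S, x, y)) ` {y. {x, y} \<in> E}"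
    have fin: "finite (edge_runs E u M F)" for F using Suc.IH by simp
    have A: "finite ?A \<and> card ?A \<le> (d - 1) * card (edge_runs E u M (Suc F'))"
    proof
      have *: "finite {z. {y, z} \<in> E \<and> z \<noteq> x}" for x y
        by (rule finite_subset[OF _ finite_neighbours[OF VE, of y]]) auto
      show "finite ?A" using fin * by auto
      have "card ?A \<le> (\<Sum>(S, x, y)\<in>edge_runs E u M (Suc F'). d - 1)"
      proof (rule order_trans[OF card_UN_le[OF fin]], rule sum_mono)
        fix s assume s: "s \<in> edge_runs E u M (Suc F')"
        obtain S x y where sxy: "s = (S, x, y)" by (cases s)
        have "card ((\<lambda>z. (insert {y, z} S, y, z)) ` {z. {y, z} \<in> E \<and> z \<noteq> x}) \<le> card {z. {y, z} \<in> E \<and> z \<noteq> x}"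
          using * by (rule card_image_le)
        also have "\<dots> \<le> d - 1"
          using s sxy edge_runs_invariant[of S x y E u M "Suc F'"] by (intro card_other_neighbours_le[OF VE reg]) auto
        finally show "card (case s of (S, x, y) \<Rightarrow> (\<lambda>z. (insert {y, z} S, y, z)) ` {z. {y, z} \<in> E \<and> z \<noteq> x})
          \<le> (case s of (S, x, y) \<Rightarrow> d - 1)" using sxy by simp
      qed
      then show "card ?A \<le> (d - 1) * card (edge_runs E u M (Suc F'))" by (simp add: case_prod_unfold mult.commute)
    qed
    have B: "finite ?B \<and> card ?B \<le> ((2 * M + 1) * d) * card (edge_runs E u M F')"
    proof
      have U: "finite (insert u (\<Union>S)) \<and> card (insert u (\<Union>S)) \<le> 2 * M + 1" if "(S, x, y) \<in> edge_runs E u M F'" for S x y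
      proof -
        have i: "finite S" "card S \<le> M" "S \<subseteq> E" using edge_runs_invariant[OF that] by auto
        have e2: "\<And>e. e \<in> S \<Longrightarrow> card e = 2" using i simple_graphD(5)[OF VE] by auto
        then have f: "finite (\<Union>S)" using i by (metis card.infinite finite_Union zero_neq_numeral)
        have "card (\<Union>S) \<le> (\<Sum>e\<in>S. card e)" using i e2 card_Union_le_sum_card by blast
        also have "\<dots> = 2 * card S" using e2 by simp
        finally have "card (\<Union>S) \<le> 2 * M" using i by simp
        then show ?thesis using f by (auto simp: card_insert_if)
      qed
      have fin1: "finite (\<Union>x\<in>insert u (\<Union>S). (\<lambda>y. (insert {x, y} S, x, y)) ` {y. {x, y} \<in> E})"
        if "(S, x, y) \<in> edge_runs E u M F'" for S x y
        using U[OF that] finite_neighbours[OF VE] by blast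
      show "finite ?B" using fin fin1 by auto
      have "card ?B \<le> (\<Sum>(S, p)\<in>edge_runs E u M F'. (2 * M + 1) * d)"
      proof (rule order_trans[OF card_UN_le[OF fin]], rule sum_mono)
        fix s assume s: "s \<in> edge_runs E u M F'"
        obtain S x y where sxy: "s = (S, x, y)" by (cases s)
        have Us: "finite (insert u (\<Union>S)) \<and> card (insert u (\<Union>S)) \<le> 2 * M + 1"
          using s unfolding sxy by (rule U)
        have "card (\<Union>x\<in>insert u (\<Union>S). (\<lambda>y. (insert {x, y} S, x, y)) ` {y. {x, y} \<in> E})
          \<le> (\<Sum>x\<in>insert u (\<Union>S). d)"
        proof (rule order_trans[OF card_UN_le], goal_cases)
          case 1 show ?case by (rule conjunct1[OF Us])
        next
          case 2
          then show ?case
            using finite_neighbours[OF VE] card_neighbours_le[OF VE reg]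
            by (intro sum_mono order_trans[OF card_image_le]) auto
        qed
        also have "\<dots> = card (insert u (\<Union>S)) * d" by simp
        also have "\<dots> \<le> (2 * M + 1) * d" using Us by (intro mult_right_mono) auto
        finally show "card (case s of (S, p) \<Rightarrow> \<Union>x\<in>insert u (\<Union>S). (\<lambda>y. (insert {x, y} S, x, y)) ` {y. {x, y} \<in> E})
          \<le> (case s of (S, p) \<Rightarrow> (2 * M + 1) * d)" using sxy by simp
      qed
      then show "card ?B \<le> ((2 * M + 1) * d) * card (edge_runs E u M F')" by (simp add: case_prod_unfold mult.commute)
    qed
    have "card (?A \<union> ?B) \<le> (d - 1) * card (edge_runs E u M (Suc F')) + ((2 * M + 1) * d) * card (edge_runs E u M F')"
      using card_Un_le[of ?A ?B] A B by linarith
    also have "\<dots> \<le> (d - 1) * ((d - 1) ^ M * (d * M\<^sup>2) ^ Suc F') + ((2 * M + 1) * d) * ((d - 1) ^ M * (d * M\<^sup>2) ^ F')"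
      by (intro add_mono mult_left_mono conjunct2[OF Suc.IH] le0)
    \<comment> \<open>The start of a run is given a factor \<open>d - 1\<close> as well, so that
      both terms carry the same power of \<open>d - 1\<close>.\<close>
    also have "\<dots> \<le> (d - 1) * ((d - 1) ^ M * (d * M\<^sup>2) ^ Suc F') + (d - 1) * (((2 * M + 1) * d) * ((d - 1) ^ M * (d * M\<^sup>2) ^ F'))"
      using d by (intro add_left_mono) auto
    also have "\<dots> = (d - 1) ^ Suc M * (d * M\<^sup>2) ^ F' * (d * M\<^sup>2 + (2 * M + 1) * d)"
      by (simp only: power_Suc distrib_left mult_ac)
    also have "d * M\<^sup>2 + (2 * M + 1) * d = d * (Suc M)\<^sup>2"
      by (simp add: algebra_simps power2_eq_square)
    also have "(d - 1) ^ Suc M * (d * M\<^sup>2) ^ F' * (d * (Suc M)\<^sup>2) \<le> (d - 1) ^ Suc M * (d * (Suc M)\<^sup>2) ^ F' * (d * (Suc M)\<^sup>2)"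
      by (intro mult_right_mono mult_left_mono power_mono) auto
    finally have "card (?A \<union> ?B) \<le> (d - 1) ^ Suc M * (d * (Suc M)\<^sup>2) ^ Suc F'"
      by (simp only: power_Suc2 mult.assoc)
    then show ?thesis using A B Suc by simp
  qed
qed

text \<open>Steps along old edges are skipped. A fresh step right after a fresh step continues the
  run, because the edge drawn last is then the previous step and the walk does not turn back. All
  other fresh steps, and those at the times \<open>B\<close> where the walk may jump, are charged as
  starts of runs.\<close>

lemma walk_in_edge_runs:
  fixes src tgt :: "nat \<Rightarrow> 'a"
  defines "seen m \<equiv> (\<lambda>k. {src k, tgt k}) ` {..<m}"
  defines "fresh k \<equiv> {src k, tgt k} \<notin> seen k"
  assumes E: "\<And>k. k < m \<Longrightarrow> {src k, tgt k} \<in> E"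
    and start: "\<And>k. k < m \<Longrightarrow> src k \<in> insert u (\<Union>(seen k))"
    and cont: "\<And>k. k < m \<Longrightarrow> k \<notin> B \<Longrightarrow> 0 < k \<and> src k = tgt (k - 1) \<and> tgt k \<noteq> src (k - 1)"
  shows "\<exists>p. (seen m, p) \<in> edge_runs E u (card (seen m)) (card {k. k < m \<and> fresh k \<and> (k \<in> B \<or> \<not> fresh (k - 1))}) \<and>
    (0 < m \<and> fresh (m - 1) \<longrightarrow> p = (src (m - 1), tgt (m - 1)))"
  using E start cont
proof (induction m)
  case 0
  then show ?case by (simp add: seen_def)
next
  case (Suc m)
  define K where "K m = {k. k < m \<and> fresh k \<and> (k \<in> B \<or> \<not> fresh (k - 1))}" for m
  have finK: "finite (K m)" by (simp add: K_def)
  obtain p where p: "(seen m, p) \<in> edge_runs E u (card (seen m)) (card (K m))"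
    "0 < m \<and> fresh (m - 1) \<longrightarrow> p = (src (m - 1), tgt (m - 1))"
    using Suc.IH[OF Suc.prems(1)[OF less_SucI] Suc.prems(2)[OF less_SucI] Suc.prems(3)[OF less_SucI]]
    unfolding K_def by blast
  have seen: "seen (Suc m) = insert {src m, tgt m} (seen m)" by (simp add: seen_def lessThan_Suc)
  have finS: "finite (seen m)" by (simp add: seen_def)
  show ?case unfolding K_def[symmetric]
  proof (cases "fresh m")
    case False
    then have "seen (Suc m) = seen m" by (simp add: seen fresh_def insert_absorb)
    moreover have "K (Suc m) = K m" using False by (auto simp: K_def less_Suc_eq)
    ultimately show "\<exists>p. (seen (Suc m), p) \<in> edge_runs E u (card (seen (Suc m))) (card (K (Suc m))) \<and>
      (0 < Suc m \<and> fresh (Suc m - 1) \<longrightarrow> p = (src (Suc m - 1), tgt (Suc m - 1)))"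
      using p False by (intro exI[of _ p]) simp
  next
    case True
    then have c: "card (seen (Suc m)) = Suc (card (seen m))" using finS by (simp add: seen fresh_def)
    have "(seen (Suc m), src m, tgt m) \<in> edge_runs E u (card (seen (Suc m))) (card (K (Suc m)))"
    proof (cases "m \<in> B \<or> \<not> fresh (m - 1)")
      case True2: True
      have "K (Suc m) = insert m (K m)" using True True2 by (auto simp: K_def less_Suc_eq)
      then have c2: "card (K (Suc m)) = Suc (card (K m))" using finK by (simp add: K_def)
      have "src m \<in> insert u (\<Union>(seen m))" "{src m, tgt m} \<in> E" using Suc.prems by auto
      then show ?thesis unfolding c c2 using p(1) by (force simp: seen)
    next
      case False2: False
      then have m: "0 < m" "src m = tgt (m - 1)" "tgt m \<noteq> src (m - 1)" using Suc.prems(3)[of m] by auto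
      have "K (Suc m) = K m" using False2 by (auto simp: K_def less_Suc_eq)
      \<comment> \<open>With no run at all only the empty set can be drawn, but a step has been made
        already.\<close>
      moreover have "card (K m) \<noteq> 0"
      proof
        assume 0: "card (K m) = 0"
        have "seen m \<noteq> {}" using m by (auto simp: seen_def)
        then obtain M where "card (seen m) = Suc M" using finS by (metis card_0_eq not0_implies_Suc)
        with 0 p(1) show False by simp
      qed
      then obtain F where F: "card (K m) = Suc F" using not0_implies_Suc by blast
      have "p = (src (m - 1), tgt (m - 1))" using p(2) m False2 by auto
      moreover have "{src m, tgt m} \<in> E" using Suc.prems by auto
      ultimately show ?thesis unfolding c using p(1) m F by (force simp: seen)
    qed
    then show "\<exists>p. (seen (Suc m), p) \<in> edge_runs E u (card (seen (Suc m))) (card (K (Suc m))) \<and>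
      (0 < Suc m \<and> fresh (Suc m - 1) \<longrightarrow> p = (src (Suc m - 1), tgt (Suc m - 1)))"
      by (intro exI[of _ "(src m, tgt m)"]) simp
  qed
qed

text \<open>The set \<open>K\<close> holds the times at which the walk leaves old edges for a fresh
  one. Between consecutive elements of \<open>K\<close> it makes an excursion: it starts with a
  fresh edge and ends with a repeated one, so \<open>excess_nb_walk\<close> gains 1.\<close>

lemma excess_returns:
  assumes fin: "finite Q" "finite (\<Union>Q)" and a: "f a \<in> \<Union>Q"
    and K: "K \<subseteq> {a..<b}" "a \<in> K"
    and nb: "\<And>i. a \<le> i \<Longrightarrow> Suc i < b \<Longrightarrow> f i \<noteq> f (Suc (Suc i))"
    and ret: "\<And>k. k \<in> K \<Longrightarrow> a < k \<Longrightarrow> {f (k - 1), f k} \<in> Q \<union> steps f a (k - 1)"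
    and leave: "\<And>k. k \<in> K \<Longrightarrow> {f k, f (Suc k)} \<notin> Q \<union> steps f a k"
    and k: "k \<in> K"
  shows "excess Q + int (card (K \<inter> {..<k})) \<le> excess (Q \<union> steps f a k)"
  using k
proof (induction k rule: less_induct)
  case (less k)
  have finK: "finite K" using K finite_subset by blast
  show ?case
  proof (cases "k = a")
    case True
    then have "K \<inter> {..<k} = {}" using K by force
    then show ?thesis using True by simp
  next
    case False
    then have ak: "a < k" "k < b" using less K by force+
    let ?k' = "Max (K \<inter> {..<k})"
    have ne: "K \<inter> {..<k} \<noteq> {}" using K ak by auto
    have k': "?k' \<in> K" "?k' < k" using Max_in[OF _ ne] finK by auto
    have mx: "\<And>j. j \<in> K \<Longrightarrow> j < k \<Longrightarrow> j \<le> ?k'" using finK by (intro Max_ge) auto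
    have eq: "K \<inter> {..<k} = insert ?k' (K \<inter> {..<?k'})" using k' mx by fastforce
    have "card (K \<inter> {..<k}) = Suc (card (K \<inter> {..<?k'}))"
      by (subst eq, subst card_insert_disjoint) (use finK in auto)
    then have "excess Q + int (card (K \<inter> {..<k})) \<le> excess (Q \<union> steps f a ?k') + 1"
      using less.IH[OF k'(2,1)] by simp
    also have "\<dots> \<le> excess (Q \<union> steps f a ?k' \<union> steps f ?k' k)"
    proof (rule excess_nb_walk)
      have ak': "a \<le> ?k'" using k' K by auto
      then show "f ?k' \<in> \<Union>(Q \<union> steps f a ?k')" using a by (intro mem_Union_steps)
      have "steps f a (k - 1) = steps f a ?k' \<union> steps f ?k' (k - 1)"
        using ak' k' by (intro steps_split) auto
      then show "f k \<in> \<Union>(Q \<union> steps f a ?k') \<or> {f (k - 1), f k} \<in> Q \<union> steps f a ?k' \<union> steps f ?k' (k - 1)"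
        using ret[OF less(2)] ak by (auto simp: Un_assoc)
      show "\<And>i. ?k' \<le> i \<Longrightarrow> Suc i < k \<Longrightarrow> f i \<noteq> f (Suc (Suc i))" using nb ak ak' by simp
      have "{f ?k', f (Suc ?k')} \<in> steps f ?k' k" using k' by (intro in_stepsI) auto
      then show "\<not> steps f ?k' k \<subseteq> Q \<union> steps f a ?k'" using leave[OF k'(1)] by blast
    qed (use fin k' in auto)
    also have "Q \<union> steps f a ?k' \<union> steps f ?k' k = Q \<union> steps f a k"
      using steps_split[of a ?k' k f] k' K by auto
    finally show ?thesis .
  qed
qed

text \<open>The excess starts at -1 or more and, as long as the union has at most \<open>l\<close>
  edges, ends at \<open>r0 - 1\<close> or less. This leaves room for \<open>r0\<close> excursions
  before the last element of \<open>K\<close>.\<close>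

lemma card_returns:
  assumes sub: "subcritical r0 \<delta> l V E" and VE: "simple_graph V E"
    and Q: "linked Q" "Q \<subseteq> E" "-1 \<le> excess Q" and a: "f a \<in> \<Union>Q"
    and fE: "steps f a b \<subseteq> E" and size: "card Q + (b - a) \<le> l"
    and K: "K \<subseteq> {a..<b}" "a \<in> K"
    and nb: "\<And>i. a \<le> i \<Longrightarrow> Suc i < b \<Longrightarrow> f i \<noteq> f (Suc (Suc i))"
    and ret: "\<And>k. k \<in> K \<Longrightarrow> a < k \<Longrightarrow> {f (k - 1), f k} \<in> Q \<union> steps f a (k - 1)"
    and leave: "\<And>k. k \<in> K \<Longrightarrow> {f k, f (Suc k)} \<notin> Q \<union> steps f a k"
  shows "card K \<le> r0 + 1"
proof -
  have finQ: "finite Q" "finite (\<Union>Q)"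
    using Q(2) simple_graphD[OF VE] by (meson Union_mono finite_subset)+
  have finK: "finite K" using K finite_subset by blast
  let ?k = "Max K"
  have k: "?k \<in> K" using K finK by (intro Max_in) auto
  have kab: "a \<le> ?k" "?k < b" using k K by auto
  have mx: "\<And>j. j \<in> K \<Longrightarrow> j \<le> ?k" using finK by simp
  have "K = insert ?k (K \<inter> {..<?k})" using mx k by (auto simp: le_less)
  then have "card K = Suc (card (K \<inter> {..<?k}))"
    using finK by (metis card_insert_disjoint finite_Int Int_iff lessThan_iff less_irrefl)
  moreover have "excess Q + int (card (K \<inter> {..<?k})) \<le> excess (Q \<union> steps f a ?k)"
    using excess_returns[where f=f, OF finQ a K nb ret leave k] by blast
  moreover have "excess (Q \<union> steps f a ?k) + 1 \<le> int r0"
  proof (rule subcritical_excess[OF sub VE])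
    show "linked (Q \<union> steps f a ?k)" using Q a kab by (intro linked_steps) auto
    show "Q \<union> steps f a ?k \<subseteq> E" using Q fE steps_mono[of a a ?k b f] kab by auto
    show "Q \<union> steps f a ?k \<noteq> {}" using a by auto
    show "card (Q \<union> steps f a ?k) \<le> l"
      using card_Un_le[of Q "steps f a ?k"] card_steps[of f a ?k] kab size by linarith
  qed
  ultimately show ?thesis using Q(3) by linarith
qed

text \<open>A run that starts inside piece \<open>j\<close> leaves an edge of some earlier piece \<open>i\<close>, or of piece \<open>j\<close> itself. Since the
  two pieces together have at most \<open>l\<close> edges, every \<open>i\<close> accounts for at most \<open>r0 + 1\<close> such starts.\<close>

lemma pieces_in_edge_runs:
  fixes f :: "nat \<Rightarrow> nat \<Rightarrow> 'a"
  assumes sub: "subcritical r0 \<delta> l V E" and VE: "simple_graph V E" and q: "1 \<le> q" "2 * q \<le> l"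
    and piece: "\<And>j. j < J \<Longrightarrow> steps (f j) 0 q \<subseteq> E"
    and nb: "\<And>j i. j < J \<Longrightarrow> Suc i < q \<Longrightarrow> f j i \<noteq> f j (Suc (Suc i))"
    and join: "\<And>j. j < J \<Longrightarrow> f j 0 = u \<or> 0 < j \<and> f j 0 = f (j - 1) q"
  defines "S \<equiv> \<Union>j<J. steps (f j) 0 q"
  shows "\<exists>F p. F \<le> J + J * (J * (r0 + 1)) \<and> (S, p) \<in> edge_runs E u (card S) F"
proof -
  \<comment> \<open>The pieces are laid end to end on one time axis: time \<open>j * q + i\<close>
    is step \<open>i\<close> of piece \<open>j\<close>.\<close>
  define src where "src k = f (k div q) (k mod q)" for k
  define tgt where "tgt k = f (k div q) (Suc (k mod q))" for k
  define seen where "seen m = (\<lambda>k. {src k, tgt k}) ` {..<m}" for m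
  define fresh where "fresh k \<longleftrightarrow> {src k, tgt k} \<notin> seen k" for k
  have dm: "(j * q + i) div q = j" "(j * q + i) mod q = i" if "i < q" for i j
    using that by auto
  have ed: "{src (j * q + i), tgt (j * q + i)} = {f j i, f j (Suc i)}" if "i < q" for i j
    using dm[OF that] by (simp add: src_def tgt_def)
  have seen_Suc: "seen (Suc k) = insert {src k, tgt k} (seen k)" for k
    by (simp add: seen_def lessThan_Suc)
  have seen_add: "seen (j * q + i) = (\<Union>i'<j. steps (f i') 0 q) \<union> steps (f j) 0 i"
    if "i \<le> q" "seen (j * q) = (\<Union>i'<j. steps (f i') 0 q)" for i j
    using that(1)
  proof (induction i)
    case 0 then show ?case using that by simp
  next
    case (Suc i)
    then show ?case using ed[of i j] by (simp add: seen_Suc steps_Suc)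
  qed
  have seen_mult: "seen (j * q) = (\<Union>i'<j. steps (f i') 0 q)" for j
  proof (induction j)
    case 0 then show ?case by (simp add: seen_def)
  next
    case (Suc j)
    have "seen (Suc j * q) = seen (j * q + q)" by (simp add: add.commute)
    also have "\<dots> = (\<Union>i'<j. steps (f i') 0 q) \<union> steps (f j) 0 q" using Suc by (intro seen_add) auto
    finally show ?case by (simp add: lessThan_Suc Un_commute)
  qed
  note seen_eq = seen_add[OF _ seen_mult]
  have S: "S = seen (J * q)" by (simp add: S_def seen_mult)
  have split: "\<exists>j i. k = j * q + i \<and> j < J \<and> i < q" if "k < J * q" for k
  proof (intro exI conjI)
    show "k = k div q * q + k mod q" by simp
    show "k div q < J" using that q by (simp add: less_mult_imp_div_less)
    show "k mod q < q" using q by simp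
  qed
  let ?F = "card {k. k < J * q \<and> fresh k \<and> (k \<in> {k. q dvd k} \<or> \<not> fresh (k - 1))}"
  have "\<exists>p. (seen (J * q), p) \<in> edge_runs E u (card (seen (J * q))) ?F \<and>
    (0 < J * q \<and> fresh (J * q - 1) \<longrightarrow> p = (src (J * q - 1), tgt (J * q - 1)))"
    unfolding fresh_def seen_def
  \<comment> \<open>Nothing is assumed about backtracking from one piece to the next, and a piece
    may restart at \<open>u\<close>. Hence every multiple of \<open>q\<close> is allowed as a break,
    at the price of \<open>J\<close> runs.\<close>
  proof (rule walk_in_edge_runs[of "J * q" src tgt E u "{k. q dvd k}"])
    fix k assume "k < J * q"
    then obtain j i where k: "k = j * q + i" "j < J" "i < q" using split by blast
    show "{src k, tgt k} \<in> E"
      unfolding k(1) ed[OF k(3)] using piece[OF k(2)] k(3) by (rule steps_subsetD)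
    have "src k \<in> insert u (\<Union>(seen k))"
    proof (cases "i = 0")
      case True
      show ?thesis
      proof (cases "f j 0 = u")
        case True2: True
        then show ?thesis using True k dm[of i j] by (simp add: src_def)
      next
        case False
        then have j: "0 < j" "f j 0 = f (j - 1) q" using join[OF k(2)] by auto
        have "{f (j - 1) (q - 1), f (j - 1) (Suc (q - 1))} \<in> steps (f (j - 1)) 0 q"
          using q by (intro in_stepsI) auto
        moreover have "steps (f (j - 1)) 0 q \<subseteq> seen k"
        proof -
          have "j - 1 \<in> {..<j}" using j by simp
          then show ?thesis unfolding k(1) seen_eq[OF less_imp_le[OF k(3)]] by blast
        qed
        ultimately have "f (j - 1) q \<in> \<Union>(seen k)" using q by auto
        then show ?thesis using True k dm[of i j] j by (simp add: src_def)
      qed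
    next
      case False
      have "{f j (i - 1), f j (Suc (i - 1))} \<in> steps (f j) 0 i" using False by (intro in_stepsI) auto
      moreover have "steps (f j) 0 i \<subseteq> seen k"
        unfolding k(1) seen_eq[OF less_imp_le[OF k(3)]] by auto
      ultimately have "f j i \<in> \<Union>(seen k)" using False by auto
      then show ?thesis using k dm[of i j] by (simp add: src_def)
    qed
    then show "src k \<in> insert u (\<Union>((\<lambda>k. {src k, tgt k}) ` {..<k}))" by (simp add: seen_def)
    show "0 < k \<and> src k = tgt (k - 1) \<and> tgt k \<noteq> src (k - 1)" if "k \<notin> {k. q dvd k}"
    proof -
      have i: "i \<noteq> 0" using that k by (intro notI) simp
      then have "k - 1 = j * q + (i - 1)" using k by simp
      then have "src (k - 1) = f j (i - 1)" "tgt (k - 1) = f j i" using dm[of "i - 1" j] k i by (simp_all add: src_def tgt_def)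
      moreover have "src k = f j i" "tgt k = f j (Suc i)" using dm[of i j] k by (simp_all add: src_def tgt_def)
      ultimately show ?thesis using nb[OF k(2), of "i - 1"] i k by auto
    qed
  qed
  moreover have "?F \<le> J + J * (J * (r0 + 1))"
  proof -
    define K where "K j = {i. 0 < i \<and> i < q \<and> fresh (j * q + i) \<and> \<not> fresh (j * q + (i - 1))}" for j
    have finK: "finite (K j)" for j by (rule finite_subset[of _ "{..<q}"]) (auto simp: K_def)
    have cK: "card (K j) \<le> J * (r0 + 1)" if j: "j < J" for j
    proof -
      \<comment> \<open>The run starts are sorted by a piece that contains the edge repeated just
        before; the index \<open>j\<close> stands for the past of piece \<open>j\<close>
        itself.\<close>
      define L where "L i' = {i \<in> K j. {f j (i - 1), f j i} \<in>
        (if i' < j then steps (f i') 0 q else steps (f j) 0 (i - 1))}" for i'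
      have finL: "finite (L i')" for i' by (rule finite_subset[OF _ finK[of j]]) (auto simp: L_def)
      have cover: "K j \<subseteq> (\<Union>i'\<in>{..j}. L i')"
      proof
        fix i assume i: "i \<in> K j"
        then have i1: "i - 1 < q" "Suc (i - 1) = i" by (auto simp: K_def)
        have "{src (j * q + (i - 1)), tgt (j * q + (i - 1))} \<in> seen (j * q + (i - 1))"
          using i unfolding K_def fresh_def by blast
        then have "{f j (i - 1), f j i} \<in> (\<Union>i'<j. steps (f i') 0 q) \<union> steps (f j) 0 (i - 1)"
          unfolding ed[OF i1(1)] i1(2) seen_eq[OF less_imp_le[OF i1(1)]] .
        then show "i \<in> (\<Union>i'\<in>{..j}. L i')" using i by (auto simp: L_def intro: less_imp_le)
      qed
      have cL: "card (L i') \<le> r0 + 1" if i': "i' \<le> j" for i'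
      proof (cases "L i' = {}")
        case False
        define a where "a = Min (L i')"
        have aL: "a \<in> L i'" using finL False by (simp add: a_def)
        then have a: "0 < a" "a < q" by (auto simp: L_def K_def)
        have amin: "a \<le> k" if "k \<in> L i'" for k using that finL by (simp add: a_def)
        \<comment> \<open>Counting begins at the first return \<open>a\<close>: there
          \<open>f j a\<close> touches \<open>Q\<close>, which is the earlier piece or the part of
          piece \<open>j\<close> before \<open>a\<close>. Together with the rest of piece
          \<open>j\<close> it has at most \<open>2 * q\<close> edges.\<close>
        define Q where "Q = (if i' < j then steps (f i') 0 q else steps (f j) 0 a)"
        have i'J: "i' < J" using i' j by simp
        have QE: "Q \<subseteq> E"
          using piece[OF i'J] piece[OF j] steps_mono[of 0 0 a q "f j"] a by (auto simp: Q_def)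
        have mem: "{f j (a - 1), f j (Suc (a - 1))} \<in> Q"
        proof (cases "i' < j")
          case True
          then show ?thesis using aL a by (simp add: Q_def L_def)
        next
          case False
          then show ?thesis using a by (simp add: Q_def in_stepsI del: Suc_pred)
        qed
        have Qseen: "Q \<union> steps (f j) a k \<subseteq> seen (j * q + k)" if "a \<le> k" "k < q" for k
        proof -
          have "steps (f j) 0 a \<union> steps (f j) a k = steps (f j) 0 k"
            using that by (intro steps_split[symmetric]) auto
          then show ?thesis unfolding seen_eq[OF less_imp_le[OF that(2)]] Q_def using i' by auto
        qed
        show ?thesis
        proof (rule card_returns[OF sub VE, of Q "f j" a q "L i'"])
          show "linked Q" "Q \<subseteq> E" "-1 \<le> excess Q"
            using QE linked_walk excess_walk[of 0 q "f i'"] excess_walk[of 0 a "f j"] a q by (auto simp: Q_def)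
          show "f j a \<in> \<Union>Q" using mem a by auto
          show "steps (f j) a q \<subseteq> E" using steps_mono[of 0 a q q "f j"] piece[OF j] by auto
          have "card Q \<le> q" using card_steps[of "f i'" 0 q] card_steps[of "f j" 0 a] a by (auto simp: Q_def)
          then show "card Q + (q - a) \<le> l" using q by simp
          show "L i' \<subseteq> {a..<q}" using amin by (auto simp: L_def K_def)
          show "a \<in> L i'" by (rule aL)
          show "\<And>i. a \<le> i \<Longrightarrow> Suc i < q \<Longrightarrow> f j i \<noteq> f j (Suc (Suc i))" using nb j by blast
          fix k assume k: "k \<in> L i'"
          have kq: "a \<le> k" "k < q" using amin k by (auto simp: L_def K_def)
          have "{src (j * q + k), tgt (j * q + k)} \<notin> seen (j * q + k)"
            using k by (simp add: L_def K_def fresh_def)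
          then show "{f j k, f j (Suc k)} \<notin> Q \<union> steps (f j) a k"
            unfolding ed[OF kq(2)] using Qseen[OF kq] by blast
          assume "a < k"
          then have split: "steps (f j) 0 (k - 1) = steps (f j) 0 a \<union> steps (f j) a (k - 1)"
            by (intro steps_split) auto
          have "{f j (k - 1), f j k} \<in> (if i' < j then steps (f i') 0 q else steps (f j) 0 (k - 1))"
            using k unfolding L_def by blast
          then show "{f j (k - 1), f j k} \<in> Q \<union> steps (f j) a (k - 1)"
            unfolding Q_def split by (cases "i' < j") simp_all
        qed
      qed simp
      have "card (K j) \<le> card (\<Union>i'\<in>{..j}. L i')" using finL by (intro card_mono cover) auto
      also have "\<dots> \<le> (\<Sum>i'\<in>{..j}. card (L i'))" by (rule card_UN_le) simp
      also have "\<dots> \<le> (\<Sum>i'\<in>{..j}. r0 + 1)" using cL by (intro sum_mono) auto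
      also have "\<dots> = Suc j * (r0 + 1)" by simp
      also have "\<dots> \<le> J * (r0 + 1)" using j by (intro mult_right_mono) auto
      finally show ?thesis .
    qed
    have "{k. k < J * q \<and> fresh k \<and> (k \<in> {k. q dvd k} \<or> \<not> fresh (k - 1))} \<subseteq>
      (\<lambda>j. j * q) ` {..<J} \<union> (\<Union>j<J. (\<lambda>i. j * q + i) ` K j)"
    proof
      fix k assume k: "k \<in> {k. k < J * q \<and> fresh k \<and> (k \<in> {k. q dvd k} \<or> \<not> fresh (k - 1))}"
      then obtain j i where ji: "k = j * q + i" "j < J" "i < q" using split by blast
      show "k \<in> (\<lambda>j. j * q) ` {..<J} \<union> (\<Union>j<J. (\<lambda>i. j * q + i) ` K j)"
      proof (cases "i = 0")
        case True
        then show ?thesis using ji by auto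
      next
        case False
        then have "\<not> q dvd k" using dm[OF ji(3), of j] ji by (simp add: dvd_eq_mod_eq_0)
        then have "i \<in> K j" using k ji False by (auto simp: K_def)
        then show ?thesis using ji by blast
      qed
    qed
    then have "?F \<le> card ((\<lambda>j. j * q) ` {..<J} \<union> (\<Union>j<J. (\<lambda>i. j * q + i) ` K j))"
      using finK by (intro card_mono) auto
    also have "\<dots> \<le> card ((\<lambda>j. j * q) ` {..<J}) + card (\<Union>j<J. (\<lambda>i. j * q + i) ` K j)" by (rule card_Un_le)
    also have "card ((\<lambda>j. j * q) ` {..<J}) \<le> J" using card_image_le[of "{..<J}" "\<lambda>j. j * q"] by simp
    also have "card (\<Union>j<J. (\<lambda>i. j * q + i) ` K j) \<le> (\<Sum>j<J. card ((\<lambda>i. j * q + i) ` K j))"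
      by (rule card_UN_le) simp
    also have "\<dots> \<le> (\<Sum>j<J. J * (r0 + 1))"
      using finK cK by (intro sum_mono order_trans[OF card_image_le]) auto
    finally show ?thesis by simp
  qed
  ultimately show ?thesis unfolding S by blast
qed

section \<open>Pairs of walks counted by their joint support\<close>

definition support :: "nat \<Rightarrow> 'a list \<Rightarrow> 'a list \<Rightarrow> 'a set set" where
  "support T w w' = steps ((!) w) 0 T \<union> steps ((!) w') 0 T"

lemma steps_shift: "steps (\<lambda>i. f (a + i)) 0 n = steps f a (a + n)"
proof -
  have *: "{a..<a + n} = (\<lambda>i. a + i) ` {0..<n}"
    using image_add_atLeastLessThan[of a 0 n] by (simp add: add.commute)
  show ?thesis unfolding steps_def * image_image by simp
qed

lemma steps_blocks: "(\<Union>j<N. steps (\<lambda>i. f (j * q + i)) 0 q) = steps f 0 (N * q)"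
proof (induction N)
  case (Suc N)
  have "steps f 0 (Suc N * q) = steps f 0 (N * q) \<union> steps f (N * q) (Suc N * q)"
    by (intro steps_split) auto
  moreover have "steps (\<lambda>i. f (N * q + i)) 0 q = steps f (N * q) (Suc N * q)"
    unfolding steps_shift by (simp add: add.commute)
  ultimately show ?case unfolding lessThan_Suc UN_insert Suc by blast
qed simp

text \<open>Both walks are cut into \<open>N\<close> pieces of length \<open>q\<close>, and those of
  \<open>w'\<close> are listed after those of \<open>w\<close>. Pieces \<open>0\<close> and
  \<open>N\<close> start at \<open>u\<close>, each other one where its predecessor ends, so the
  previous count applies with \<open>J = 2 * N\<close>.\<close>

lemma support_in_edge_runs:
  assumes sub: "subcritical r0 \<delta> l V E" and VE: "simple_graph V E" and q: "1 \<le> q" "2 * q \<le> l"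
    and w: "w \<in> nbws E (N * q) u" and w': "w' \<in> nbws E (N * q) u"
  defines "S \<equiv> support (N * q) w w'"
  shows "\<exists>F p. F \<le> 2 * N + 2 * N * (2 * N * (r0 + 1)) \<and> (S, p) \<in> edge_runs E u (card S) F"
proof -
  define f where "f j i = (if j < N then w ! (j * q + i) else w' ! ((j - N) * q + i))" for j i
  have lt: "j * q + i < N * q" if "j < N" "i < q" for j i
  proof -
    have "j * q + i < Suc j * q" using that by simp
    also have "\<dots> \<le> N * q" using that by (intro mult_right_mono) auto
    finally show ?thesis .
  qed
  have ff: "\<exists>v j'. v \<in> nbws E (N * q) u \<and> j' < N \<and> f j = (\<lambda>i. v ! (j' * q + i))" if "j < 2 * N" for j
  proof (cases "j < N")
    case True
    then show ?thesis using w by (intro exI[of _ w] exI[of _ j]) (simp add: f_def fun_eq_iff)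
  next
    case False
    then show ?thesis using w' that by (intro exI[of _ w'] exI[of _ "j - N"]) (auto simp: f_def)
  qed
  have fw: "f j = (\<lambda>i. w ! (j * q + i))" if "j < N" for j using that by (simp add: f_def fun_eq_iff)
  have fw': "f (N + j) = (\<lambda>i. w' ! (j * q + i))" for j by (simp add: f_def fun_eq_iff)
  have "(\<Union>j<2 * N. steps (f j) 0 q) = (\<Union>j<N. steps (f j) 0 q) \<union> (\<Union>j<N. steps (f (N + j)) 0 q)"
  proof -
    have "{..<2 * N} = {..<N} \<union> (\<lambda>j. N + j) ` {..<N}"
      using image_add_atLeastLessThan[of N 0 N] by (auto simp: atLeast0LessThan)
    then show ?thesis by auto
  qed
  also have "(\<Union>j<N. steps (f j) 0 q) = (\<Union>j<N. steps (\<lambda>i. w ! (j * q + i)) 0 q)"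
    using fw by simp
  also have "\<dots> = steps ((!) w) 0 (N * q)" by (rule steps_blocks)
  also have "(\<Union>j<N. steps (f (N + j)) 0 q) = (\<Union>j<N. steps (\<lambda>i. w' ! (j * q + i)) 0 q)"
    by (simp add: fw')
  also have "\<dots> = steps ((!) w') 0 (N * q)" by (rule steps_blocks)
  finally have S: "S = (\<Union>j<2 * N. steps (f j) 0 q)" by (simp add: S_def support_def)
  show ?thesis unfolding S
  proof (rule pieces_in_edge_runs[OF sub VE q])
    fix j assume j: "j < 2 * N"
    then obtain v j' where v: "v \<in> nbws E (N * q) u" "j' < N" "f j = (\<lambda>i. v ! (j' * q + i))" using ff by blast
    show "steps (f j) 0 q \<subseteq> E"
    proof
      fix e assume "e \<in> steps (f j) 0 q"
      then obtain i where "i < q" "e = {f j i, f j (Suc i)}" by (auto simp: steps_def)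
      then show "e \<in> E" using nbwsD(3)[OF v(1) lt[OF v(2)], of i] v(3) by simp
    qed
    show "f j i \<noteq> f j (Suc (Suc i))" if i: "Suc i < q" for i
      using nbwsD(4)[OF v(1), of "j' * q + i"] lt[OF v(2) i] v(3) by simp
    show "f j 0 = u \<or> 0 < j \<and> f j 0 = f (j - 1) q"
    proof (cases "j = 0 \<or> j = N")
      case True
      then show ?thesis using nbwsD(2)[OF w] nbwsD(2)[OF w'] by (auto simp: f_def)
    next
      case False
      then obtain m where m: "j = Suc m" by (cases j) auto
      have "f j 0 = f (j - 1) q"
        using False by (cases "j < N") (auto simp: f_def m Suc_diff_le add.commute)
      then show ?thesis using m by simp
    qed
  qed
qed

text \<open>Block by block: there are \<open>card Z\<close> choices for the next cut vertex, and
  \<open>card_nbws_between\<close> bounds the walks leading to it. Later \<open>Z\<close> is the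
  vertex set of a support.\<close>

lemma card_block_walks:
  assumes sub: "subcritical r0 \<delta> l V E" and VE: "simple_graph V E" and \<delta>: "\<delta> \<ge> 0"
    and q: "(r0 + 2) * q \<le> l" and Z: "finite Z"
  shows "real (card {w \<in> nbws E (N * q) u. \<forall>j\<le>N. w ! (j * q) \<in> Z}) \<le> (real (card Z) * walk_bound r0 \<delta> l q) ^ N"
proof (induction N)
  case 0
  have "{w \<in> nbws E (0 * q) u. \<forall>j\<le>0. w ! (j * q) \<in> Z} \<subseteq> {[u]}"
    by (auto simp: nbws_def length_Suc_conv)
  then have "card {w \<in> nbws E (0 * q) u. \<forall>j\<le>0. w ! (j * q) \<in> Z} \<le> card {[u]}" by (intro card_mono) auto
  then show ?case by simp
next
  case (Suc N)
  define X where "X N = {w \<in> nbws E (N * q) u. \<forall>j\<le>N. w ! (j * q) \<in> Z}" for N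
  define Y where "Y a z = {b \<in> nbws E q a. b ! q = z}" for a z
  let ?B = "walk_bound r0 \<delta> l q"
  have finX: "finite (X N)" for N using finite_nbws[OF simple_graphD(3)[OF VE]] by (simp add: X_def)
  have finY: "finite (Y a z)" for a z using finite_nbws[OF simple_graphD(3)[OF VE]] by (simp add: Y_def)
  \<comment> \<open>The last vertex of \<open>a\<close> is also the first vertex of
    \<open>b\<close>, hence \<open>tl b\<close>.\<close>
  have cover: "X (Suc N) \<subseteq> (\<Union>a\<in>X N. \<Union>z\<in>Z. (\<lambda>b. a @ tl b) ` Y (a ! (N * q)) z)"
  proof
    fix w assume w: "w \<in> X (Suc N)"
    then have wn: "w \<in> nbws E (Suc N * q) u" "\<And>j. j \<le> Suc N \<Longrightarrow> w ! (j * q) \<in> Z" by (auto simp: X_def)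
    define a where "a = take (Suc (N * q)) w"
    define b where "b = drop (N * q) w"
    have len: "length w = Suc (N * q + q)" using nbwsD(1)[OF wn(1)] by simp
    have an: "a ! i = w ! i" if "i \<le> N * q" for i using that by (simp add: a_def)
    have bn: "b ! i = w ! (N * q + i)" if "i \<le> q" for i using that len by (simp add: b_def)
    have "a \<in> nbws E (N * q) u"
      using nbwsD[OF wn(1)] an len by (auto simp: nbws_def) (simp add: a_def)
    moreover have "a ! (j * q) \<in> Z" if "j \<le> N" for j
      using wn(2)[of j] that by (subst an) auto
    ultimately have aX: "a \<in> X N" by (auto simp: X_def)
    have "b \<in> nbws E q (w ! (N * q))"
      using nbwsD(3,4)[OF wn(1)] bn len by (auto simp: nbws_def) (simp add: b_def)
    then have "b \<in> Y (a ! (N * q)) (w ! (Suc N * q))"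
      using bn[of q] an[of "N * q"] by (simp add: Y_def add.commute)
    moreover have "w = a @ tl b"
      unfolding a_def b_def tl_drop by (simp add: drop_Suc[symmetric] tl_drop[symmetric])
    ultimately show "w \<in> (\<Union>a\<in>X N. \<Union>z\<in>Z. (\<lambda>b. a @ tl b) ` Y (a ! (N * q)) z)"
      using aX wn(2)[of "Suc N"] by blast
  qed
  have cY: "real (card (Y a z)) \<le> ?B" for a z
    unfolding Y_def by (rule card_nbws_between[OF sub VE \<delta> q])
  have B0: "0 \<le> ?B" using cY[of u u] by linarith
  have "card (X (Suc N)) \<le> (\<Sum>a\<in>X N. \<Sum>z\<in>Z. card (Y (a ! (N * q)) z))"
  proof -
    have "card (X (Suc N)) \<le> card (\<Union>a\<in>X N. \<Union>z\<in>Z. (\<lambda>b. a @ tl b) ` Y (a ! (N * q)) z)"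
      using finX Z finY by (intro card_mono cover) auto
    also have "\<dots> \<le> (\<Sum>a\<in>X N. card (\<Union>z\<in>Z. (\<lambda>b. a @ tl b) ` Y (a ! (N * q)) z))"
      by (rule card_UN_le[OF finX])
    also have "\<dots> \<le> (\<Sum>a\<in>X N. \<Sum>z\<in>Z. card ((\<lambda>b. a @ tl b) ` Y (a ! (N * q)) z))"
      by (intro sum_mono card_UN_le Z)
    also have "\<dots> \<le> (\<Sum>a\<in>X N. \<Sum>z\<in>Z. card (Y (a ! (N * q)) z))"
      by (intro sum_mono card_image_le finY)
    finally show ?thesis .
  qed
  then have "real (card (X (Suc N))) \<le> (\<Sum>a\<in>X N. \<Sum>z\<in>Z. real (card (Y (a ! (N * q)) z)))"
    by (simp flip: of_nat_sum)
  also have "\<dots> \<le> (\<Sum>a\<in>X N. \<Sum>z\<in>Z. ?B)" by (intro sum_mono cY)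
  also have "\<dots> = real (card (X N)) * (real (card Z) * ?B)" by simp
  also have "\<dots> \<le> (real (card Z) * ?B) ^ N * (real (card Z) * ?B)"
    using Suc B0 by (intro mult_right_mono) (auto simp: X_def)
  finally show ?case by (simp add: X_def mult_ac)
qed

lemma card_Union_edges:
  assumes "simple_graph V E" "S \<subseteq> E" shows "finite (\<Union>S)" "card (\<Union>S) \<le> 2 * card S"
proof -
  have S: "finite S" "\<And>e. e \<in> S \<Longrightarrow> card e = 2"
    using assms simple_graphD[OF assms(1)] finite_subset by blast+
  show "finite (\<Union>S)" using S by (metis card.infinite finite_Union zero_neq_numeral)
  have "card (\<Union>S) \<le> (\<Sum>e\<in>S. card e)" using S card_Union_le_sum_card by blast
  then show "card (\<Union>S) \<le> 2 * card S" using S by simp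
qed

lemma support_subset: "w \<in> nbws E T u \<Longrightarrow> w' \<in> nbws E T u \<Longrightarrow> support T w w' \<subseteq> E"
  unfolding support_def by (intro Un_least nbws_steps) auto

text \<open>All cut vertices of both walks lie on edges of \<open>S\<close>, so there are at most
  \<open>2 * card S\<close> candidates for each. The two walks are bounded independently, which
  gives the exponent \<open>2 * N\<close>.\<close>

lemma card_pairs_of_support:
  assumes sub: "subcritical r0 \<delta> l V E" and VE: "simple_graph V E" and \<delta>: "\<delta> \<ge> 0"
    and q: "(r0 + 2) * q \<le> l" "1 \<le> q" and N: "1 \<le> N" and S: "S \<subseteq> E"
  shows "real (card {(w, w'). w \<in> nbws E (N * q) u \<and> w' \<in> nbws E (N * q) u \<and> support (N * q) w w' = S})
    \<le> (2 * real (card S) * walk_bound r0 \<delta> l q) ^ (2 * N)"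
proof -
  let ?T = "N * q" and ?B = "walk_bound r0 \<delta> l q"
  let ?X = "{w \<in> nbws E (N * q) u. \<forall>j\<le>N. w ! (j * q) \<in> \<Union>S}"
  note U = card_Union_edges[OF VE S]
  have finX: "finite ?X" using finite_nbws[OF simple_graphD(3)[OF VE]] by simp
  have mem: "w ! (j * q) \<in> \<Union>(steps ((!) w) 0 ?T)" if "j \<le> N" for j and w :: "'a list"
  proof -
    have "0 < ?T" using q N by simp
    then have "w ! 0 \<in> \<Union>(steps ((!) w) 0 ?T)" by (rule start_in_steps)
    then have "w ! (j * q) \<in> \<Union>(steps ((!) w) 0 ?T \<union> steps ((!) w) 0 (j * q))" by (rule mem_Union_steps) simp
    moreover have "steps ((!) w) 0 (j * q) \<subseteq> steps ((!) w) 0 ?T" using that by (intro steps_mono) auto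
    ultimately show ?thesis by (simp add: Un_absorb2)
  qed
  have "{(w, w'). w \<in> nbws E ?T u \<and> w' \<in> nbws E ?T u \<and> support ?T w w' = S} \<subseteq> ?X \<times> ?X"
    using mem unfolding support_def by blast
  then have "card {(w, w'). w \<in> nbws E ?T u \<and> w' \<in> nbws E ?T u \<and> support ?T w w' = S} \<le> card (?X \<times> ?X)"
    using finX by (intro card_mono) auto
  then have "real (card {(w, w'). w \<in> nbws E ?T u \<and> w' \<in> nbws E ?T u \<and> support ?T w w' = S})
    \<le> real (card ?X) * real (card ?X)" by (simp add: card_cartesian_product flip: of_nat_mult)
  also have "\<dots> \<le> (real (card (\<Union>S)) * ?B) ^ N * (real (card (\<Union>S)) * ?B) ^ N"
    by (intro mult_mono card_block_walks[OF sub VE \<delta> q(1) U(1)]) (auto intro!: zero_le_power mult_nonneg_nonneg simp: walk_bound_def \<delta>)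
  also have "\<dots> = (real (card (\<Union>S)) * ?B) ^ (2 * N)" by (simp add: power_add[symmetric] mult_2)
  also have "\<dots> \<le> (2 * real (card S) * ?B) ^ (2 * N)"
    using U(2) \<delta> by (intro power_mono mult_right_mono) (auto simp: walk_bound_def)
  finally show ?thesis .
qed

text \<open>The first factor counts the possible supports: \<open>(M + 1) * (F + 1)\<close> choices
  for the numbers of edges and runs, times the largest number of encodings. The second counts the
  pairs with a given support.\<close>

lemma card_pairs:
  assumes sub: "subcritical r0 \<delta> l V E" and VE: "simple_graph V E" and reg: "regular_graph d V E"
    and d: "2 \<le> d" and \<delta>: "\<delta> \<ge> 0"
    and q: "(r0 + 2) * q \<le> l" "1 \<le> q" and N: "1 \<le> N" and M: "1 \<le> M"
  defines "F \<equiv> 2 * N + 2 * N * (2 * N * (r0 + 1))"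
  shows "real (card {(w, w'). w \<in> nbws E (N * q) u \<and> w' \<in> nbws E (N * q) u \<and> card (support (N * q) w w') \<le> M})
    \<le> real ((M + 1) * (F + 1) * ((d - 1) ^ M * (d * M\<^sup>2) ^ F)) * (2 * real M * walk_bound r0 \<delta> l q) ^ (2 * N)"
proof -
  let ?T = "N * q" and ?B = "walk_bound r0 \<delta> l q"
  define P where "P S = {(w, w'). w \<in> nbws E ?T u \<and> w' \<in> nbws E ?T u \<and> support ?T w w' = S}" for S
  define A where "A = (\<Union>(m, k)\<in>{..M} \<times> {..F}. edge_runs E u m k)"
  define I where "I = {S \<in> fst ` A. S \<subseteq> E \<and> card S \<le> M}"
  note fc = card_edge_runs[OF VE reg d]
  have finA: "finite A" using fc by (auto simp: A_def)
  have cA: "card A \<le> (M + 1) * (F + 1) * ((d - 1) ^ M * (d * M\<^sup>2) ^ F)"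
  proof -
    have "card A \<le> (\<Sum>(m, k)\<in>{..M} \<times> {..F}. card (edge_runs E u m k))"
      unfolding A_def by (rule order_trans[OF card_UN_le]) (auto simp: case_prod_unfold)
    also have "\<dots> \<le> (\<Sum>(m, k)\<in>{..M} \<times> {..F}. (d - 1) ^ M * (d * M\<^sup>2) ^ F)"
    proof (rule sum_mono)
      fix p assume "p \<in> {..M} \<times> {..F}"
      then obtain m k where p: "p = (m, k)" "m \<le> M" "k \<le> F" by auto
      have "card (edge_runs E u m k) \<le> (d - 1) ^ m * (d * m\<^sup>2) ^ k" using fc by blast
      also have "\<dots> \<le> (d - 1) ^ M * (d * M\<^sup>2) ^ k"
        using p d by (intro mult_mono power_increasing power_mono) auto
      also have "\<dots> \<le> (d - 1) ^ M * (d * M\<^sup>2) ^ F"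
        using p d M by (intro mult_left_mono power_increasing) auto
      finally show "(case p of (m, k) \<Rightarrow> card (edge_runs E u m k)) \<le> (case p of (m, k) \<Rightarrow> (d - 1) ^ M * (d * M\<^sup>2) ^ F)"
        using p by simp
    qed
    also have "\<dots> = (M + 1) * (F + 1) * ((d - 1) ^ M * (d * M\<^sup>2) ^ F)"
      by (simp add: case_prod_unfold)
    finally show ?thesis .
  qed
  have finP: "finite (P S)" for S
    using finite_nbws[OF simple_graphD(3)[OF VE], of ?T u]
    by (intro finite_subset[of "P S" "nbws E ?T u \<times> nbws E ?T u"]) (auto simp: P_def)
  have finI: "finite I" using finA by (simp add: I_def)
  have q2: "2 * q \<le> l"
  proof -
    have "2 * q \<le> (r0 + 2) * q" by simp
    then show ?thesis using q by linarith
  qed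
  have cover: "{(w, w'). w \<in> nbws E ?T u \<and> w' \<in> nbws E ?T u \<and> card (support ?T w w') \<le> M} \<subseteq> (\<Union>S\<in>I. P S)"
  proof (clarify)
    fix w w' assume w: "w \<in> nbws E ?T u" "w' \<in> nbws E ?T u" and c: "card (support ?T w w') \<le> M"
    obtain k p where "k \<le> F" "(support ?T w w', p) \<in> edge_runs E u (card (support ?T w w')) k"
      using support_in_edge_runs[OF sub VE q(2) q2 w] unfolding F_def by blast
    then have "(support ?T w w', p) \<in> A" using c unfolding A_def by blast
    then have "support ?T w w' \<in> I" using c support_subset[OF w] unfolding I_def by force
    then show "(w, w') \<in> (\<Union>S\<in>I. P S)" using w unfolding P_def by blast
  qed
  have "card {(w, w'). w \<in> nbws E ?T u \<and> w' \<in> nbws E ?T u \<and> card (support ?T w w') \<le> M} \<le> card (\<Union>S\<in>I. P S)"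
    using finI finP by (intro card_mono cover) auto
  also have "\<dots> \<le> (\<Sum>S\<in>I. card (P S))" by (rule card_UN_le[OF finI])
  finally have "real (card {(w, w'). w \<in> nbws E ?T u \<and> w' \<in> nbws E ?T u \<and> card (support ?T w w') \<le> M})
    \<le> (\<Sum>S\<in>I. real (card (P S)))" by (simp flip: of_nat_sum)
  also have "\<dots> \<le> (\<Sum>S\<in>I. (2 * real M * ?B) ^ (2 * N))"
  proof (rule sum_mono)
    fix S assume S: "S \<in> I"
    have "real (card (P S)) \<le> (2 * real (card S) * ?B) ^ (2 * N)"
      unfolding P_def using S by (intro card_pairs_of_support[OF sub VE \<delta> q N]) (simp add: I_def)
    also have "\<dots> \<le> (2 * real M * ?B) ^ (2 * N)"
      using S \<delta> by (intro power_mono mult_right_mono) (auto simp: I_def walk_bound_def)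
    finally show "real (card (P S)) \<le> (2 * real M * ?B) ^ (2 * N)" .
  qed
  also have "\<dots> = real (card I) * (2 * real M * ?B) ^ (2 * N)" by simp
  also have "\<dots> \<le> real ((M + 1) * (F + 1) * ((d - 1) ^ M * (d * M\<^sup>2) ^ F)) * (2 * real M * ?B) ^ (2 * N)"
  proof (rule mult_right_mono)
    have "card I \<le> card (fst ` A)" using finA by (intro card_mono) (auto simp: I_def)
    also have "\<dots> \<le> card A" using finA by (rule card_image_le)
    finally show "real (card I) \<le> real ((M + 1) * (F + 1) * ((d - 1) ^ M * (d * M\<^sup>2) ^ F))"
      using cA by (simp only: of_nat_le_iff)
  qed (auto simp: walk_bound_def \<delta> intro!: zero_le_power mult_nonneg_nonneg)
  finally show ?thesis .
qed

section \<open>Averaging over the solution family\<close>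

text \<open>By default the simplifier turns the field operations of \<^typ>\<open>bit\<close> into bit operations.\<close>

declare add_bit_eq_xor [simp del] mult_bit_eq_and [simp del]

text \<open>The nontrivial character of the two-element group.\<close>

definition sgnb :: "bit \<Rightarrow> real" where
  "sgnb b = (if b = 0 then 1 else - 1)"

lemma sgnb_0 [simp]: "sgnb 0 = 1" and sgnb_1 [simp]: "sgnb 1 = - 1"
  by (simp_all add: sgnb_def)

lemma sgnb_add: "sgnb (a + b) = sgnb a * sgnb b"
  by (cases a; cases b) (simp_all add: sgnb_def)

lemma sgnb_sum: "finite A \<Longrightarrow> sgnb (\<Sum>i\<in>A. f i) = (\<Prod>i\<in>A. sgnb (f i))"
  by (induction A rule: finite_induct) (simp_all add: sgnb_add)

lemma dot_add_right: "dot E y (z + z') = dot E y z + dot E y z'"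
  by (simp add: dot_def distrib_left sum.distrib)

lemma dot_add_left: "dot E (y + y') z = dot E y z + dot E y' z"
  by (simp add: dot_def distrib_right sum.distrib)

text \<open>Double orthogonal complement over the two-element field, by adding the generators one at
  a time. If every \<open>y\<close> orthogonal to \<open>B\<close> is orthogonal to \<open>b\<close>
  too, then \<open>b\<close> adds no condition; otherwise \<open>z\<close> is corrected by a
  multiple of \<open>b\<close>.\<close>

lemma in_span_if_annihilated:
  assumes fin: "finite E" and B: "finite B" "\<And>b e. b \<in> B \<Longrightarrow> e \<notin> E \<Longrightarrow> b e = 0" and z: "\<And>e. e \<notin> E \<Longrightarrow> z e = 0"
    and ann: "\<And>y. (\<And>b. b \<in> B \<Longrightarrow> dot E y b = 0) \<Longrightarrow> dot E y z = 0"
  shows "z \<in> F2.span B"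
  using B z ann
proof (induction B arbitrary: z rule: finite_induct)
  case empty
  have "z e = 0" for e
  proof (cases "e \<in> E")
    case True
    have "dot E (\<lambda>e'. if e' = e then 1 else 0) z = z e"
      using True fin by (simp add: dot_def if_distrib[of "\<lambda>x. x * _"] cong: if_cong)
    then show ?thesis using empty(3)[of "\<lambda>e'. if e' = e then 1 else 0"] by simp
  qed (use empty in auto)
  then have "z = 0" by (simp add: fun_eq_iff)
  then show ?case using F2.span_zero[of "{}"] by (simp add: zero_fun_def)
next
  case (insert b B)
  show ?case
  proof (cases "\<exists>y0. (\<forall>c\<in>B. dot E y0 c = 0) \<and> dot E y0 b = 1")
    case False
    have "dot E y z = 0" if y: "\<And>c. c \<in> B \<Longrightarrow> dot E y c = 0" for y
    proof (rule insert.prems(3))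
      fix c assume "c \<in> insert b B"
      moreover have "dot E y b \<noteq> 1" using False y by blast
      ultimately show "dot E y c = 0" using y by auto
    qed
    then have "z \<in> F2.span B" using insert.IH insert.prems(1,2) by blast
    then show ?thesis using F2.span_mono[of B "insert b B"] by blast
  next
    case True
    then obtain y0 where y0: "\<And>c. c \<in> B \<Longrightarrow> dot E y0 c = 0" "dot E y0 b = 1" by blast
    \<comment> \<open>The correction makes \<open>y0\<close> annihilate \<open>z'\<close>. If
      \<open>y\<close> annihilates \<open>B\<close> but not \<open>b\<close>, then
      \<open>y + y0\<close> annihilates both and therefore \<open>z\<close>; so \<open>y\<close> and
      \<open>y0\<close> agree on \<open>z\<close>, and on \<open>b\<close>.\<close>
    define z' where "z' = (if dot E y0 z = 0 then z else z + b)"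
    have z0: "z' e = 0" if "e \<notin> E" for e
      using insert.prems(1)[of b e] insert.prems(2)[of e] that by (simp add: z'_def)
    have "dot E y z' = 0" if y: "\<And>c. c \<in> B \<Longrightarrow> dot E y c = 0" for y
    proof (cases "dot E y b = 0")
      case True
      then have "dot E y z = 0" using y by (intro insert.prems(3)) auto
      then show ?thesis using True by (simp add: z'_def dot_add_right)
    next
      case False
      then have yb: "dot E y b = 1" by simp
      have "dot E (y + y0) z = 0"
      proof (rule insert.prems(3))
        fix c assume "c \<in> insert b B"
        then show "dot E (y + y0) c = 0" using y y0 yb by (auto simp: dot_add_left)
      qed
      then have "dot E y z = dot E y0 z" by (cases "dot E y z"; cases "dot E y0 z") (simp_all add: dot_add_left)
      then show ?thesis using yb by (simp add: z'_def dot_add_right)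
    qed
    then have z': "z' \<in> F2.span B" using insert.IH insert.prems(1) z0 by blast
    have bb: "b + b = 0" by (simp add: fun_eq_iff)
    have "z = z' \<or> z = z' + b"
      using bb by (simp add: z'_def add.assoc)
    moreover have "z' \<in> F2.span (insert b B)" "b \<in> F2.span (insert b B)"
      using z' F2.span_mono[of B "insert b B"] F2.span_base[of b "insert b B"] by blast+
    ultimately show ?thesis using F2.span_add by blast
  qed
qed

lemma chi_outside: "C \<subseteq> E \<Longrightarrow> e \<notin> E \<Longrightarrow> chi C e = 0"
  by (auto simp: chi_def)

text \<open>Being zero off \<open>E\<close> leaves one code for each signing of \<open>E\<close>, so
  the set is finite and can be averaged over.\<close>

definition solutions :: "'a set set \<Rightarrow> 'a set set set \<Rightarrow> ('a set \<Rightarrow> bit) set" where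
  "solutions E \<C> = {s. (\<forall>e. e \<notin> E \<longrightarrow> s e = 0) \<and> (\<forall>C\<in>\<C>. dot E s (chi C) = 1)}"

lemma finite_solutions: "finite E \<Longrightarrow> finite (solutions E \<C>)"
proof -
  assume "finite E"
  moreover have "(UNIV :: bit set) = {0, 1}" by auto
  then have "finite (UNIV :: bit set)" by (metis finite.simps)
  ultimately have "finite {s. \<forall>e. (e \<in> E \<longrightarrow> s e \<in> (UNIV :: bit set)) \<and> (e \<notin> E \<longrightarrow> s e = 0)}"
    by (rule finite_set_of_finite_funs)
  then show ?thesis by (rule finite_subset[rotated]) (auto simp: solutions_def)
qed

lemma dot_cong: "(\<And>e. e \<in> E \<Longrightarrow> s e = s' e) \<Longrightarrow> dot E s z = dot E s' z"
  by (simp add: dot_def)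

lemma solutions_nonempty:
  assumes "consistent E \<C>" shows "solutions E \<C> \<noteq> {}"
proof -
  obtain s where s: "\<And>C. C \<in> \<C> \<Longrightarrow> dot E s (chi C) = 1" using assms by (auto simp: consistent_def)
  have "dot E (\<lambda>e. if e \<in> E then s e else 0) z = dot E s z" for z by (rule dot_cong) simp
  then have "(\<lambda>e. if e \<in> E then s e else 0) \<in> solutions E \<C>" using s by (simp add: solutions_def)
  then show ?thesis by blast
qed

lemma sgnb_solution:
  assumes "s \<in> solutions E \<C>" shows "(\<lambda>e. sgnb (s e)) \<in> solution_family E \<C>"
proof -
  have "sign_code (\<lambda>e. sgnb (s e)) = s"
    by (auto simp: sign_code_def sgnb_def fun_eq_iff)
  then show ?thesis using assms
    by (auto simp: solution_family_def signing_def unbalanced_def solutions_def sgnb_def)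
qed

text \<open>Since \<open>z\<close> is outside the span, some \<open>y\<close> is orthogonal to all
  cycles but not to \<open>z\<close>. Translation by \<open>y\<close> permutes the solutions and
  flips the sign of every term.\<close>

lemma character_sum_zero:
  assumes fin: "finite E" and C: "\<And>C. C \<in> \<C> \<Longrightarrow> C \<subseteq> E"
    and z: "\<And>e. e \<notin> E \<Longrightarrow> z e = 0" "z \<notin> cycle_span \<C>"
  shows "(\<Sum>s\<in>solutions E \<C>. sgnb (dot E s z)) = 0"
proof -
  have "finite \<C>" using C fin by (meson PowI finite_Pow_iff finite_subset subsetI)
  then have "finite (chi ` \<C>)" by simp
  moreover have "\<And>b e. b \<in> chi ` \<C> \<Longrightarrow> e \<notin> E \<Longrightarrow> b e = 0" using C chi_outside by blast
  ultimately obtain y0 where y0: "\<And>C. C \<in> \<C> \<Longrightarrow> dot E y0 (chi C) = 0" "dot E y0 z \<noteq> 0"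
    using in_span_if_annihilated[OF fin, of "chi ` \<C>" z] z unfolding cycle_span_def by blast
  define y where "y e = (if e \<in> E then y0 e else 0)" for e
  have dy: "dot E y x = dot E y0 x" for x by (rule dot_cong) (simp add: y_def)
  have yy: "s + y + y = s" for s
  proof
    fix e show "(s + y + y) e = s e" by (cases "s e"; cases "y e") (simp_all add: add.assoc)
  qed
  have clos: "s + y \<in> solutions E \<C>" if "s \<in> solutions E \<C>" for s
    using that y0(1) by (auto simp: solutions_def dot_add_left dy y_def)
  have "(\<Sum>s\<in>solutions E \<C>. sgnb (dot E s z)) = (\<Sum>s\<in>solutions E \<C>. sgnb (dot E (s + y) z))"
    by (rule sum.reindex_bij_witness[of _ "\<lambda>s. s + y" "\<lambda>s. s + y"]) (auto simp: yy clos)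
  also have "\<dots> = - (\<Sum>s\<in>solutions E \<C>. sgnb (dot E s z))"
    using y0(2) by (simp add: dot_add_left dy sgnb_add sum_negf)
  finally show ?thesis by simp
qed

section \<open>Signs of walks and the averaged sum of squares\<close>

definition wsign :: "('a set \<Rightarrow> real) \<Rightarrow> nat \<Rightarrow> 'a list \<Rightarrow> real" where
  "wsign \<sigma> t w = (\<Prod>i<t. \<sigma> {w ! i, w ! Suc i})"

definition parity :: "nat \<Rightarrow> 'a list \<Rightarrow> 'a set \<Rightarrow> bit" where
  "parity t w e = (\<Sum>i<t. if {w ! i, w ! Suc i} = e then 1 else 0)"

lemma parity_outside: "w \<in> nbws E t x \<Longrightarrow> e \<notin> E \<Longrightarrow> parity t w e = 0"
  unfolding parity_def by (rule sum.neutral) (auto dest: nbwsD(3))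

lemma wsign_parity:
  assumes fin: "finite E" and w: "w \<in> nbws E t x"
  shows "wsign (\<lambda>e. sgnb (s e)) t w = sgnb (dot E s (parity t w))"
proof -
  have "dot E s (parity t w) = (\<Sum>e\<in>E. \<Sum>i<t. if {w ! i, w ! Suc i} = e then s e else 0)"
    by (simp add: dot_def parity_def sum_distrib_left if_distrib[of "\<lambda>y. _ * y"] cong: if_cong)
  also have "\<dots> = (\<Sum>i<t. \<Sum>e\<in>E. if {w ! i, w ! Suc i} = e then s e else 0)"
    by (rule sum.swap)
  also have "\<dots> = (\<Sum>i<t. s {w ! i, w ! Suc i})"
    using fin nbwsD(3)[OF w] by (intro sum.cong refl) (simp add: sum.delta')
  finally show ?thesis by (simp add: wsign_def sgnb_sum)
qed

lemma weight_le_max_weight: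
  assumes "finite E" "z \<in> W" shows "weight E z \<le> max_weight E W"
  unfolding max_weight_def
proof (rule Max_ge)
  show "finite (weight E ` W)"
    by (rule finite_subset[of _ "{..card E}"]) (auto simp: weight_def intro!: card_mono assms)
qed (use assms in auto)

lemma parity_eq_card: "parity t w e = of_nat (card {i. i < t \<and> {w ! i, w ! Suc i} = e})"
proof -
  have "parity t w e = (\<Sum>i\<in>{i \<in> {..<t}. {w ! i, w ! Suc i} = e}. 1)"
    unfolding parity_def by (rule sum.inter_filter[symmetric]) simp
  then show ?thesis by simp
qed

lemma sum_traversals:
  assumes "finite S" "steps ((!) w) 0 t \<subseteq> S"
  shows "(\<Sum>e\<in>S. card {i. i < t \<and> {w ! i, w ! Suc i} = e}) = t"
proof -
  have "(\<Sum>e\<in>S. \<Sum>i\<in>{i \<in> {..<t}. {w ! i, w ! Suc i} = e}. 1) = (\<Sum>i\<in>{..<t}. 1::nat)"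
    using assms(2) by (intro sum.group assms(1)) (auto simp: steps_def)
  then show ?thesis by simp
qed

text \<open>The two walks make \<open>2 * t\<close> traversals. An edge of the support uses at least
  two of them unless it is traversed exactly once, and such an edge is counted in the weight of the
  joint parity vector.\<close>

lemma card_support_le:
  assumes fin: "finite E" and w: "w \<in> nbws E t x" and w': "w' \<in> nbws E t x"
  shows "card (support t w w') \<le> t + weight E (parity t w + parity t w')"
proof -
  let ?S = "support t w w'"
  let ?z = "parity t w + parity t w'"
  define m where "m e = card {i. i < t \<and> {w ! i, w ! Suc i} = e} + card {i. i < t \<and> {w' ! i, w' ! Suc i} = e}" for e
  have finS: "finite ?S" by (simp add: support_def)
  have "(\<Sum>e\<in>?S. m e) = 2 * t"
    unfolding m_def sum.distrib using sum_traversals[of ?S w t] sum_traversals[of ?S w' t] finS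
    by (simp add: support_def)
  moreover have "2 \<le> m e + (if ?z e \<noteq> 0 then 1 else 0)" if e: "e \<in> ?S" for e
  proof -
    have ze: "?z e = of_nat (m e)" by (simp add: parity_eq_card m_def)
    have "m e \<noteq> 0" using e by (auto simp: m_def support_def steps_def)
    moreover have "?z e = 1" if "m e = 1" using ze that by simp
    ultimately show ?thesis by (cases "m e = 1") auto
  qed
  then have "(\<Sum>e\<in>?S. 2) \<le> (\<Sum>e\<in>?S. m e + (if ?z e \<noteq> 0 then 1 else 0))" by (rule sum_mono)
  moreover have "(\<Sum>e\<in>?S. if ?z e \<noteq> 0 then 1 else 0) = card {e \<in> ?S. ?z e \<noteq> 0}"
    using finS by (simp flip: sum.inter_filter)
  moreover have "card {e \<in> ?S. ?z e \<noteq> 0} \<le> weight E ?z"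
    unfolding weight_def using fin support_subset[OF w w'] by (intro card_mono) auto
  ultimately have "2 * card ?S \<le> 2 * t + weight E ?z" by (simp add: sum.distrib)
  then show ?thesis by simp
qed

text \<open>The entry at \<open>x\<close>, \<open>v\<close> of the matrix \<open>P\<close> in the
  overview.\<close>

definition walk_sum :: "'a set set \<Rightarrow> ('a set \<Rightarrow> real) \<Rightarrow> nat \<Rightarrow> 'a \<Rightarrow> 'a \<Rightarrow> real" where
  "walk_sum E \<sigma> t x v = (\<Sum>w\<in>{w \<in> nbws E t x. w ! t = v}. wsign \<sigma> t w)"

text \<open>Each square is a sum over pairs of walks with common ends. Averaged over the solutions,
  a pair contributes 0 unless its joint parity lies in \<open>cycle_span \<C>\<close>, and then
  \<open>card_support_le\<close> makes its support small; it never contributes more than 1. Some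
  signing is no worse than the average.\<close>

lemma exists_good_signing:
  assumes VE: "simple_graph V E" and C: "\<And>C. C \<in> \<C> \<Longrightarrow> C \<subseteq> E" and cons: "consistent E \<C>"
    and M: "t + max_weight E (cycle_span \<C>) \<le> M"
  shows "\<exists>\<sigma>\<in>solution_family E \<C>. (\<Sum>x\<in>V. \<Sum>v\<in>V. (walk_sum E \<sigma> t x v)\<^sup>2) \<le>
    (\<Sum>x\<in>V. real (card {(w, w'). w \<in> nbws E t x \<and> w' \<in> nbws E t x \<and> card (support t w w') \<le> M}))"
proof -
  let ?Sol = "solutions E \<C>" and ?R = "\<Sum>x\<in>V. real (card {(w, w'). w \<in> nbws E t x \<and> w' \<in> nbws E t x \<and> card (support t w w') \<le> M})"
  note fin = simple_graphD(1,2,3)[OF VE]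
  have finS: "finite ?Sol" by (rule finite_solutions[OF fin(2)])
  define A where "A x v = {w \<in> nbws E t x. w ! t = v}" for x v
  have finA: "finite (A x v)" for x v using finite_nbws[OF fin(3)] by (simp add: A_def)
  define f where "f s = (\<Sum>x\<in>V. \<Sum>v\<in>V. (walk_sum E (\<lambda>e. sgnb (s e)) t x v)\<^sup>2)" for s
  have corr: "(\<Sum>s\<in>?Sol. wsign (\<lambda>e. sgnb (s e)) t w * wsign (\<lambda>e. sgnb (s e)) t w')
      \<le> (if card (support t w w') \<le> M then real (card ?Sol) else 0)"
    if w: "w \<in> nbws E t x" "w' \<in> nbws E t x" for w w' x
  proof -
    let ?z = "parity t w + parity t w'"
    have eq: "(\<Sum>s\<in>?Sol. wsign (\<lambda>e. sgnb (s e)) t w * wsign (\<lambda>e. sgnb (s e)) t w') = (\<Sum>s\<in>?Sol. sgnb (dot E s ?z))"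
      by (simp add: wsign_parity[OF fin(2) w(1)] wsign_parity[OF fin(2) w(2)] dot_add_right sgnb_add)
    show ?thesis
    proof (cases "card (support t w w') \<le> M")
      case True
      have "(\<Sum>s\<in>?Sol. sgnb (dot E s ?z)) \<le> (\<Sum>s\<in>?Sol. 1)" by (rule sum_mono) (simp add: sgnb_def)
      then show ?thesis using True eq by simp
    next
      case False
      have "?z \<notin> cycle_span \<C>"
      proof
        assume "?z \<in> cycle_span \<C>"
        then have "weight E ?z \<le> max_weight E (cycle_span \<C>)" by (rule weight_le_max_weight[OF fin(2)])
        then show False using False card_support_le[OF fin(2) w] M by simp
      qed
      then have "(\<Sum>s\<in>?Sol. sgnb (dot E s ?z)) = 0"
        using C parity_outside[OF w(1)] parity_outside[OF w(2)] by (intro character_sum_zero[OF fin(2)]) auto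
      then show ?thesis using False eq by simp
    qed
  qed
  have "(\<Sum>s\<in>?Sol. f s) = (\<Sum>s\<in>?Sol. \<Sum>x\<in>V. \<Sum>v\<in>V. \<Sum>w\<in>A x v. \<Sum>w'\<in>A x v.
      wsign (\<lambda>e. sgnb (s e)) t w * wsign (\<lambda>e. sgnb (s e)) t w')"
    by (simp add: f_def walk_sum_def A_def power2_eq_square sum_product)
  also have "\<dots> = (\<Sum>x\<in>V. \<Sum>v\<in>V. \<Sum>w\<in>A x v. \<Sum>w'\<in>A x v. \<Sum>s\<in>?Sol.
      wsign (\<lambda>e. sgnb (s e)) t w * wsign (\<lambda>e. sgnb (s e)) t w')"
    by (simp only: sum.swap[of _ _ ?Sol])
  also have "\<dots> \<le> (\<Sum>x\<in>V. \<Sum>v\<in>V. \<Sum>w\<in>A x v. \<Sum>w'\<in>A x v.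
      if card (support t w w') \<le> M then real (card ?Sol) else 0)"
    by (intro sum_mono corr) (auto simp: A_def)
  also have "\<dots> \<le> (\<Sum>x\<in>V. real (card ?Sol) * real (card {(w, w'). w \<in> nbws E t x \<and> w' \<in> nbws E t x \<and> card (support t w w') \<le> M}))"
  proof (rule sum_mono)
    fix x
    define P where "P v = {p \<in> A x v \<times> A x v. card (support t (fst p) (snd p)) \<le> M}" for v
    have finP: "finite (P v)" for v using finA by (simp add: P_def)
    have "(\<Sum>w\<in>A x v. \<Sum>w'\<in>A x v. if card (support t w w') \<le> M then real (card ?Sol) else 0)
        = real (card ?Sol) * real (card (P v))" for v
    proof -
      have "(\<Sum>w\<in>A x v. \<Sum>w'\<in>A x v. if card (support t w w') \<le> M then real (card ?Sol) else 0)
        = (\<Sum>p\<in>A x v \<times> A x v. if card (support t (fst p) (snd p)) \<le> M then real (card ?Sol) else 0)"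
        by (simp add: sum.cartesian_product case_prod_unfold)
      also have "\<dots> = (\<Sum>p\<in>P v. real (card ?Sol))"
        unfolding P_def using finA by (intro sum.inter_filter[symmetric]) auto
      finally show ?thesis by simp
    qed
    then have "(\<Sum>v\<in>V. \<Sum>w\<in>A x v. \<Sum>w'\<in>A x v. if card (support t w w') \<le> M then real (card ?Sol) else 0)
      = real (card ?Sol) * real (\<Sum>v\<in>V. card (P v))" by (simp add: sum_distrib_left)
    \<comment> \<open>The common end vertex tells the sets \<open>P v\<close> apart, so summing over
      \<open>v\<close> counts each pair only once.\<close>
    also have "(\<Sum>v\<in>V. card (P v)) = card (\<Union>v\<in>V. P v)"
      using fin(1) finP by (intro card_UN_disjoint[symmetric]) (auto simp: P_def A_def)
    also have "real (card (\<Union>v\<in>V. P v)) \<le> real (card {(w, w'). w \<in> nbws E t x \<and> w' \<in> nbws E t x \<and> card (support t w w') \<le> M})"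
    proof -
      have "finite (nbws E t x \<times> nbws E t x)" using finite_nbws[OF fin(3)] by simp
      then have "finite {(w, w'). w \<in> nbws E t x \<and> w' \<in> nbws E t x \<and> card (support t w w') \<le> M}"
        by (rule finite_subset[rotated]) auto
      then have "card (\<Union>v\<in>V. P v) \<le> card {(w, w'). w \<in> nbws E t x \<and> w' \<in> nbws E t x \<and> card (support t w w') \<le> M}"
        by (rule card_mono) (auto simp: P_def A_def)
      then show ?thesis by simp
    qed
    finally show "(\<Sum>v\<in>V. \<Sum>w\<in>A x v. \<Sum>w'\<in>A x v. if card (support t w w') \<le> M then real (card ?Sol) else 0)
      \<le> real (card ?Sol) * real (card {(w, w'). w \<in> nbws E t x \<and> w' \<in> nbws E t x \<and> card (support t w w') \<le> M})"
      by (simp add: mult_left_mono)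
  qed
  also have "\<dots> = (\<Sum>s\<in>?Sol. ?R)" by (simp add: sum_distrib_left)
  finally have "(\<Sum>s\<in>?Sol. f s) \<le> (\<Sum>s\<in>?Sol. ?R)" .
  then have "\<exists>s\<in>?Sol. f s \<le> ?R"
    using sum_strict_mono[OF finS solutions_nonempty[OF cons], of "\<lambda>_. ?R" f] by (meson not_less)
  then show ?thesis unfolding f_def using sgnb_solution by blast
qed

section \<open>Spectral radius and non-backtracking walks\<close>

text \<open>The coefficient counts how often \<open>u - v - u\<close> can be put in front of a non-backtracking walk of length \<open>t\<close> from \<open>u\<close>
  with no backtracking at the junction: \<open>v\<close> must differ from the second vertex of the walk, if there is one.\<close>

fun nbpoly :: "nat \<Rightarrow> real \<Rightarrow> nat \<Rightarrow> real" where
  "nbpoly d r 0 = 1"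
| "nbpoly d r (Suc 0) = r"
| "nbpoly d r (Suc (Suc t)) = r * nbpoly d r (Suc t) - (if t = 0 then real d else real d - 1) * nbpoly d r t"

text \<open>Hence the square depends only on the absolute value of \<open>r\<close>, and a negative
  eigenvalue can be treated as a positive one.\<close>

lemma nbpoly_minus: "nbpoly d (- r) t = (- 1) ^ t * nbpoly d r t"
  by (induction d r t rule: nbpoly.induct) (simp_all add: algebra_simps)

text \<open>The characteristic roots of the recurrence are \<open>a * z\<close> and
  \<open>a / z\<close>. Subtracting \<open>a / z\<close> times the previous term leaves a geometric
  sequence of ratio \<open>a * z\<close> that starts with \<open>a^2 * z^2 - 1\<close>; by
  \<open>2 <= a^2\<close> this is at least half of \<open>a^2 * z^2\<close>. The subtracted terms
  are nonnegative.\<close>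

lemma nbpoly_lower:
  assumes a: "a > 0" "a\<^sup>2 = real d - 1" "2 \<le> a\<^sup>2" and z: "1 \<le> z"
  shows "(a * z) ^ Suc t / 2 \<le> nbpoly d (a * (z + 1 / z)) (Suc t)"
proof -
  let ?r = "a * (z + 1 / z)"
  let ?p = "nbpoly d ?r"
  have z0: "z > 0" using z by simp
  have rz: "?r - a / z = a * z" "?r * (a * z) = a\<^sup>2 * z\<^sup>2 + a\<^sup>2"
    using z0 by (simp_all add: field_simps power2_eq_square)
  have D: "?p (Suc (Suc t)) - a / z * ?p (Suc t) = (a * z) ^ t * (a\<^sup>2 * z\<^sup>2 - 1)" for t
  proof (induction t)
    case 0
    have "?p (Suc (Suc 0)) - a / z * ?p (Suc 0) = ?r * (?r - a / z) - real d"
      by (simp add: algebra_simps)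
    then show ?case using rz a(2) by simp
  next
    case (Suc t)
    have "?p (Suc (Suc (Suc t))) - a / z * ?p (Suc (Suc t)) = (?r - a / z) * ?p (Suc (Suc t)) - a\<^sup>2 * ?p (Suc t)"
      unfolding nbpoly.simps(3)[of d ?r "Suc t"] a(2) by (simp add: left_diff_distrib del: nbpoly.simps(3))
    also have "\<dots> = a * z * (?p (Suc (Suc t)) - a / z * ?p (Suc t))"
      using z0 by (simp add: rz right_diff_distrib power2_eq_square del: nbpoly.simps(3))
    finally show ?case using Suc by (simp add: mult_ac)
  qed
  have "2 * 1 \<le> a\<^sup>2 * z\<^sup>2" using a z by (intro mult_mono) auto
  then have half: "a\<^sup>2 * z\<^sup>2 / 2 \<le> a\<^sup>2 * z\<^sup>2 - 1" by simp
  have ge: "(a * z) ^ Suc (Suc t) / 2 \<le> (a * z) ^ t * (a\<^sup>2 * z\<^sup>2 - 1)" for t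
  proof -
    have "(a * z) ^ Suc (Suc t) / 2 = (a * z) ^ t * (a\<^sup>2 * z\<^sup>2 / 2)"
      by (simp add: power2_eq_square mult_ac)
    also have "\<dots> \<le> (a * z) ^ t * (a\<^sup>2 * z\<^sup>2 - 1)"
      using half a z0 by (intro mult_left_mono) auto
    finally show ?thesis .
  qed
  have pos: "0 \<le> ?p (Suc t)" for t
  proof (induction t)
    case 0 then show ?case using a z0 by simp
  next
    case (Suc t)
    have "0 \<le> (a * z) ^ Suc (Suc t) / 2" using a z0 by simp
    also have "\<dots> \<le> ?p (Suc (Suc t)) - a / z * ?p (Suc t)" using ge D by simp
    finally have "a / z * ?p (Suc t) \<le> ?p (Suc (Suc t))" by simp
    moreover have "0 \<le> a / z * ?p (Suc t)" using Suc a z0 by simp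
    ultimately show ?case by linarith
  qed
  show ?thesis
  proof (cases t)
    case 0
    have "a * z / 2 \<le> a * z" "0 \<le> a * 2 / z" "0 \<le> a * (1 / z)" using a z0 by simp_all
    then show ?thesis using 0 by (simp add: distrib_left)
  next
    case (Suc s)
    have "0 \<le> a / z * ?p (Suc s)" using pos[of s] a z0 by simp
    then show ?thesis unfolding Suc using ge[of s] D[of s] by linarith
  qed
qed

section \<open>Non-backtracking walk sums of an eigenvector\<close>

context
  fixes V :: "'a set" and E :: "'a set set" and d :: nat and \<sigma> :: "'a set \<Rightarrow> real" and x :: "'a \<Rightarrow> complex"
  assumes VE: "simple_graph V E" and reg: "regular_graph d V E" and sig: "signing E \<sigma>"
begin

text \<open>The walks from \<open>v\<close> before which the step from \<open>u\<close> to
  \<open>v\<close> can be put. A walk of length 0 has no second vertex to be tested.\<close>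

definition extending :: "'a \<Rightarrow> 'a \<Rightarrow> nat \<Rightarrow> 'a list set" where
  "extending u v t = {w \<in> nbws E t v. t = 0 \<or> w ! 1 \<noteq> u}"

definition walk_val :: "nat \<Rightarrow> 'a list \<Rightarrow> complex" where
  "walk_val t w = of_real (wsign \<sigma> t w) * x (w ! t)"

lemma finite_extending: "finite (extending u v t)"
  using finite_nbws[OF simple_graphD(3)[OF VE]] by (simp add: extending_def)

lemma Cons_nbws_iff: "u # w \<in> nbws E (Suc t) u' \<longleftrightarrow> u = u' \<and> {u, w ! 0} \<in> E \<and> w \<in> extending u (w ! 0) t"
proof -
  have 1: "(\<forall>i<Suc t. {(u # w) ! i, (u # w) ! Suc i} \<in> E) \<longleftrightarrow> {u, w ! 0} \<in> E \<and> (\<forall>i<t. {w ! i, w ! Suc i} \<in> E)"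
    by (auto simp: less_Suc_eq_0_disj)
  have 2: "(\<forall>i. Suc i < Suc t \<longrightarrow> (u # w) ! i \<noteq> (u # w) ! Suc (Suc i)) \<longleftrightarrow>
    (t = 0 \<or> w ! 1 \<noteq> u) \<and> (\<forall>i. Suc i < t \<longrightarrow> w ! i \<noteq> w ! Suc (Suc i))" (is "?L \<longleftrightarrow> ?R")
  proof
    assume L: ?L
    show ?R
    proof (intro conjI allI impI)
      show "t = 0 \<or> w ! 1 \<noteq> u" using L[rule_format, of 0] by (cases t) auto
      fix i assume "Suc i < t"
      then show "w ! i \<noteq> w ! Suc (Suc i)" using L[rule_format, of "Suc i"] by simp
    qed
  next
    assume R: ?R
    show ?L
    proof (intro allI impI)
      fix i assume "Suc i < Suc t"
      then show "(u # w) ! i \<noteq> (u # w) ! Suc (Suc i)" using R by (cases i) auto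
    qed
  qed
  show ?thesis unfolding nbws_def extending_def mem_Collect_eq 1 2 by auto
qed

lemma walk_val_Cons:
  assumes "w \<in> extending u v t"
  shows "walk_val (Suc t) (u # w) = of_real (\<sigma> {u, v}) * walk_val t w"
proof -
  have "wsign \<sigma> (Suc t) (u # w) = \<sigma> {u, w ! 0} * wsign \<sigma> t w"
    unfolding wsign_def by (subst prod.lessThan_Suc_shift) simp
  then show ?thesis using assms by (simp add: walk_val_def extending_def nbws_def)
qed

lemma nbws_Suc_eq: "nbws E (Suc t) u = (\<Union>v\<in>{v. {u, v} \<in> E}. Cons u ` extending u v t)"
proof (intro equalityI subsetI)
  fix w assume w: "w \<in> nbws E (Suc t) u"
  then obtain a w' where "w = a # w'" by (cases w) (auto simp: nbws_def)
  then show "w \<in> (\<Union>v\<in>{v. {u, v} \<in> E}. Cons u ` extending u v t)" using w Cons_nbws_iff by auto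
next
  fix w assume "w \<in> (\<Union>v\<in>{v. {u, v} \<in> E}. Cons u ` extending u v t)"
  then obtain v w' where w': "{u, v} \<in> E" "w' \<in> extending u v t" "w = u # w'" by auto
  moreover have "w' ! 0 = v" using w'(2) by (simp add: extending_def nbws_def)
  ultimately show "w \<in> nbws E (Suc t) u" using Cons_nbws_iff by simp
qed

text \<open>The entry at \<open>u\<close> of the signed walk matrix applied to \<open>x\<close>; see
  \<open>walk_total_by_end\<close>.\<close>

definition walk_total :: "nat \<Rightarrow> 'a \<Rightarrow> complex" where
  "walk_total t u = (\<Sum>w\<in>nbws E t u. walk_val t w)"

lemma walk_total_Suc:
  "walk_total (Suc t) u = (\<Sum>v\<in>{v. {u, v} \<in> E}. of_real (\<sigma> {u, v}) * (\<Sum>w\<in>extending u v t. walk_val t w))"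
proof -
  have "walk_total (Suc t) u = (\<Sum>v\<in>{v. {u, v} \<in> E}. \<Sum>w\<in>Cons u ` extending u v t. walk_val (Suc t) w)"
    unfolding walk_total_def nbws_Suc_eq
    using finite_neighbours[OF VE] finite_extending
    by (intro sum.UNION_disjoint) (auto simp: extending_def nbws_def)
  also have "\<dots> = (\<Sum>v\<in>{v. {u, v} \<in> E}. of_real (\<sigma> {u, v}) * (\<Sum>w\<in>extending u v t. walk_val t w))"
    by (intro sum.cong refl) (simp add: sum.reindex walk_val_Cons sum_distrib_left)
  finally show ?thesis .
qed

text \<open>The walks excluded from \<open>extending u v\<close> step from \<open>v\<close> back to
  \<open>u\<close>. Without that step they are walks from \<open>u\<close> that do not proceed to
  \<open>v\<close>.\<close>

lemma sum_extending_Suc: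
  assumes uv: "{u, v} \<in> E"
  shows "(\<Sum>w\<in>extending u v (Suc t). walk_val (Suc t) w) =
    walk_total (Suc t) v - of_real (\<sigma> {u, v}) * (\<Sum>w\<in>extending v u t. walk_val t w)"
proof -
  have eq: "{w \<in> nbws E (Suc t) v. w ! 1 = u} = Cons v ` extending v u t"
  proof (intro equalityI subsetI)
    fix w assume w: "w \<in> {w \<in> nbws E (Suc t) v. w ! 1 = u}"
    then obtain a w' where "w = a # w'" by (cases w) (auto simp: nbws_def)
    then show "w \<in> Cons v ` extending v u t" using w Cons_nbws_iff by auto
  next
    fix w assume "w \<in> Cons v ` extending v u t"
    then obtain w' where w': "w' \<in> extending v u t" "w = v # w'" by auto
    moreover have "w' ! 0 = u" using w'(1) by (simp add: extending_def nbws_def)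
    ultimately show "w \<in> {w \<in> nbws E (Suc t) v. w ! 1 = u}" using Cons_nbws_iff uv by (simp add: insert_commute)
  qed
  have fin: "finite (nbws E (Suc t) v)" using finite_nbws[OF simple_graphD(3)[OF VE]] .
  have "nbws E (Suc t) v = extending u v (Suc t) \<union> Cons v ` extending v u t"
    unfolding eq[symmetric] by (auto simp: extending_def)
  moreover have "extending u v (Suc t) \<inter> Cons v ` extending v u t = {}"
    unfolding eq[symmetric] by (auto simp: extending_def)
  ultimately have "walk_total (Suc t) v = (\<Sum>w\<in>extending u v (Suc t). walk_val (Suc t) w) + (\<Sum>w\<in>Cons v ` extending v u t. walk_val (Suc t) w)"
    unfolding walk_total_def using finite_extending by (simp add: sum.union_disjoint)
  also have "(\<Sum>w\<in>Cons v ` extending v u t. walk_val (Suc t) w) = of_real (\<sigma> {u, v}) * (\<Sum>w\<in>extending v u t. walk_val t w)"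
    by (simp add: sum.reindex walk_val_Cons sum_distrib_left insert_commute)
  finally show ?thesis by simp
qed

lemma sum_sum_extending:
  assumes u: "u \<in> V"
  shows "(\<Sum>v\<in>{v. {u, v} \<in> E}. \<Sum>w\<in>extending v u t. walk_val t w) =
    of_real (if t = 0 then real d else real d - 1) * walk_total t u"
proof -
  have fin: "finite {v. {u, v} \<in> E}" "finite (nbws E t u)"
    using finite_neighbours[OF VE] finite_nbws[OF simple_graphD(3)[OF VE]] by auto
  have deg: "card {v. {u, v} \<in> E} = d"
    using card_neighbours[OF VE, of u] reg u by (simp add: regular_graph_def)
  have cnt: "card {v \<in> {v. {u, v} \<in> E}. t = 0 \<or> w ! 1 \<noteq> v} = (if t = 0 then d else d - 1)"
    if w: "w \<in> nbws E t u" for w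
  proof (cases "t = 0")
    case False
    then have "{u, w ! 1} \<in> E" using nbwsD(2)[OF w] nbwsD(3)[OF w, of 0] by simp
    moreover have "{v \<in> {v. {u, v} \<in> E}. t = 0 \<or> w ! 1 \<noteq> v} = {v. {u, v} \<in> E} - {w ! 1}" using False by auto
    ultimately show ?thesis using False deg fin by simp
  qed (simp add: deg)
  have dpos: "t \<noteq> 0 \<Longrightarrow> w \<in> nbws E t u \<Longrightarrow> 1 \<le> d" for w
  proof -
    assume "t \<noteq> 0" "w \<in> nbws E t u"
    then have "w ! 1 \<in> {v. {u, v} \<in> E}" using nbwsD(2)[of w E t u] nbwsD(3)[of w E t u 0] by simp
    then show "1 \<le> d" unfolding deg[symmetric] using fin(1) by (auto simp: Suc_le_eq card_gt_0_iff)
  qed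
  have "(\<Sum>v\<in>{v. {u, v} \<in> E}. \<Sum>w\<in>extending v u t. walk_val t w)
    = (\<Sum>v\<in>{v. {u, v} \<in> E}. \<Sum>w\<in>nbws E t u. if t = 0 \<or> w ! 1 \<noteq> v then walk_val t w else 0)"
    unfolding extending_def using fin(2) by (intro sum.cong refl sum.inter_filter)
  also have "\<dots> = (\<Sum>w\<in>nbws E t u. \<Sum>v\<in>{v. {u, v} \<in> E}. if t = 0 \<or> w ! 1 \<noteq> v then walk_val t w else 0)"
    by (rule sum.swap)
  also have "\<dots> = (\<Sum>w\<in>nbws E t u. of_real (if t = 0 then real d else real d - 1) * walk_val t w)"
  proof (rule sum.cong[OF refl])
    fix w assume w: "w \<in> nbws E t u"
    have "(\<Sum>v\<in>{v. {u, v} \<in> E}. if t = 0 \<or> w ! 1 \<noteq> v then walk_val t w else 0)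
      = (\<Sum>v\<in>{v \<in> {v. {u, v} \<in> E}. t = 0 \<or> w ! 1 \<noteq> v}. walk_val t w)"
      using fin(1) by (rule sum.inter_filter[symmetric])
    also have "\<dots> = of_nat (if t = 0 then d else d - 1) * walk_val t w"
      by (simp only: sum_constant cnt[OF w])
    also have "\<dots> = of_real (if t = 0 then real d else real d - 1) * walk_val t w"
      using dpos[OF _ w] by (auto simp: of_nat_diff)
    finally show "(\<Sum>v\<in>{v. {u, v} \<in> E}. if t = 0 \<or> w ! 1 \<noteq> v then walk_val t w else 0)
      = of_real (if t = 0 then real d else real d - 1) * walk_val t w" .
  qed
  finally show ?thesis by (simp add: walk_total_def sum_distrib_left)
qed

lemma signing_square: "{u, v} \<in> E \<Longrightarrow> \<sigma> {u, v} * \<sigma> {u, v} = 1"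
  using sig by (auto simp: signing_def)

text \<open>Prefixing a step applies the signed adjacency matrix, apart from walks beginning
  \<open>u - v - u\<close>. The two equal signs of such a beginning multiply to 1, so the correction
  is a multiple of an earlier total, with the coefficient of \<open>nbpoly\<close>.\<close>

lemma walk_total_eigen:
  assumes eig: "\<And>u. u \<in> V \<Longrightarrow> (\<Sum>v\<in>{v. {u, v} \<in> E}. of_real (\<sigma> {u, v}) * x v) = of_real r * x u"
    and u: "u \<in> V"
  shows "walk_total t u = of_real (nbpoly d r t) * x u"
  using u
proof (induction t arbitrary: u rule: less_induct)
  case (less t)
  have ext0: "extending u v 0 = {[v]}" for u v by (auto simp: extending_def nbws_def length_Suc_conv)
  have nb: "v \<in> V" if "{u, v} \<in> E" for v using that simple_graphD(4)[OF VE] by auto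
  consider "t = 0" | "t = 1" | s where "t = Suc (Suc s)" by (metis One_nat_def not0_implies_Suc)
  then show ?case
  proof cases
    case 1
    have "nbws E 0 u = {[u]}" by (auto simp: nbws_def length_Suc_conv)
    then show ?thesis using 1 by (simp add: walk_total_def walk_val_def wsign_def)
  next
    case 2
    have "walk_total (Suc 0) u = (\<Sum>v\<in>{v. {u, v} \<in> E}. of_real (\<sigma> {u, v}) * x v)"
      unfolding walk_total_Suc ext0 by (simp add: walk_val_def wsign_def)
    then show ?thesis using eig[OF less(2)] 2 by simp
  next
    case 3
    let ?N = "{v. {u, v} \<in> E}" and ?p = "nbpoly d r"
    have "walk_total t u = (\<Sum>v\<in>?N. of_real (\<sigma> {u, v}) * (\<Sum>w\<in>extending u v (Suc s). walk_val (Suc s) w))"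
      unfolding 3 by (rule walk_total_Suc)
    also have "\<dots> = (\<Sum>v\<in>?N. of_real (?p (Suc s)) * (of_real (\<sigma> {u, v}) * x v) - (\<Sum>w\<in>extending v u s. walk_val s w))"
    proof (rule sum.cong[OF refl])
      fix v assume v: "v \<in> ?N"
      have IH: "walk_total (Suc s) v = of_real (?p (Suc s)) * x v" using less(1)[of "Suc s" v] 3 nb v by simp
      have sq: "complex_of_real (\<sigma> {u, v}) * complex_of_real (\<sigma> {u, v}) = 1"
        using signing_square[of u v] v by (metis mem_Collect_eq of_real_1 of_real_mult)
      have "of_real (\<sigma> {u, v}) * (\<Sum>w\<in>extending u v (Suc s). walk_val (Suc s) w)
        = of_real (\<sigma> {u, v}) * (of_real (?p (Suc s)) * x v) - (of_real (\<sigma> {u, v}) * of_real (\<sigma> {u, v})) * (\<Sum>w\<in>extending v u s. walk_val s w)"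
        using sum_extending_Suc[of u v s] v unfolding IH by (simp add: right_diff_distrib)
      then show "of_real (\<sigma> {u, v}) * (\<Sum>w\<in>extending u v (Suc s). walk_val (Suc s) w)
        = of_real (?p (Suc s)) * (of_real (\<sigma> {u, v}) * x v) - (\<Sum>w\<in>extending v u s. walk_val s w)"
        unfolding sq by (simp add: mult_ac)
    qed
    also have "\<dots> = of_real (?p (Suc s)) * (\<Sum>v\<in>?N. of_real (\<sigma> {u, v}) * x v) - (\<Sum>v\<in>?N. \<Sum>w\<in>extending v u s. walk_val s w)"
      by (simp add: sum_subtractf sum_distrib_left)
    also have "\<dots> = of_real (?p (Suc s)) * (of_real r * x u) - of_real (if s = 0 then real d else real d - 1) * (of_real (?p s) * x u)"
      unfolding eig[OF less(2)] sum_sum_extending[OF less(2)] using less(1)[of s u] less(2) 3 by simp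
    also have "\<dots> = of_real (?p t) * x u" unfolding 3 by (simp add: algebra_simps)
    finally show ?thesis .
  qed
qed

lemma walk_total_by_end:
  assumes u: "u \<in> V"
  shows "walk_total t u = (\<Sum>v\<in>V. of_real (walk_sum E \<sigma> t u v) * x v)"
proof -
  have fin: "finite (nbws E t u)" using finite_nbws[OF simple_graphD(3)[OF VE]] .
  have "w ! t \<in> V" if w: "w \<in> nbws E t u" for w
  proof -
    have "w ! t \<in> set w" using nbwsD(1)[OF w] by simp
    then show ?thesis using set_nbws[OF w] u simple_graphD(4)[OF VE] by auto
  qed
  then have "(\<Sum>v\<in>V. \<Sum>w\<in>{w \<in> nbws E t u. w ! t = v}. walk_val t w) = walk_total t u"
    unfolding walk_total_def by (intro sum.group fin simple_graphD(1)[OF VE]) auto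
  moreover have "(\<Sum>w\<in>{w \<in> nbws E t u. w ! t = v}. walk_val t w) = of_real (walk_sum E \<sigma> t u v) * x v" for v
    unfolding walk_sum_def of_real_sum sum_distrib_right
    by (intro sum.cong refl) (simp add: walk_val_def)
  ultimately show ?thesis by simp
qed

text \<open>An eigenvalue of a matrix is at most its Frobenius norm; the proof is Cauchy-Schwarz in
  each row.\<close>

lemma nbpoly_sq_le:
  assumes eig: "\<And>u. u \<in> V \<Longrightarrow> (\<Sum>v\<in>{v. {u, v} \<in> E}. of_real (\<sigma> {u, v}) * x v) = of_real r * x u"
    and nz: "u0 \<in> V" "x u0 \<noteq> 0"
  shows "(nbpoly d r t)\<^sup>2 \<le> (\<Sum>u\<in>V. \<Sum>v\<in>V. (walk_sum E \<sigma> t u v)\<^sup>2)"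
proof -
  let ?X = "\<Sum>v\<in>V. (cmod (x v))\<^sup>2"
  have finV: "finite V" by (rule simple_graphD(1)[OF VE])
  have "0 < (cmod (x u0))\<^sup>2" using nz by simp
  also have "\<dots> \<le> ?X" using nz finV by (intro member_le_sum) auto
  finally have X: "0 < ?X" .
  have "(nbpoly d r t)\<^sup>2 * (cmod (x u))\<^sup>2 \<le> (\<Sum>v\<in>V. (walk_sum E \<sigma> t u v)\<^sup>2) * ?X" if u: "u \<in> V" for u
  proof -
    have "\<bar>nbpoly d r t\<bar> * cmod (x u) = cmod (\<Sum>v\<in>V. of_real (walk_sum E \<sigma> t u v) * x v)"
      using walk_total_eigen[OF eig u] walk_total_by_end[OF u] by (metis norm_mult norm_of_real)
    also have "\<dots> \<le> (\<Sum>v\<in>V. \<bar>walk_sum E \<sigma> t u v\<bar> * cmod (x v))"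
      by (rule order_trans[OF norm_sum]) (simp add: norm_mult)
    also have "\<dots> \<le> L2_set (walk_sum E \<sigma> t u) V * L2_set (\<lambda>v. cmod (x v)) V"
      using L2_set_mult_ineq[of "walk_sum E \<sigma> t u" "\<lambda>v. cmod (x v)" V] by simp
    finally have "(\<bar>nbpoly d r t\<bar> * cmod (x u))\<^sup>2 \<le> (L2_set (walk_sum E \<sigma> t u) V * L2_set (\<lambda>v. cmod (x v)) V)\<^sup>2"
      by (intro power_mono) auto
    then show ?thesis by (simp add: power_mult_distrib L2_set_def sum_nonneg)
  qed
  then have "(\<Sum>u\<in>V. (nbpoly d r t)\<^sup>2 * (cmod (x u))\<^sup>2) \<le> (\<Sum>u\<in>V. (\<Sum>v\<in>V. (walk_sum E \<sigma> t u v)\<^sup>2) * ?X)"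
    by (rule sum_mono)
  then have "(nbpoly d r t)\<^sup>2 * ?X \<le> (\<Sum>u\<in>V. \<Sum>v\<in>V. (walk_sum E \<sigma> t u v)\<^sup>2) * ?X"
    by (simp only: sum_distrib_left[symmetric] sum_distrib_right[symmetric])
  then show ?thesis using X by simp
qed

text \<open>The matrix is Hermitian, so the form \<open>S\<close> equals its own conjugate; it is
  also \<open>k\<close> times the squared norm of \<open>x\<close>.\<close>

lemma eigenvalue_real:
  assumes eig: "\<And>u. u \<in> V \<Longrightarrow> (\<Sum>v\<in>{v. {u, v} \<in> E}. of_real (\<sigma> {u, v}) * x v) = k * x u"
    and nz: "u0 \<in> V" "x u0 \<noteq> 0"
  shows "k = of_real (Re k)"
proof -
  let ?X = "\<Sum>v\<in>V. (cmod (x v))\<^sup>2"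
  have finV: "finite V" by (rule simple_graphD(1)[OF VE])
  have "0 < (cmod (x u0))\<^sup>2" using nz by simp
  also have "\<dots> \<le> ?X" using nz finV by (intro member_le_sum) auto
  finally have X: "0 < ?X" .
  define a where "a u v = (if {u, v} \<in> E then of_real (\<sigma> {u, v}) else (0::complex))" for u v
  have a: "cnj (a u v) = a v u" for u v by (simp add: a_def insert_commute)
  define S where "S = (\<Sum>u\<in>V. \<Sum>v\<in>V. cnj (x u) * (a u v * x v))"
  have row: "(\<Sum>v\<in>V. a u v * x v) = k * x u" if u: "u \<in> V" for u
  proof -
    have "{v. {u, v} \<in> E} = {v \<in> V. {u, v} \<in> E}" using simple_graphD(4)[OF VE] by auto
    then have "(\<Sum>v\<in>{v. {u, v} \<in> E}. of_real (\<sigma> {u, v}) * x v) = (\<Sum>v\<in>V. if {u, v} \<in> E then of_real (\<sigma> {u, v}) * x v else 0)"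
      using finV by (simp add: sum.inter_filter)
    also have "\<dots> = (\<Sum>v\<in>V. a u v * x v)" by (intro sum.cong refl) (simp add: a_def)
    finally show ?thesis using eig[OF u] by simp
  qed
  have "S = (\<Sum>u\<in>V. cnj (x u) * (k * x u))"
    unfolding S_def by (intro sum.cong refl) (simp add: row flip: sum_distrib_left)
  also have "\<dots> = (\<Sum>u\<in>V. k * of_real ((cmod (x u))\<^sup>2))"
    by (intro sum.cong refl) (simp only: complex_norm_square mult_ac)
  also have "\<dots> = k * of_real ?X" by (simp add: sum_distrib_left)
  finally have S: "S = k * of_real ?X" .
  have "cnj S = (\<Sum>u\<in>V. \<Sum>v\<in>V. cnj (x v) * (a v u * x u))"
    unfolding S_def cnj_sum by (intro sum.cong refl) (simp add: a mult_ac)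
  also have "\<dots> = S" unfolding S_def by (rule sum.swap)
  finally have "cnj S = S" .
  then have "cnj k * of_real ?X = k * of_real ?X" unfolding S by simp
  moreover have "complex_of_real ?X \<noteq> 0" using X by (metis of_real_eq_0_iff less_irrefl)
  ultimately have "cnj k = k" by (metis mult_right_cancel)
  then show ?thesis by (metis Reals_cnj_iff of_real_Re)
qed

text \<open>Read the eigenvalue equation at a vertex where the modulus of \<open>x\<close> is
  largest.\<close>

lemma eigenvalue_le_degree:
  assumes eig: "\<And>u. u \<in> V \<Longrightarrow> (\<Sum>v\<in>{v. {u, v} \<in> E}. of_real (\<sigma> {u, v}) * x v) = k * x u"
    and nz: "u0 \<in> V" "x u0 \<noteq> 0"
  shows "cmod k \<le> real d"
proof -
  have finV: "finite V" by (rule simple_graphD(1)[OF VE])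
  have "Max ((\<lambda>v. cmod (x v)) ` V) \<in> (\<lambda>v. cmod (x v)) ` V"
    using finV nz(1) by (intro Max_in) auto
  then obtain u where u0: "u \<in> V" "Max ((\<lambda>v. cmod (x v)) ` V) = cmod (x u)" by auto
  then have u: "u \<in> V" "\<And>v. v \<in> V \<Longrightarrow> cmod (x v) \<le> cmod (x u)"
    using Max_ge[of "(\<lambda>v. cmod (x v)) ` V"] finV by auto
  have xu: "0 < cmod (x u)" using u(2)[OF nz(1)] nz(2) by (metis less_le_trans zero_less_norm_iff)
  have deg: "card {v. {u, v} \<in> E} = d"
    using card_neighbours[OF VE, of u] reg u by (simp add: regular_graph_def)
  have "cmod k * cmod (x u) = cmod (\<Sum>v\<in>{v. {u, v} \<in> E}. of_real (\<sigma> {u, v}) * x v)"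
    using eig[OF u(1)] by (simp add: norm_mult)
  also have "\<dots> \<le> (\<Sum>v\<in>{v. {u, v} \<in> E}. cmod (x u))"
  proof (rule order_trans[OF norm_sum], rule sum_mono)
    fix v assume v: "v \<in> {v. {u, v} \<in> E}"
    then have "\<bar>\<sigma> {u, v}\<bar> = 1" "v \<in> V" using sig simple_graphD(4)[OF VE] by (auto simp: signing_def)
    then show "cmod (of_real (\<sigma> {u, v}) * x v) \<le> cmod (x u)" using u(2) by (simp add: norm_mult)
  qed
  also have "\<dots> = real d * cmod (x u)" using deg by simp
  finally show ?thesis using xu by simp
qed

end

section \<open>From the spectral radius to the walk sums\<close>

lemma rho_eigenvector:
  assumes n: "0 < n" and VE: "simple_graph {..<n} E"
  obtains k u0 x where "cmod k = rho (signed_adjacency n E \<sigma>)" "u0 < n" "x u0 \<noteq> 0"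
    "\<forall>u\<in>{..<n}. (\<Sum>v\<in>{v. {u, v} \<in> E}. complex_of_real (\<sigma> {u, v}) * x v) = k * x u"
proof -
  let ?A = "map_mat complex_of_real (signed_adjacency n E \<sigma>)"
  have A: "?A \<in> carrier_mat n n" by (simp add: signed_adjacency_def)
  obtain k where k: "k \<in> spectrum ?A" "cmod k = rho (signed_adjacency n E \<sigma>)"
    using spectral_radius_mem_max(1)[OF A n] by (auto simp: rho_def)
  then obtain v where v: "v \<in> carrier_vec n" "v \<noteq> 0\<^sub>v n" "?A *\<^sub>v v = k \<cdot>\<^sub>v v"
    using A by (auto simp: spectrum_def eigenvalue_def eigenvector_def)
  obtain u0 where u0: "u0 < n" "v $ u0 \<noteq> 0" using v(1,2) by (metis carrier_vecD eq_vecI index_zero_vec)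
  have "(\<Sum>w\<in>{w. {u, w} \<in> E}. complex_of_real (\<sigma> {u, w}) * v $ w) = k * v $ u" if u: "u \<in> {..<n}" for u
  proof -
    have "k * v $ u = (?A *\<^sub>v v) $ u" using v u by simp
    also have "\<dots> = (\<Sum>w\<in>{..<n}. if {u, w} \<in> E then complex_of_real (\<sigma> {u, w}) * v $ w else 0)"
      using v(1) u by (auto simp: scalar_prod_def signed_adjacency_def atLeast0LessThan intro!: sum.cong)
    also have "\<dots> = (\<Sum>w\<in>{w \<in> {..<n}. {u, w} \<in> E}. complex_of_real (\<sigma> {u, w}) * v $ w)"
      by (rule sum.inter_filter[symmetric]) simp
    also have "{w \<in> {..<n}. {u, w} \<in> E} = {w. {u, w} \<in> E}" using simple_graphD(4)[OF VE] by auto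
    finally show ?thesis by simp
  qed
  then show thesis using that[of k u0 "\<lambda>u. v $ u"] k u0 by blast
qed

text \<open>Settles the cases in which the asserted bound is no smaller than
  \<open>d\<close>.\<close>

lemma rho_le_degree:
  assumes "0 < n" "simple_graph {..<n} E" "regular_graph d {..<n} E" "signing E \<sigma>"
  shows "rho (signed_adjacency n E \<sigma>) \<le> real d"
proof -
  obtain k u0 x where k: "cmod k = rho (signed_adjacency n E \<sigma>)" "u0 < n" "x u0 \<noteq> 0"
    "\<forall>u\<in>{..<n}. (\<Sum>v\<in>{v. {u, v} \<in> E}. complex_of_real (\<sigma> {u, v}) * x v) = k * x u"
    by (rule rho_eigenvector[OF assms(1,2), of \<sigma>])
  show ?thesis using eigenvalue_le_degree[OF assms(2-4) k(4)[rule_format]] k by auto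
qed

lemma rho_cases:
  assumes n: "0 < n" and VE: "simple_graph {..<n} E" and reg: "regular_graph d {..<n} E"
    and sig: "signing E \<sigma>" and d: "3 \<le> d" and t: "1 \<le> t"
  obtains "rho (signed_adjacency n E \<sigma>) \<le> 2 * sqrt (real d - 1)"
  | z where "1 \<le> z" "rho (signed_adjacency n E \<sigma>) = sqrt (real d - 1) * (z + 1 / z)"
    "((sqrt (real d - 1) * z) ^ t / 2)\<^sup>2 \<le> (\<Sum>u<n. \<Sum>v<n. (walk_sum E \<sigma> t u v)\<^sup>2)"
proof (cases "rho (signed_adjacency n E \<sigma>) \<le> 2 * sqrt (real d - 1)")
  case False
  let ?R = "rho (signed_adjacency n E \<sigma>)" and ?a = "sqrt (real d - 1)"
  have a: "0 < ?a" "?a\<^sup>2 = real d - 1" "2 \<le> ?a\<^sup>2" using d by auto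
  obtain k u0 x where k: "cmod k = ?R" "u0 < n" "x u0 \<noteq> 0"
    "\<forall>u\<in>{..<n}. (\<Sum>v\<in>{v. {u, v} \<in> E}. complex_of_real (\<sigma> {u, v}) * x v) = k * x u"
    by (rule rho_eigenvector[OF n VE, of \<sigma>])
  have kr: "k = of_real (Re k)" using eigenvalue_real[OF VE reg sig k(4)[rule_format] _ k(3)] k(2) by auto
  then have R: "?R = \<bar>Re k\<bar>" using k(1) by (metis norm_of_real)
  define s where "s = ?R / ?a"
  have s: "2 < s" using False a by (simp add: s_def field_simps)
  then have disc: "0 \<le> s\<^sup>2 - 4" using power_mono[of 2 s 2] by simp
  define w where "w = sqrt (s\<^sup>2 - 4)"
  have w: "0 \<le> w" "w * w = s * s - 4" using disc by (simp_all add: w_def power2_eq_square)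
  \<comment> \<open>The larger root of \<open>X^2 - s * X + 1\<close>; the smaller root
    \<open>(s - w) / 2\<close> is its inverse.\<close>
  define z where "z = (s + w) / 2"
  have z1: "1 \<le> z" using s w(1) by (simp add: z_def)
  have "z * ((s - w) / 2) = 1"
    using w by (simp add: z_def field_simps)
  then have "1 / z = (s - w) / 2" using z1 by (simp add: field_simps)
  then have "z + 1 / z = s" by (simp add: z_def field_simps)
  then have Rz: "?R = ?a * (z + 1 / z)" using a by (simp add: s_def)
  have "(nbpoly d (Re k) t)\<^sup>2 \<le> (\<Sum>u<n. \<Sum>v<n. (walk_sum E \<sigma> t u v)\<^sup>2)"
    using nbpoly_sq_le[OF VE reg sig, of x "Re k" u0 t] k kr by simp
  moreover have "(nbpoly d (Re k) t)\<^sup>2 = (nbpoly d ?R t)\<^sup>2"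
    unfolding R using nbpoly_minus[of d "Re k" t] by (simp add: abs_if power_mult_distrib flip: power_mult)
  moreover have "((?a * z) ^ t / 2)\<^sup>2 \<le> (nbpoly d ?R t)\<^sup>2"
  proof (rule power_mono)
    obtain t' where "t = Suc t'" using t by (cases t) auto
    then show "(?a * z) ^ t / 2 \<le> nbpoly d ?R t" unfolding Rz using nbpoly_lower[OF a z1] by simp
    show "0 \<le> (?a * z) ^ t / 2" using a z1 by simp
  qed
  ultimately show thesis using that(2)[OF z1 Rz] by simp
qed (use that(1) in auto)

section \<open>Choice of the parameters\<close>

text \<open>The linear terms cancel. The bound for \<open>exp (- h)\<close> is obtained from
  \<open>1 + h <= exp h\<close> and \<open>(1 + h) * (1 - h + h^2) = 1 + h^3\<close>.\<close>

lemma exp_add_exp_minus_le: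
  fixes h :: real
  assumes "0 \<le> h" "h \<le> 1"
  shows "exp h + exp (- h) \<le> 2 + 2 * h\<^sup>2"
proof -
  have "exp h \<le> 1 + h + h\<^sup>2" using assms by (rule exp_bound)
  moreover have "exp (- h) \<le> 1 - h + h\<^sup>2"
  proof -
    have "1 \<le> 1 + h ^ 3" using assms by simp
    also have "\<dots> = (1 + h) * (1 - h + h\<^sup>2)" by (simp add: algebra_simps power2_eq_square power3_eq_cube)
    also have "\<dots> \<le> exp h * (1 - h + h\<^sup>2)"
    proof (rule mult_right_mono)
      show "1 + h \<le> exp h" by (rule exp_ge_add_one_self)
      have "0 \<le> h\<^sup>2" by simp
      then show "0 \<le> 1 - h + h\<^sup>2" using assms by linarith
    qed
    finally show ?thesis by (simp add: exp_minus field_simps)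
  qed
  ultimately show ?thesis by simp
qed

lemma add_inverse_mono:
  fixes z w :: real
  assumes "1 \<le> z" "z \<le> w"
  shows "z + 1 / z \<le> w + 1 / w"
proof -
  have "1 * 1 \<le> z * w" using assms by (intro mult_mono) auto
  then have "0 \<le> (w - z) * (z * w - 1)" using assms by (intro mult_nonneg_nonneg) auto
  then show ?thesis using assms by (simp add: field_simps)
qed

text \<open>Replacing \<open>1 / Y\<close> by \<open>Y\<close> makes the two exponentials symmetric,
  so that \<open>h\<close> enters only squared.\<close>

lemma add_inverse_le_if_le_mult_exp:
  fixes z Y h :: real
  assumes z: "1 \<le> z" and Y: "1 \<le> Y" and h: "0 \<le> h" "h \<le> 1" and le: "z \<le> Y * exp h"
  shows "z + 1 / z \<le> 2 * Y * (1 + h\<^sup>2)"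
proof -
  have "z + 1 / z \<le> Y * exp h + 1 / (Y * exp h)" using z le by (rule add_inverse_mono)
  also have "1 / (Y * exp h) = (1 / Y) * exp (- h)" by (simp add: exp_minus field_simps)
  also have "Y * exp h + (1 / Y) * exp (- h) \<le> Y * exp h + Y * exp (- h)"
  proof -
    have "1 / Y \<le> Y" using Y by (simp add: divide_le_eq) (metis mult_mono' mult_1 zero_le_one order_trans)
    then show ?thesis by (intro add_left_mono mult_right_mono) auto
  qed
  also have "\<dots> = Y * (exp h + exp (- h))" by (simp add: distrib_left)
  also have "\<dots> \<le> Y * (2 + 2 * h\<^sup>2)" using Y exp_add_exp_minus_le[OF h] by (intro mult_left_mono) auto
  finally show ?thesis by (simp add: algebra_simps)
qed

text \<open>Here \<open>y\<close> is \<open>ln n\<close>. Everything except \<open>exp y\<close>,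
  which is the number of starting vertices, is bounded by powers of \<open>y\<close> with total
  exponent \<open>O(N^2)\<close>, and \<open>y ^ O(N^2)\<close> is \<open>exp (O(y))\<close> because
  \<open>N^2 * ln y\<close> is at most \<open>4 * y\<close>. The leading 4 undoes the squared factor
  1/2 of \<open>nbpoly_lower\<close>.\<close>

lemma walk_pair_count_growth:
  fixes y :: real and r0 d L N q l :: nat
  assumes y: "1 \<le> ln y" "real L + 10 \<le> y" "16 * real r0 + 25 \<le> y" "real d \<le> y"
    and N: "1 \<le> N" "real (N\<^sup>2) * ln y \<le> 4 * y" and q: "1 \<le> q" "q \<le> l" "real l \<le> 4 * y" and d: "2 \<le> d"
  defines "M \<equiv> N * q + L" and "F \<equiv> 2 * N + 2 * N * (2 * N * (r0 + 1))"
  shows "4 * exp y * (real (M + 1) * real (F + 1) * (real d - 1) ^ L * (real d * (real M)\<^sup>2) ^ F) *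
      (2 * real M * (1 + (real q + 1)\<^sup>2 * (2 * real l * (2 * real q + 1) ^ (3 * r0)))) ^ (2 * N)
    \<le> exp ((1 + 4 * (70 + real L + 40 * real r0)) * y)"
proof -
  have y10: "10 \<le> y" using y(2) by simp
  then have y1: "1 \<le> y" "0 < y" by auto
  have N2: "real (N\<^sup>2) \<le> 4 * y"
  proof -
    have "real (N\<^sup>2) * 1 \<le> real (N\<^sup>2) * ln y" using y(1) by (intro mult_left_mono) auto
    then show ?thesis using N(2) by simp
  qed
  have NN: "N \<le> N\<^sup>2" using N(1) by (simp add: power2_eq_square)
  have yy: "10 * y \<le> y\<^sup>2" using y10 by (simp add: power2_eq_square)
  have Nle: "real N \<le> 2 * y"
  proof (rule power2_le_imp_le)
    have "(real N)\<^sup>2 \<le> 4 * y" using N2 by simp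
    also have "\<dots> \<le> 4 * (y * y)" using y1 by simp
    finally show "(real N)\<^sup>2 \<le> (2 * y)\<^sup>2" by (simp add: power2_eq_square)
  qed (use y1 in simp)
  have ql: "real q \<le> 4 * y" using q by (meson of_nat_le_iff order_trans)
  have M: "real M + 1 \<le> y ^ 3"
  proof -
    have "real N * real q \<le> (2 * y) * (4 * y)" using Nle ql y1 by (intro mult_mono) auto
    then have "real M + 1 \<le> 8 * y\<^sup>2 + real L + 1" by (simp add: M_def power2_eq_square)
    also have "\<dots> \<le> 8 * y\<^sup>2 + y" using y(2) by simp
    also have "\<dots> \<le> 10 * y\<^sup>2" using yy y1 by simp
    also have "\<dots> \<le> y * y\<^sup>2" using y10 by (intro mult_right_mono) auto
    finally show ?thesis by (simp add: power2_eq_square power3_eq_cube)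
  qed
  have Fle: "F \<le> N\<^sup>2 * (4 * r0 + 6)"
    using NN by (simp add: F_def power2_eq_square algebra_simps)
  have F1: "real F + 1 \<le> y\<^sup>2"
  proof -
    have "real F \<le> real (N\<^sup>2) * (4 * real r0 + 6)" using of_nat_mono[OF Fle, where 'a = real] by simp
    also have "\<dots> \<le> (4 * y) * (4 * real r0 + 6)" using N2 by (intro mult_right_mono) auto
    finally have "real F + 1 \<le> y * (16 * real r0 + 24) + 1" by (simp add: algebra_simps)
    also have "\<dots> \<le> y * (16 * real r0 + 25)" using y1 by (simp add: algebra_simps)
    also have "\<dots> \<le> y * y" using y(3) y1 by (intro mult_left_mono) auto
    finally show ?thesis by (simp add: power2_eq_square)
  qed
  have dM: "real d * (real M)\<^sup>2 \<le> y ^ 7"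
  proof -
    have "real d * (real M)\<^sup>2 \<le> y * (y ^ 3)\<^sup>2" using y(4) M y1 by (intro mult_mono power_mono) auto
    also have "\<dots> = y ^ 7" by (simp add: power_mult[symmetric] flip: power_Suc)
    finally show ?thesis .
  qed
  let ?B = "1 + (real q + 1)\<^sup>2 * (2 * real l * (2 * real q + 1) ^ (3 * r0))"
  have B: "2 * real M * ?B \<le> y ^ (11 + 6 * r0)"
  proof -
    have q1: "real q + 1 \<le> y\<^sup>2" "2 * real q + 1 \<le> y\<^sup>2" "2 * real l \<le> y\<^sup>2" using ql q(3) yy y1 by linarith+
    have "(real q + 1)\<^sup>2 * (2 * real l * (2 * real q + 1) ^ (3 * r0)) \<le> (y\<^sup>2)\<^sup>2 * (y\<^sup>2 * (y\<^sup>2) ^ (3 * r0))"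
      using q1 by (intro mult_mono power_mono) auto
    also have "\<dots> = y ^ (2 * 2 + (2 + 2 * (3 * r0)))" by (simp only: power_mult[symmetric] power_add[symmetric])
    also have "2 * 2 + (2 + 2 * (3 * r0)) = 6 + 6 * r0" by simp
    finally have "?B \<le> y ^ (6 + 6 * r0) + y ^ (6 + 6 * r0)" using one_le_power[OF y1(1), of "6 + 6 * r0"] by linarith
    also have "\<dots> \<le> y * y ^ (6 + 6 * r0)" using y10 by simp
    also have "\<dots> = y ^ Suc (6 + 6 * r0)" by (simp only: power_Suc)
    also have "Suc (6 + 6 * r0) = 7 + 6 * r0" by simp
    finally have "?B \<le> y ^ (7 + 6 * r0)" .
    then have "(2 * real M) * ?B \<le> (y * y ^ 3) * y ^ (7 + 6 * r0)"
      using M y10 y1 by (intro mult_mono) auto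
    also have "\<dots> = y ^ (Suc 3 + (7 + 6 * r0))" by (simp only: power_Suc[symmetric] power_add[symmetric])
    also have "Suc 3 + (7 + 6 * r0) = 11 + 6 * r0" by simp
    finally show ?thesis .
  qed
  \<comment> \<open>The 6 is 1 for the leading 4, plus 3 for \<open>M + 1\<close> and 2 for
    \<open>F + 1\<close>.\<close>
  let ?e = "6 + L + 7 * F + (11 + 6 * r0) * (2 * N)"
  have "4 * exp y * (real (M + 1) * real (F + 1) * (real d - 1) ^ L * (real d * (real M)\<^sup>2) ^ F) * (2 * real M * ?B) ^ (2 * N)
    \<le> y * exp y * (y ^ 3 * y\<^sup>2 * y ^ L * (y ^ 7) ^ F) * (y ^ (11 + 6 * r0)) ^ (2 * N)"
  proof (intro mult_mono power_mono)
    show "4 \<le> y" using y10 by simp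
    show "real (M + 1) \<le> y ^ 3" using M by simp
    show "real (F + 1) \<le> y\<^sup>2" using F1 by simp
    show "real d - 1 \<le> y" "0 \<le> real d - 1" using y(4) d by auto
  qed (use dM B y1 d in auto)
  also have "\<dots> = exp y * y ^ ?e"
    by (simp add: power_mult[symmetric] power_add[symmetric] mult_ac) (simp add: power_add power2_eq_square power3_eq_cube mult_ac eval_nat_numeral)
  also have "y ^ ?e = exp (real ?e * ln y)" using y1 by (simp only: exp_of_nat_mult exp_ln)
  also have "real ?e * ln y \<le> 4 * (70 + real L + 40 * real r0) * y"
  proof -
    \<comment> \<open>The constants are \<open>70 = 6 + 42 + 22\<close> and
      \<open>40 = 28 + 12\<close>.\<close>
    have "?e \<le> N\<^sup>2 * (70 + L + 40 * r0)"
    proof -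
      have "1 \<le> N\<^sup>2" using N by simp
      then have a: "6 + L \<le> N\<^sup>2 * (6 + L)" by simp
      have b: "7 * F \<le> N\<^sup>2 * (28 * r0 + 42)" using Fle by (simp add: algebra_simps)
      have c: "(11 + 6 * r0) * (2 * N) \<le> (11 + 6 * r0) * (2 * N\<^sup>2)" using NN by (intro mult_left_mono) auto
      have "?e \<le> N\<^sup>2 * (6 + L) + N\<^sup>2 * (28 * r0 + 42) + (11 + 6 * r0) * (2 * N\<^sup>2)" using a b c by linarith
      also have "\<dots> = N\<^sup>2 * (70 + L + 40 * r0)" by (simp add: algebra_simps)
      finally show ?thesis .
    qed
    then have "real ?e \<le> real (N\<^sup>2) * (70 + real L + 40 * real r0)"
      using of_nat_mono[where 'a = real] by fastforce
    then have "real ?e * ln y \<le> real (N\<^sup>2) * (70 + real L + 40 * real r0) * ln y"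
      using y(1) by (intro mult_right_mono) auto
    also have "\<dots> = (70 + real L + 40 * real r0) * (real (N\<^sup>2) * ln y)" by simp
    also have "\<dots> \<le> (70 + real L + 40 * real r0) * (4 * y)" using N(2) by (intro mult_left_mono) auto
    finally show ?thesis by (simp add: mult_ac)
  qed
  then have "exp y * exp (real ?e * ln y) \<le> exp y * exp (4 * (70 + real L + 40 * real r0) * y)" by simp
  also have "\<dots> = exp ((1 + 4 * (70 + real L + 40 * real r0)) * y)" by (simp add: mult_exp_exp distrib_right)
  finally show ?thesis .
qed

text \<open>Comparing \<open>rho_cases\<close> with the averaged pair count yields
  \<open>z ^ (2 * t) <= (1 + \<delta>) ^ (4 * t) * exp (c * y)\<close> for a constant
  \<open>c\<close>. The root of order \<open>2 * t\<close> bounds \<open>z\<close>, and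
  \<open>add_inverse_le_if_le_mult_exp\<close> turns this into a bound on the radius. The
  assumptions labelled \<open>y\<close> state how large \<open>n\<close> has to be.\<close>

lemma exists_signing_if_large:
  fixes \<delta> :: real and n r0 d L :: nat
  assumes n: "0 < n" and VE: "simple_graph {..<n} E" and reg: "regular_graph d {..<n} E"
    and sub: "subcritical r0 \<delta> (2 * nat \<lceil>ln (real n)\<rceil>) {..<n} E"
    and C: "\<And>C. C \<in> \<C> \<Longrightarrow> C \<subseteq> E" and cons: "consistent E \<C>" and L: "max_weight E (cycle_span \<C>) \<le> L"
    and \<delta>: "0 \<le> \<delta>" and d: "3 \<le> d"
  defines "y \<equiv> ln (real n)"
  defines "k \<equiv> (1 + 4 * (70 + real L + 40 * real r0)) * (real r0 + 2) / 2"
  assumes y: "1 \<le> ln y" "real L + 10 \<le> y" "16 * real r0 + 25 \<le> y" "real d \<le> y" "k\<^sup>2 * (ln y / y) \<le> 1"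
  shows "\<exists>\<sigma>\<in>solution_family E \<C>. rho (signed_adjacency n E \<sigma>)
    \<le> 2 * sqrt (real d - 1) * (1 + \<delta>)\<^sup>2 * (1 + k\<^sup>2 * (ln y / y))"
proof -
  define l where "l = 2 * nat \<lceil>y\<rceil>"
  \<comment> \<open>The largest length with \<open>(r0 + 2) * q <= l\<close>, as required for
    counting detours. The next line takes \<open>N\<close> so that \<open>N^2 * ln y\<close>
    balances \<open>y\<close>.\<close>
  define q where "q = l div (r0 + 2)"
  define N where "N = nat \<lceil>sqrt (y / ln y)\<rceil>"
  define M where "M = N * q + L"
  define F where "F = 2 * N + 2 * N * (2 * N * (r0 + 1))"
  let ?T = "N * q" and ?a = "sqrt (real d - 1)"
  have y10: "10 \<le> y" "1 \<le> y" "0 < y" using y(2) by auto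
  have ly: "0 < ln y" using y(1) by simp
  have l: "2 * y \<le> real l" "real l \<le> 4 * y" using y10 unfolding l_def by linarith+
  have q0: "(r0 + 2) * q \<le> l" unfolding q_def by (metis div_times_less_eq_dividend mult.commute)
  \<comment> \<open>Rounding down costs less than \<open>r0 + 2\<close>, which is below
    \<open>y\<close>, while \<open>l\<close> is at least \<open>2 * y\<close>.\<close>
  have qy: "y \<le> real q * (real r0 + 2)"
  proof -
    have "l mod (r0 + 2) < r0 + 2" by simp
    moreover have "l = q * (r0 + 2) + l mod (r0 + 2)" unfolding q_def by (simp only: div_mult_mod_eq)
    ultimately have "l < q * (r0 + 2) + (r0 + 2)" by linarith
    then have "real l < real q * (real r0 + 2) + (real r0 + 2)"
      using of_nat_less_iff[where 'a = real, of l "q * (r0 + 2) + (r0 + 2)"] by (simp add: algebra_simps)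
    then show ?thesis using l(1) y(3) by linarith
  qed
  have q1: "1 \<le> q" using qy y10 by (cases q) auto
  have ql: "q \<le> l" unfolding q_def by simp
  have yl: "1 \<le> y / ln y" using ln_le_minus_one[of y] y10 ly by (simp add: field_simps)
  have s1: "1 \<le> sqrt (y / ln y)" using yl by simp
  have N1: "1 \<le> N" unfolding N_def using s1 by linarith
  have Ns: "sqrt (y / ln y) \<le> real N" "real N \<le> 2 * sqrt (y / ln y)" unfolding N_def using s1 by linarith+
  have N2: "real (N\<^sup>2) * ln y \<le> 4 * y"
  proof -
    have "(real N)\<^sup>2 \<le> (2 * sqrt (y / ln y))\<^sup>2" using Ns by (intro power_mono) auto
    then have "(real N)\<^sup>2 \<le> 4 * (y / ln y)" using yl by (simp add: power_mult_distrib)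
    then show ?thesis using ly by (simp add: field_simps)
  qed
  have M1: "1 \<le> M" using N1 q1 by (simp add: M_def Suc_le_eq)
  obtain \<sigma> where \<sigma>: "\<sigma> \<in> solution_family E \<C>"
    and avg: "(\<Sum>x<n. \<Sum>v<n. (walk_sum E \<sigma> ?T x v)\<^sup>2) \<le>
      (\<Sum>x<n. real (card {(w, w'). w \<in> nbws E ?T x \<and> w' \<in> nbws E ?T x \<and> card (support ?T w w') \<le> M}))"
    using exists_good_signing[OF VE C cons, of ?T M] L by (auto simp: M_def)
  have sig: "signing E \<sigma>" using \<sigma> by (simp add: solution_family_def)
  have Y1: "1 \<le> (1 + \<delta>)\<^sup>2" using \<delta> by simp
  have tail: "0 \<le> k\<^sup>2 * (ln y / y)" using ly y10 by simp
  have rho: "rho (signed_adjacency n E \<sigma>) \<le> 2 * ?a * (1 + \<delta>)\<^sup>2 * (1 + k\<^sup>2 * (ln y / y))"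
  proof (rule rho_cases[OF n VE reg sig d, of ?T])
    show "1 \<le> ?T" using N1 q1 by (simp add: Suc_le_eq)
  next
    assume *: "rho (signed_adjacency n E \<sigma>) \<le> 2 * ?a"
    have "1 * 1 \<le> (1 + \<delta>)\<^sup>2 * (1 + k\<^sup>2 * (ln y / y))" using Y1 tail by (intro mult_mono) auto
    then have "2 * ?a * 1 \<le> 2 * ?a * ((1 + \<delta>)\<^sup>2 * (1 + k\<^sup>2 * (ln y / y)))" using d by (intro mult_left_mono) auto
    then show ?thesis using * by (simp add: mult.assoc)
  next
    fix z assume z: "1 \<le> z" and R: "rho (signed_adjacency n E \<sigma>) = ?a * (z + 1 / z)"
      and sq: "((?a * z) ^ ?T / 2)\<^sup>2 \<le> (\<Sum>u<n. \<Sum>v<n. (walk_sum E \<sigma> ?T u v)\<^sup>2)"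
    let ?B = "1 + (real q + 1)\<^sup>2 * (2 * real l * (2 * real q + 1) ^ (3 * r0))"
    let ?G = "real (M + 1) * real (F + 1) * (real d - 1) ^ L * (real d * (real M)\<^sup>2) ^ F"
    let ?D = "(1 + \<delta>) ^ (2 * q)"
    define h where "h = k / real N"
    have sub': "subcritical r0 \<delta> l {..<n} E" using sub by (simp add: l_def y_def)
    have D1: "1 \<le> ?D" using \<delta> by simp
    have WB: "walk_bound r0 \<delta> l q \<le> ?B * ?D"
    proof -
      have "walk_bound r0 \<delta> l q = 1 + (real q + 1)\<^sup>2 * (2 * real l * (2 * real q + 1) ^ (3 * r0)) * ?D"
        by (simp add: walk_bound_def mult_ac)
      then show ?thesis using D1 by (simp add: distrib_right)
    qed
    have W0: "0 \<le> walk_bound r0 \<delta> l q"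
      unfolding walk_bound_def using \<delta> by (intro add_nonneg_nonneg mult_nonneg_nonneg) auto
    have "((?a * z) ^ ?T / 2)\<^sup>2 \<le> (\<Sum>x<n. real ((M + 1) * (F + 1) * ((d - 1) ^ M * (d * M\<^sup>2) ^ F)) * (2 * real M * walk_bound r0 \<delta> l q) ^ (2 * N))"
      using order_trans[OF sq avg] unfolding F_def
      by (rule order_trans) (use d in \<open>intro sum_mono card_pairs[OF sub' VE reg _ \<delta> q0 q1 N1 M1]; simp\<close>)
    also have "\<dots> = real n * (real ((M + 1) * (F + 1) * ((d - 1) ^ M * (d * M\<^sup>2) ^ F)) * (2 * real M * walk_bound r0 \<delta> l q) ^ (2 * N))"
      by simp
    also have "real ((M + 1) * (F + 1) * ((d - 1) ^ M * (d * M\<^sup>2) ^ F)) = (real d - 1) ^ ?T * ?G"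
    proof -
      have dd: "real (d - 1) = real d - 1" using d by simp
      have pM: "(real d - 1) ^ M = (real d - 1) ^ ?T * (real d - 1) ^ L" by (simp only: M_def power_add)
      show ?thesis by (simp only: of_nat_mult of_nat_power dd pM mult_ac)
    qed
    also have "real n * ((real d - 1) ^ ?T * ?G * (2 * real M * walk_bound r0 \<delta> l q) ^ (2 * N))
      \<le> real n * ((real d - 1) ^ ?T * ?G * ((2 * real M * ?B) * ?D) ^ (2 * N))"
    proof (intro mult_left_mono power_mono)
      show "2 * real M * walk_bound r0 \<delta> l q \<le> (2 * real M * ?B) * ?D"
        using mult_left_mono[OF WB, of "2 * real M"] by (simp add: mult.assoc)
    qed (use W0 d in auto)
    also have "\<dots> = (real d - 1) ^ ?T * (1 + \<delta>) ^ (4 * ?T) * (exp y * ?G * (2 * real M * ?B) ^ (2 * N))"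
    proof -
      \<comment> \<open>There are \<open>2 * N\<close> pieces, each with exponent
        \<open>2 * q\<close>; the root of order \<open>2 * ?T\<close> will leave
        \<open>(1 + \<delta>)^2\<close>.\<close>
      have DN: "?D ^ (2 * N) = (1 + \<delta>) ^ (4 * ?T)"
        unfolding power_mult[symmetric] by (rule arg_cong[of _ _ "\<lambda>i. (1 + \<delta>) ^ i"]) simp
      have ny: "real n = exp y" using n by (simp add: y_def)
      show ?thesis unfolding power_mult_distrib[of "2 * real M * ?B"] DN ny by (simp only: mult_ac)
    qed
    finally have as: "((?a * z) ^ ?T / 2)\<^sup>2 \<le> (real d - 1) ^ ?T * (1 + \<delta>) ^ (4 * ?T) * (exp y * ?G * (2 * real M * ?B) ^ (2 * N))" .
    have a2: "?a\<^sup>2 = real d - 1" using d by simp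
    have "(?a\<^sup>2) ^ ?T * z ^ (2 * ?T) = ((?a * z) ^ ?T)\<^sup>2"
      unfolding power_mult_distrib power_mult[symmetric] by (simp only: mult.commute[of 2])
    then have "(real d - 1) ^ ?T * z ^ (2 * ?T) = 4 * ((?a * z) ^ ?T / 2)\<^sup>2"
      unfolding a2 by (simp add: power_divide)
    also have "\<dots> \<le> 4 * ((real d - 1) ^ ?T * (1 + \<delta>) ^ (4 * ?T) * (exp y * ?G * (2 * real M * ?B) ^ (2 * N)))"
      using as by (rule mult_left_mono) simp
    also have "\<dots> = (real d - 1) ^ ?T * ((1 + \<delta>) ^ (4 * ?T) * (4 * exp y * ?G * (2 * real M * ?B) ^ (2 * N)))"
      by (simp only: mult_ac)
    finally have "(real d - 1) ^ ?T * z ^ (2 * ?T) \<le> (real d - 1) ^ ?T * ((1 + \<delta>) ^ (4 * ?T) * (4 * exp y * ?G * (2 * real M * ?B) ^ (2 * N)))" .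
    moreover have "0 < (real d - 1) ^ ?T" using d by simp
    ultimately have "z ^ (2 * ?T) \<le> (1 + \<delta>) ^ (4 * ?T) * (4 * exp y * ?G * (2 * real M * ?B) ^ (2 * N))"
      by (rule mult_left_le_imp_le)
    also have "\<dots> \<le> (1 + \<delta>) ^ (4 * ?T) * exp ((1 + 4 * (70 + real L + 40 * real r0)) * y)"
      using walk_pair_count_growth[OF y(1-4) N1 N2 q1 ql l(2)] d \<delta> unfolding M_def F_def
      by (intro mult_left_mono) auto
    finally have z1: "z ^ (2 * ?T) \<le> (1 + \<delta>) ^ (4 * ?T) * exp ((1 + 4 * (70 + real L + 40 * real r0)) * y)" .
    \<comment> \<open>The choice of \<open>k\<close> is made here: \<open>2 * ?T * h\<close> equals
      \<open>2 * q * k\<close>, and \<open>q * (r0 + 2)\<close> is at least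
      \<open>y\<close>.\<close>
    have "(1 + 4 * (70 + real L + 40 * real r0)) * y \<le> real (2 * ?T) * h"
    proof -
      have "(1 + 4 * (70 + real L + 40 * real r0)) * y \<le> (1 + 4 * (70 + real L + 40 * real r0)) * (real q * (real r0 + 2))"
        using qy by (intro mult_left_mono) auto
      also have "\<dots> = real (2 * ?T) * h" using N1 by (simp add: h_def k_def)
      finally show ?thesis .
    qed
    then have "(1 + \<delta>) ^ (4 * ?T) * exp ((1 + 4 * (70 + real L + 40 * real r0)) * y) \<le> (1 + \<delta>) ^ (4 * ?T) * exp (real (2 * ?T) * h)"
      using \<delta> by (intro mult_left_mono) auto
    also have "\<dots> = ((1 + \<delta>)\<^sup>2 * exp h) ^ (2 * ?T)"
      unfolding power_mult_distrib exp_of_nat_mult power_mult[symmetric] by simp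
    finally have zp: "z ^ (2 * ?T) \<le> ((1 + \<delta>)\<^sup>2 * exp h) ^ (2 * ?T)" using z1 by (rule order_trans[rotated])
    have zle: "z \<le> (1 + \<delta>)\<^sup>2 * exp h"
    proof (rule ccontr)
      assume "\<not> z \<le> (1 + \<delta>)\<^sup>2 * exp h"
      then have "((1 + \<delta>)\<^sup>2 * exp h) ^ (2 * ?T) < z ^ (2 * ?T)"
        using N1 q1 by (intro power_strict_mono) auto
      then show False using zp by simp
    qed
    have k0: "0 \<le> k" by (simp add: k_def)
    have h0: "0 \<le> h" by (simp add: h_def k0)
    have h2: "h\<^sup>2 \<le> k\<^sup>2 * (ln y / y)"
    proof -
      have "0 < real N" "0 < sqrt (y / ln y)" using N1 s1 by linarith+
      then have "h \<le> k / sqrt (y / ln y)"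
        unfolding h_def using Ns(1) k0 by (intro divide_left_mono mult_pos_pos)
      then have "h\<^sup>2 \<le> (k / sqrt (y / ln y))\<^sup>2" using h0 by (rule power_mono)
      then show ?thesis using yl by (simp add: power_divide)
    qed
    then have "h\<^sup>2 \<le> 1\<^sup>2" using y(5) by simp
    then have h1: "h \<le> 1" by (rule power2_le_imp_le) simp
    have "z + 1 / z \<le> 2 * (1 + \<delta>)\<^sup>2 * (1 + h\<^sup>2)" using z Y1 h0 h1 zle by (rule add_inverse_le_if_le_mult_exp)
    also have "\<dots> \<le> 2 * (1 + \<delta>)\<^sup>2 * (1 + k\<^sup>2 * (ln y / y))" using h2 by (intro mult_left_mono) auto
    finally have "?a * (z + 1 / z) \<le> ?a * (2 * (1 + \<delta>)\<^sup>2 * (1 + k\<^sup>2 * (ln y / y)))"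
      using d by (intro mult_left_mono) auto
    then show ?thesis unfolding R by (simp only: mult_ac)
  qed
  show ?thesis using \<sigma> rho by blast
qed

text \<open>Makes \<open>ln (ln 3)\<close> positive, so that the error term stays away from 0
  between \<open>n = 3\<close> and any threshold. The fourth power of the bound for
  \<open>exp (1 / 4)\<close> is about 2.97.\<close>

lemma exp_1_less_3: "exp 1 < (3 :: real)"
proof -
  have "exp (1 / 4 :: real) \<le> 1 + 1 / 4 + (1 / 4)\<^sup>2" by (rule exp_bound) auto
  then have "exp (1 / 4 :: real) ^ 4 \<le> (1 + 1 / 4 + (1 / 4)\<^sup>2) ^ 4" by (intro power_mono) auto
  also have "\<dots> < 3" by (simp add: power2_eq_square eval_nat_numeral)
  finally show ?thesis by (simp add: exp_of_nat_mult[symmetric])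
qed

text \<open>If degrees are at most 1, only a single neighbour can be reached from vertex 0, but the
  vertices 1 and 2 both have to be.\<close>

lemma degree_ge_2:
  fixes E :: "nat set set"
  assumes n: "3 \<le> n" and VE: "simple_graph {..<n} E" and con: "graph_connected {..<n} E" and reg: "regular_graph d {..<n} E"
  shows "2 \<le> d"
proof (rule ccontr)
  assume "\<not> 2 \<le> d"
  then have d1: "d \<le> Suc 0" by simp
  have uniq: "v = v'" if "{u, v} \<in> E" "{u, v'} \<in> E" for u v v'
  proof -
    have "finite {v. {u, v} \<in> E}" by (rule finite_neighbours[OF VE])
    moreover have "card {v. {u, v} \<in> E} \<le> Suc 0"
      using card_neighbours_le[OF VE reg] d1 by (rule order_trans)
    ultimately have "\<forall>a\<in>{v. {u, v} \<in> E}. \<forall>b\<in>{v. {u, v} \<in> E}. a = b" by (simp only: card_le_Suc0_iff_eq)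
    then show ?thesis using that by blast
  qed
  have reach: "v = 0 \<or> {0, v} \<in> E" if "(0, v) \<in> {(x, y). {x, y} \<in> E}\<^sup>*" for v
    using that
  proof (induction rule: rtrancl_induct)
    case (step v w)
    then have "{v, w} \<in> E" by simp
    then show ?case using step(3) uniq[of v w 0] by (auto simp: insert_commute)
  qed simp
  have "(0, 1) \<in> {(x, y). {x, y} \<in> E}\<^sup>*" "(0, 2) \<in> {(x, y). {x, y} \<in> E}\<^sup>*"
    using con n by (auto simp: graph_connected_def)
  then have "{0, 1} \<in> E" "{0, 2} \<in> E" using reach by fastforce+
  then show False using uniq[of 0 1 2] by simp
qed

lemma large_threshold_exists:
  fixes k a b c :: real
  shows "\<exists>y0\<ge>1. \<forall>y\<ge>y0. 1 \<le> ln y \<and> a \<le> y \<and> b \<le> y \<and> c \<le> y \<and> k\<^sup>2 * (ln y / y) \<le> 1"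
proof -
  have "((\<lambda>y. k\<^sup>2 * (ln y / y)) \<longlongrightarrow> k\<^sup>2 * 0) at_top"
    by (intro tendsto_mult_left ln_x_over_x_tendsto_0) 
  then have "eventually (\<lambda>y. k\<^sup>2 * (ln y / y) < 1) at_top" by (simp add: order_tendsto_iff)
  moreover have "eventually (\<lambda>y :: real. 1 \<le> ln y) at_top" using ln_at_top by (simp add: filterlim_at_top)
  ultimately have "eventually (\<lambda>y. 1 \<le> ln y \<and> a \<le> y \<and> b \<le> y \<and> c \<le> y \<and> k\<^sup>2 * (ln y / y) \<le> 1) at_top"
    using eventually_ge_at_top[of a] eventually_ge_at_top[of b] eventually_ge_at_top[of c] by eventually_elim auto
  then obtain y0 where "\<forall>y\<ge>y0. 1 \<le> ln y \<and> a \<le> y \<and> b \<le> y \<and> c \<le> y \<and> k\<^sup>2 * (ln y / y) \<le> 1"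
    by (auto simp: eventually_at_top_linorder)
  then show ?thesis by (intro exI[of _ "max 1 y0"]) auto
qed

theorem proposition24:
  fixes r0 d :: nat and \<delta> \<Lambda> :: real
  assumes "\<delta> \<ge> 0"
  shows "\<exists>K\<ge>0. \<forall>(L::real) (n::nat) (E::nat set set) (\<C>::nat set set set).
    n \<ge> 3 \<longrightarrow>
    simple_graph {..<n} E \<longrightarrow>
    graph_connected {..<n} E \<longrightarrow>
    regular_graph d {..<n} E \<longrightarrow>
    subcritical r0 \<delta> (2 * nat \<lceil>ln (real n)\<rceil>) {..<n} E \<longrightarrow>
    (\<forall>C\<in>\<C>. even_cycle E C \<and> real (card C) \<le> L) \<longrightarrow>
    consistent E \<C> \<longrightarrow>
    real (max_weight E (cycle_span \<C>)) \<le> \<Lambda> \<longrightarrow>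
    (\<exists>\<sigma> \<in> solution_family E \<C>.
       rho (signed_adjacency n E \<sigma>)
         \<le> 2 * sqrt (real d - 1) * (1 + \<delta>) ^ (4 * (r0 + 2))
             * (1 + K * (ln (ln (real n)) / ln (real n))))"
proof -
  \<comment> \<open>A natural number in place of \<open>\<Lambda>\<close>. The constants
    \<open>k\<close>, \<open>y0\<close> and \<open>K\<close> are built from \<open>W\<close>,
    \<open>r0\<close> and \<open>d\<close> before the graph is chosen.\<close>
  define W where "W = nat \<lceil>\<Lambda>\<rceil>"
  define k where "k = (1 + 4 * (70 + real W + 40 * real r0)) * (real r0 + 2) / 2"
  obtain y0 where y0: "1 \<le> y0" "\<And>y. y0 \<le> y \<Longrightarrow> 1 \<le> ln y \<and> real W + 10 \<le> y \<and> 16 * real r0 + 25 \<le> y \<and>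
      real d \<le> y \<and> k\<^sup>2 * (ln y / y) \<le> 1"
    using large_threshold_exists[of "real W + 10" "16 * real r0 + 25" "real d" k] by blast
  have "ln (exp 1) < ln (3::real)" using exp_1_less_3 by (subst ln_less_cancel_iff) auto
  then have ln3: "1 < ln (3::real)" by simp
  have lln3: "0 < ln (ln (3::real))" using ln3 by simp
  \<comment> \<open>The first entry serves \<open>ln n >= y0\<close>; the second makes the claimed
    bound exceed \<open>d\<close> for all smaller \<open>n\<close>.\<close>
  define K where "K = max (k\<^sup>2) (real d * (y0 / ln (ln 3)))"
  have K0: "0 \<le> K" by (simp add: K_def le_max_iff_disj)
  show ?thesis
  proof (intro exI[of _ K] conjI K0 allI impI)
    fix L :: real and n :: nat and E :: "nat set set" and \<C> :: "nat set set set"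
    assume n: "3 \<le> n" and VE: "simple_graph {..<n} E" and con: "graph_connected {..<n} E"
      and reg: "regular_graph d {..<n} E" and sub: "subcritical r0 \<delta> (2 * nat \<lceil>ln (real n)\<rceil>) {..<n} E"
      and cyc: "\<forall>C\<in>\<C>. even_cycle E C \<and> real (card C) \<le> L" and cons: "consistent E \<C>"
      and wt: "real (max_weight E (cycle_span \<C>)) \<le> \<Lambda>"
    let ?y = "ln (real n)"
    have d2: "2 \<le> d" by (rule degree_ge_2[OF n VE con reg])
    have C: "C \<subseteq> E" if "C \<in> \<C>" for C using cyc that by (auto simp: even_cycle_def is_cycle_def)
    have y3: "ln 3 \<le> ?y" using n by simp
    have y1: "1 < ?y" using y3 ln3 by linarith
    have lny: "ln (ln 3) \<le> ln ?y" using y3 ln3 by simp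
    have ratio: "0 \<le> ln ?y / ?y" using lny lln3 y1 by simp
    have a1: "1 \<le> sqrt (real d - 1)" using d2 by simp
    have D1: "1 \<le> (1 + \<delta>) ^ (4 * (r0 + 2))" using assms by simp
    \<comment> \<open>The argument gives the exponent 2; here it is relaxed to that of the
      theorem.\<close>
    have D2: "(1 + \<delta>)\<^sup>2 \<le> (1 + \<delta>) ^ (4 * (r0 + 2))" using assms by (intro power_increasing) auto
    let ?b = "2 * sqrt (real d - 1) * (1 + \<delta>) ^ (4 * (r0 + 2)) * (1 + K * (ln ?y / ?y))"
    show "\<exists>\<sigma> \<in> solution_family E \<C>. rho (signed_adjacency n E \<sigma>) \<le> ?b"
    \<comment> \<open>If the bound is at least \<open>d\<close>, any solution will do. Otherwise
      \<open>d\<close> and \<open>n\<close> are forced to be large enough for the main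
      argument.\<close>
    proof (cases "real d \<le> ?b")
      case True
      obtain s where s: "s \<in> solutions E \<C>" using solutions_nonempty[OF cons] by blast
      define \<sigma> where "\<sigma> e = sgnb (s e)" for e
      have \<sigma>: "\<sigma> \<in> solution_family E \<C>" using sgnb_solution[OF s] by (simp add: \<sigma>_def[abs_def])
      then have "rho (signed_adjacency n E \<sigma>) \<le> real d"
        using n by (intro rho_le_degree[OF _ VE reg]) (auto simp: solution_family_def)
      then show ?thesis using True \<sigma> by (meson order_trans)
    next
      case False
      have base: "1 * 1 \<le> sqrt (real d - 1) * (1 + \<delta>) ^ (4 * (r0 + 2))" using a1 D1 by (intro mult_mono) auto
      have Kr: "0 \<le> K * (ln ?y / ?y)" using K0 ratio by (rule mult_nonneg_nonneg)
      have Kn: "0 \<le> 1 + K * (ln ?y / ?y)" using Kr by linarith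
      have b2: "2 * (1 + K * (ln ?y / ?y)) \<le> ?b"
        using mult_right_mono[OF base Kn] by (simp only: mult_1 mult.assoc mult_le_cancel_left_pos zero_less_numeral)
      have "?b < real d" using False by simp
      with b2 have small: "2 * (1 + K * (ln ?y / ?y)) < real d" by (rule le_less_trans)
      define X where "X = K * (ln ?y / ?y)"
      \<comment> \<open>For \<open>d = 2\<close> the bound is at least \<open>2 = d\<close>, which
        belongs to the other case.\<close>
      have d3: "3 \<le> d"
      proof (rule ccontr)
        assume "\<not> 3 \<le> d"
        then have "real d = 2" using d2 by simp
        then show False using small Kr unfolding X_def[symmetric] distrib_left mult_1_right by linarith
      qed
      \<comment> \<open>Below \<open>y0\<close> the ratio \<open>ln ?y / ?y\<close> is at least
        \<open>ln (ln 3) / y0\<close>, so the second entry of \<open>K\<close> lifts the bound above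
        \<open>d\<close>.\<close>
      have yy0: "y0 \<le> ?y"
      proof (rule ccontr)
        assume "\<not> y0 \<le> ?y"
        then have lt: "?y < y0" by simp
        have "real d = real d * (y0 / ln (ln 3)) * (ln (ln 3) / y0)" using lln3 y0(1) by simp
        also have "\<dots> \<le> K * (ln ?y / ?y)"
        proof (rule mult_mono)
          show "real d * (y0 / ln (ln 3)) \<le> K" by (simp add: K_def)
          show "ln (ln 3) / y0 \<le> ln ?y / ?y" using lny lln3 lt y1 by (intro frac_le) auto
        qed (use K0 lln3 y0(1) in auto)
        finally show False using small Kr unfolding X_def[symmetric] distrib_left mult_1_right by linarith
      qed
      have mw: "max_weight E (cycle_span \<C>) \<le> W" using wt unfolding W_def by linarith
      have kn: "0 \<le> k\<^sup>2 * (ln ?y / ?y)" using ratio by (intro mult_nonneg_nonneg) auto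
      have kn1: "0 \<le> 1 + k\<^sup>2 * (ln ?y / ?y)" using add_nonneg_nonneg[OF zero_le_one kn] .
      have "\<exists>\<sigma>\<in>solution_family E \<C>. rho (signed_adjacency n E \<sigma>)
        \<le> 2 * sqrt (real d - 1) * (1 + \<delta>)\<^sup>2 * (1 + k\<^sup>2 * (ln ?y / ?y))"
        unfolding k_def
      proof (rule exists_signing_if_large[OF _ VE reg sub C cons mw assms d3])
        show "0 < n" using n by simp
      qed (use y0(2)[OF yy0] in \<open>simp_all add: k_def\<close>)
      moreover have "2 * sqrt (real d - 1) * (1 + \<delta>)\<^sup>2 * (1 + k\<^sup>2 * (ln ?y / ?y)) \<le> ?b"
      proof (intro mult_mono add_left_mono D2)
        show "k\<^sup>2 \<le> K" by (simp add: K_def)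
      qed (use ratio a1 K0 Kn kn1 assms in simp_all)
      ultimately show ?thesis by (meson order_trans)
    qed
  qed
qed

end
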